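(* For the Manhattan model on the cylinders $\mathcal C_n$ and every fixed $p\in(0,1)$, there are constants $C=C(p)<\infty$ and $n_*=n_*(p)<\infty$ such that, for all integers $n\ge n_*$ and all $M\ge Cn^{10}$, $$\mathbb P_p^{\mathrm M}\bigl(B_n^{(M)}\bigr)\ge 1-C\exp\left\{-\frac{M}{Cn^{10}}\right\}.$$
   Context: Cylinder: for an integer $n\ge1$, $\mathcal C_n=\mathbb Z\times(\mathbb Z/2n\mathbb Z)$ (quotient of $\mathbb Z^2$ by translation by $(0,2n)$; its edges are the images of the nearest-neighbor edges of $\mathbb Z^2$). Mirrors and trajectories: each vertex has four incident half-edges $N,E,S,W$ (pointing in directions $(0,1),(1,0),(0,-1),(-1,0)$). A one-site state is one of: no mirror, pairing $(N,S)(E,W)$; a north-west (NW) mirror (a diagonal segment along the NW--SE direction), pairing $(N,E)(S,W)$; a north-east (NE) mirror (along the NE--SW direction), pairing $(N,W)(S,E)$. A ray arriving at a vertex along a half-edge leaves along the half-edge paired with it. A directed edge is an ordered pair $(u,v)$ of nearest neighbors along an edge; together with the environment (a state at each vertex) it determines a trajectory, i.e. the sequence of directed edges starting with $(u,v)$ and following this rule at each vertex; $u$ is its initial vertex. A trajectory remains in a set if all its vertices lie in it. Manhattan law $\mathbb P_p^{\mathrm M}$: independently at each vertex $(x,y)$, a mirror with probability $p$ and no mirror with probability $1-p$; a mirror at $(x,y)$ is NW if $x-y$ is even and NE otherwise (well defined on $\mathcal C_n$ since $2n$ is even). Localization event: for $M\ge1$, $B_n^{(M)}$ is the event that every trajectory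 whose initial vertex lies in $\{0\}\times(\mathbb Z/2n\mathbb Z)$ remains in $[-M,M]\times(\mathbb Z/2n\mathbb Z)$. *)

theory Defs
  imports "HOL-Probability.Probability"
begin

datatype half_edge = North | East | South | West

datatype site_state = No_Mirror | NW_Mirror | NE_Mirror

fun opposite :: "half_edge \<Rightarrow> half_edge" where
  "opposite North = South"
| "opposite South = North"
| "opposite East = West"
| "opposite West = East"

fun paired :: "site_state \<Rightarrow> half_edge \<Rightarrow> half_edge" where
  "paired No_Mirror h = opposite h"
| "paired NW_Mirror North = East"
| "paired NW_Mirror East = North"
| "paired NW_Mirror South = West"
| "paired NW_Mirror West = South"
| "paired NE_Mirror North = West"
| "paired NE_Mirror West = North"
| "paired NE_Mirror South = East"
| "paired NE_Mirror East = South"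

type_synonym vertex = "int \<times> int"

text \<open>Classes in \<open>\<int>/2n\<int>\<close> are represented by their representatives in \<open>{0..<2n}\<close>.\<close>

definition cylinder :: "nat \<Rightarrow> vertex set" where
  "cylinder n = UNIV \<times> {0..<2 * int n}"

fun neighbour :: "nat \<Rightarrow> vertex \<Rightarrow> half_edge \<Rightarrow> vertex" where
  "neighbour n (x, y) North = (x, (y + 1) mod (2 * int n))"
| "neighbour n (x, y) East = (x + 1, y)"
| "neighbour n (x, y) South = (x, (y - 1) mod (2 * int n))"
| "neighbour n (x, y) West = (x - 1, y)"

text \<open>A directed edge from \<open>u\<close> to \<open>v\<close> is encoded by \<open>u\<close> and the half-edge at \<open>u\<close> along which
  it leaves, so that \<open>v = neighbour n u h\<close>. Unlike the pair \<open>(u, v)\<close>, this also separates the two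
  parallel vertical edges between vertically adjacent vertices when \<open>n = 1\<close>.\<close>

type_synonym directed_edge = "vertex \<times> half_edge"

type_synonym environment = "vertex \<Rightarrow> site_state"

text \<open>A ray leaving \<open>u\<close> along the half-edge \<open>h\<close> arrives at the next vertex along the half-edge
  \<open>opposite h\<close> of that vertex.\<close>

definition next_edge :: "nat \<Rightarrow> environment \<Rightarrow> directed_edge \<Rightarrow> directed_edge" where
  "next_edge n \<omega> = (\<lambda>(u, h). let v = neighbour n u h in (v, paired (\<omega> v) (opposite h)))"

definition trajectory :: "nat \<Rightarrow> environment \<Rightarrow> directed_edge \<Rightarrow> nat \<Rightarrow> directed_edge" where
  "trajectory n \<omega> e k = (next_edge n \<omega> ^^ k) e"

text \<open>Trajectories are infinite, so their vertices are exactly the initial vertices of their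
  edges.\<close>

definition remains_in :: "(nat \<Rightarrow> directed_edge) \<Rightarrow> vertex set \<Rightarrow> bool" where
  "remains_in \<gamma> S \<longleftrightarrow> (\<forall>k. fst (\<gamma> k) \<in> S)"

definition manhattan_site :: "real \<Rightarrow> vertex \<Rightarrow> site_state pmf" where
  "manhattan_site p = (\<lambda>(x, y).
     map_pmf (\<lambda>mirror. if mirror then (if even (x - y) then NW_Mirror else NE_Mirror) else No_Mirror)
       (bernoulli_pmf p))"

definition manhattan_law :: "real \<Rightarrow> nat \<Rightarrow> environment measure" where
  "manhattan_law p n = PiM (cylinder n) (\<lambda>v. measure_pmf (manhattan_site p v))"

definition strip :: "nat \<Rightarrow> real \<Rightarrow> vertex set" where
  "strip n M = {(x, y) \<in> cylinder n. - M \<le> of_int x \<and> of_int x \<le> M}"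

definition localization_event :: "nat \<Rightarrow> real \<Rightarrow> environment set" where
  "localization_event n M =
     {\<omega> \<in> cylinder n \<rightarrow>\<^sub>E UNIV.
        \<forall>u \<in> {0} \<times> {0..<2 * int n}. \<forall>h. remains_in (trajectory n \<omega> (u, h)) (strip n M)}"

lemma prob_space_manhattan_law: "prob_space (manhattan_law p n)"
  unfolding manhattan_law_def by (intro prob_space_PiM prob_space_measure_pmf)

lemma space_manhattan_law: "space (manhattan_law p n) = cylinder n \<rightarrow>\<^sub>E UNIV"
  by (simp add: manhattan_law_def space_PiM)

instance half_edge :: countable by countable_datatype

lemma measurable_next_edge:
  "(\<lambda>\<omega>. next_edge n \<omega> e) \<in> measurable (manhattan_law p n) (count_space UNIV)"
proof -
  obtain u h where e: "e = (u, h)" by (cases e)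
  define v where "v = neighbour n u h"
  have comp: "(\<lambda>\<omega>. \<omega> v) \<in> measurable (manhattan_law p n) (count_space UNIV)"
  proof (cases "v \<in> cylinder n")
    case True
    then have "(\<lambda>\<omega>. \<omega> v) \<in> measurable (manhattan_law p n) (measure_pmf (manhattan_site p v))"
      unfolding manhattan_law_def by (rule measurable_component_singleton)
    then show ?thesis using measurable_cong_sets[OF refl sets_measure_pmf_count_space, of "manhattan_law p n" "manhattan_site p v"]
      by blast
  next
    case False
    have "\<omega> v = undefined" if "\<omega> \<in> space (manhattan_law p n)" for \<omega>
      using PiE_arb[of \<omega> "cylinder n"] that False unfolding space_manhattan_law by blast
    then have "(\<lambda>\<omega>. \<omega> v) \<in> measurable (manhattan_law p n) (count_space UNIV) \<longleftrightarrow>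
        (\<lambda>\<omega>. undefined :: site_state) \<in> measurable (manhattan_law p n) (count_space UNIV)"
      by (rule measurable_cong)
    then show ?thesis by simp
  qed
  have "(\<lambda>\<omega>. (\<lambda>s. (v, paired s (opposite h))) (\<omega> v)) \<in> measurable (manhattan_law p n) (count_space UNIV)"
    by (rule measurable_compose[OF comp]) simp
  then show ?thesis by (simp add: e next_edge_def v_def Let_def)
qed

lemma measurable_trajectory:
  "(\<lambda>\<omega>. trajectory n \<omega> e k) \<in> measurable (manhattan_law p n) (count_space UNIV)"
proof (induction k)
  case 0
  then show ?case by (simp add: trajectory_def)
next
  case (Suc k)
  have "(\<lambda>\<omega>. next_edge n \<omega> (trajectory n \<omega> e k)) \<in> measurable (manhattan_law p n) (count_space UNIV)"
    by (rule measurable_compose_countable[OF measurable_next_edge Suc])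
  then show ?case by (simp add: trajectory_def)
qed

lemma sets_localization_event: "localization_event n M \<in> sets (manhattan_law p n)"
proof -
  let ?R = "\<lambda>u h k \<omega>. u \<in> {0} \<times> {0..<2 * int n} \<longrightarrow> fst (trajectory n \<omega> (u, h) k) \<in> strip n M"
  have "{\<omega> \<in> space (manhattan_law p n). ?R u h k \<omega>} \<in> sets (manhattan_law p n)" for u h k
  proof -
    have "(\<lambda>\<omega>. trajectory n \<omega> (u, h) k) -` {e. u \<in> {0} \<times> {0..<2 * int n} \<longrightarrow> fst e \<in> strip n M}
        \<inter> space (manhattan_law p n) \<in> sets (manhattan_law p n)"
      by (rule measurable_sets[OF measurable_trajectory]) simp
    moreover have "{\<omega> \<in> space (manhattan_law p n). ?R u h k \<omega>} =
        (\<lambda>\<omega>. trajectory n \<omega> (u, h) k) -` {e. u \<in> {0} \<times> {0..<2 * int n} \<longrightarrow> fst e \<in> strip n M}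
        \<inter> space (manhattan_law p n)"
      by blast
    ultimately show ?thesis by simp
  qed
  then have "{\<omega> \<in> space (manhattan_law p n). \<forall>u h k. ?R u h k \<omega>} \<in> sets (manhattan_law p n)"
    by (intro sets.sets_Collect_countable_All)
  moreover have "localization_event n M = {\<omega> \<in> space (manhattan_law p n). \<forall>u h k. ?R u h k \<omega>}"
    unfolding localization_event_def space_manhattan_law remains_in_def by blast
  ultimately show ?thesis by (simp only:)
qed

end

theory Submission
  imports Defs
begin

text \<open>Unroll the cylinder to the plane and call a ray entering a slab of columns from the left a crossing
  if it leaves on the right. As many crossings follow the Manhattan orientation as oppose it, and extending
  the slab can only destroy crossings. A fresh slab of length \<open>T\<close> destroys one as soon as it reflects the
  outgoing end of a crossing of the first kind into that of a crossing of the second kind.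

  Let \<open>m\<close> be the probability that a given ray crosses a slab of length \<open>T\<close>, so that \<open>m \<ge> 1 / (2n)\<close> while
  crossings persist. Draw the rays of the two ends in independent environments. Such a ray
  crosses with probability \<open>m\<close>, and given this, with probability of order \<open>m\<close> there are of order \<open>m T\<close> columns which
  it passes only once and where a local change displaces the rest of the path by two rows. For
  \<open>T\<close> of order \<open>n\<^sup>3\<close> this is of order \<open>n\<^sup>2\<close>, so that the exit row fluctuates by more than \<open>2n\<close>, and two such
  rays have to meet with probability of order \<open>m\<^sup>3\<close>. Up to the first meeting the independent rays look
  like rays of a single environment, and the state of the meeting point decides whether they are joined;
  summing over the \<open>2nT\<close> possible meeting points, a crossing is lost with probability of order
  \<open>m\<^sup>3 / (n T)\<close>. Since the expected number of crossings starts at \<open>n m\<close>, after of order \<open>n\<^sup>7\<close>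
  slabs of length \<open>T\<close>, that is \<open>n\<^sup>1\<^sup>0\<close> columns, there is no crossing with probability at least 1/2.
  Independent blocks of that length give the exponential bound.\<close>

subsection \<open>Finite products of Bernoulli variables\<close>

text \<open>Each vertex carries one bit, since the parity of x - y fixes the type of a mirror; a
  configuration is the finite set of its mirrors, and probabilities are finite weighted sums up to
  the final transfer to the product measure. The obstacle is dependence: the exit row of one ray can
  be dispersed, but two rays in one environment are correlated. So the meeting is produced for
  independent copies and only then moved into one environment by a weight-preserving exchange.
  Orientation makes a meeting useful: at a vertex the oriented ray has two possible exits, the
  reversal of a ray of the other kind leaves along one of them, and the bit selects the exit. As for
  the exponents, a loss of order m^3 / (n T) per slab can be paid from n m for at most order n^2 T /
  m^2 slabs, which is n^7 when m is at least of order 1 / n and T of order n^3; starting from n m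
  and not from n saves a factor n. The order n^3 of T comes from asking m T to be of order n^2 in
  the worst case m of order 1 / n.\<close>

definition expect :: "real \<Rightarrow> 'a set \<Rightarrow> ('a set \<Rightarrow> real) \<Rightarrow> real" where
  "expect p V F = (\<Sum>B\<in>Pow V. (\<Prod>v\<in>V. if v \<in> B then p else 1 - p) * F B)"

abbreviation prb :: "real \<Rightarrow> 'a set \<Rightarrow> ('a set \<Rightarrow> bool) \<Rightarrow> real" where
  "prb p V A \<equiv> expect p V (\<lambda>B. of_bool (A B))"

lemma expect_empty [simp]: "expect p {} F = F {}"
  by (simp add: expect_def)

lemma expect_insert:
  assumes "finite V" "v \<notin> V"
  shows "expect p (insert v V) F = p * expect p V (\<lambda>B. F (insert v B)) + (1 - p) * expect p V F"
proof -
  have i: "inj_on (insert v) (Pow V)"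
    using assms by (auto simp: inj_on_def)
  have d: "Pow V \<inter> insert v ` Pow V = {}"
    using assms by auto
  have a: "(\<Prod>w\<in>insert v V. if w \<in> B then p else 1 - p) = (1 - p) * (\<Prod>w\<in>V. if w \<in> B then p else 1 - p)"
    if "B \<in> Pow V" for B using that assms by auto
  have b: "(\<Prod>w\<in>insert v V. if w \<in> insert v B then p else 1 - p) = p * (\<Prod>w\<in>V. if w \<in> B then p else 1 - p)"
    if "B \<in> Pow V" for B
  proof -
    have "(\<Prod>w\<in>V. if w \<in> insert v B then p else 1 - p) = (\<Prod>w\<in>V. if w \<in> B then p else 1 - p)"
      using assms by (intro prod.cong) auto
    then show ?thesis using assms by simp
  qed
  show ?thesis
    unfolding expect_def Pow_insert
    apply (subst sum.union_disjoint)
    using assms d apply auto[3]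
    apply (subst sum.reindex[OF i])
    by (simp only: a b sum_distrib_left o_def mult.assoc add.commute cong: sum.cong)
qed

lemma expect_cong:
  assumes "\<And>B. B \<subseteq> V \<Longrightarrow> F B = G B"
  shows "expect p V F = expect p V G"
  unfolding expect_def using assms by (intro sum.cong) auto

lemma expect_add: "expect p V (\<lambda>B. F B + G B) = expect p V F + expect p V G"
  by (simp add: expect_def sum.distrib algebra_simps)

lemma expect_diff: "expect p V (\<lambda>B. F B - G B) = expect p V F - expect p V G"
  by (simp add: expect_def sum_subtractf algebra_simps)

lemma expect_cmult: "expect p V (\<lambda>B. c * F B) = c * expect p V F"
  by (simp add: expect_def sum_distrib_left algebra_simps)

lemma expect_sum: "expect p V (\<lambda>B. \<Sum>i\<in>I. F i B) = (\<Sum>i\<in>I. expect p V (F i))"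
  unfolding expect_def by (subst sum.swap) (simp add: sum_distrib_left)

lemma expect_const [simp]: "finite V \<Longrightarrow> expect p V (\<lambda>_. c) = c"
  by (induction V rule: finite_induct) (simp_all add: expect_insert algebra_simps)

lemma expect_mono:
  assumes "0 \<le> p" "p \<le> 1" "\<And>B. B \<subseteq> V \<Longrightarrow> F B \<le> G B"
  shows "expect p V F \<le> expect p V G"
  unfolding expect_def using assms
  by (intro sum_mono mult_left_mono prod_nonneg) auto

lemma expect_nonneg:
  assumes "0 \<le> p" "p \<le> 1" "\<And>B. B \<subseteq> V \<Longrightarrow> 0 \<le> F B"
  shows "0 \<le> expect p V F"
  unfolding expect_def using assms
  by (intro sum_nonneg mult_nonneg_nonneg prod_nonneg) auto

lemma prb_le_1:
  assumes "0 \<le> p" "p \<le> 1" "finite V"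
  shows "prb p V A \<le> 1"
proof -
  have "prb p V A \<le> expect p V (\<lambda>_. 1)"
    using assms by (intro expect_mono) auto
  then show ?thesis using assms by simp
qed

lemma prb_mono:
  assumes "0 \<le> p" "p \<le> 1" "\<And>B. B \<subseteq> V \<Longrightarrow> A B \<Longrightarrow> A' B"
  shows "prb p V A \<le> prb p V A'"
  using assms by (intro expect_mono) auto

lemma prb_not:
  assumes "finite V"
  shows "prb p V (\<lambda>B. \<not> A B) = 1 - prb p V A"
proof -
  have "prb p V (\<lambda>B. \<not> A B) = expect p V (\<lambda>B. 1 - of_bool (A B))"
    by (intro expect_cong) auto
  then show ?thesis using assms by (simp add: expect_diff)
qed

lemma prb_disj_le:
  assumes "0 \<le> p" "p \<le> 1"
  shows "prb p V (\<lambda>B. A B \<or> A' B) \<le> prb p V A + prb p V A'"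
  unfolding expect_add[symmetric] using assms by (intro expect_mono) auto

lemma prb_ex_le:
  assumes "0 \<le> p" "p \<le> 1" "finite I"
  shows "prb p V (\<lambda>B. \<exists>i\<in>I. A i B) \<le> (\<Sum>i\<in>I. prb p V (A i))"
  unfolding expect_sum[symmetric]
proof (intro expect_mono assms)
  fix B
  show "of_bool (\<exists>i\<in>I. A i B) \<le> (\<Sum>i\<in>I. of_bool (A i B) :: real)"
  proof (cases "\<exists>i\<in>I. A i B")
    case True
    then obtain i where i: "i \<in> I" "A i B" by auto
    have "of_bool (A i B) \<le> (\<Sum>i\<in>I. of_bool (A i B) :: real)"
      by (rule member_le_sum) (use i assms in auto)
    then show ?thesis using i True by simp
  qed (auto intro: sum_nonneg)
qed

lemma expect_union:
  assumes "finite V" "finite W" "V \<inter> W = {}"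
  shows "expect p (V \<union> W) F = expect p V (\<lambda>B. expect p W (\<lambda>C. F (B \<union> C)))"
  using assms
proof (induction V arbitrary: F rule: finite_induct)
  case (insert v V)
  have "v \<notin> V \<union> W" using insert by auto
  then show ?case
    using insert by (simp add: expect_insert Un_assoc[symmetric])
qed simp

lemma expect_reindex:
  assumes "finite V" "inj_on g V"
  shows "expect p (g ` V) F = expect p V (\<lambda>B. F (g ` B))"
  using assms
proof (induction V arbitrary: F rule: finite_induct)
  case (insert v V)
  then have "g v \<notin> g ` V" by (auto simp: inj_on_def)
  then show ?case
    using insert by (simp add: expect_insert)
qed simp

lemma expect_restrict:
  assumes "finite V" "W \<subseteq> V"
  shows "expect p V (\<lambda>B. F (B \<inter> W)) = expect p W F"
proof -
  have V: "V = W \<union> (V - W)" using assms by auto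
  have fin: "finite W" "finite (V - W)" using assms finite_subset by auto
  have "expect p V (\<lambda>B. F (B \<inter> W)) = expect p (W \<union> (V - W)) (\<lambda>B. F (B \<inter> W))"
    using V by simp
  also have "\<dots> = expect p W (\<lambda>B. expect p (V - W) (\<lambda>C. F ((B \<union> C) \<inter> W)))"
    by (rule expect_union) (use fin in auto)
  also have "\<dots> = expect p W (\<lambda>B. expect p (V - W) (\<lambda>C. F B))"
  proof (intro expect_cong)
    fix B C assume "B \<subseteq> W" "C \<subseteq> V - W"
    then have "(B \<union> C) \<inter> W = B" by auto
    then show "F ((B \<union> C) \<inter> W) = F B" by simp
  qed
  finally show ?thesis using fin by simp
qed

lemma expect_singleton: "expect p {v} F = p * F {v} + (1 - p) * F {}"
  using expect_insert[of "{}" v p F] by simp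

lemma expect_split:
  assumes "finite V" "v \<in> V"
  shows "expect p V F = p * expect p (V - {v}) (\<lambda>B. F (insert v B)) + (1 - p) * expect p (V - {v}) F"
  using expect_insert[of "V - {v}" v p F] assms by (simp add: insert_absorb)

lemma prb_absent_present:
  assumes "finite V" "v \<in> V" "w \<in> V" "v \<noteq> w"
  shows "prb p V (\<lambda>B. v \<notin> B \<and> w \<in> B) = p * (1 - p)"
proof -
  have "prb p V (\<lambda>B. v \<notin> B \<and> w \<in> B) = expect p V (\<lambda>B. of_bool (v \<notin> B \<inter> {v, w} \<and> w \<in> B \<inter> {v, w}))"
    by (intro expect_cong) auto
  also have "\<dots> = expect p {v, w} (\<lambda>B. of_bool (v \<notin> B \<and> w \<in> B))"
    by (rule expect_restrict[where F = "\<lambda>B. of_bool (v \<notin> B \<and> w \<in> B)"]) (use assms in auto)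
  also have "\<dots> = p * (1 - p)"
    using assms by (subst expect_insert) (auto simp: expect_singleton)
  finally show ?thesis .
qed

text \<open>Flipping the bit at \<open>v\<close> exchanges its weights p and 1 - p, which changes
  probabilities by a factor p / (1 - p) or (1 - p) / p; the sum of the two dominates either.\<close>

lemma prb_flip_le:
  assumes "0 < p" "p < 1" "finite V" "v \<in> V"
  shows "prb p V (\<lambda>B. A (if v \<in> B then B - {v} else insert v B)) \<le> (p / (1 - p) + (1 - p) / p) * prb p V A"
    (is "_ \<le> ?R * _")
proof -
  let ?W = "V - {v}"
  define a where "a = prb p ?W (\<lambda>B. A (insert v B))"
  define b where "b = prb p ?W A"
  have nn: "0 \<le> a" "0 \<le> b" unfolding a_def b_def using assms by (auto intro!: expect_nonneg)
  have 1: "prb p ?W (\<lambda>B. A (if v \<in> insert v B then insert v B - {v} else insert v (insert v B))) = b"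
    unfolding b_def
  proof (intro expect_cong)
    fix B assume "B \<subseteq> V - {v}"
    then have "insert v B - {v} = B" by auto
    then show "of_bool (A (if v \<in> insert v B then insert v B - {v} else insert v (insert v B))) = (of_bool (A B) :: real)"
      by simp
  qed
  have 2: "prb p ?W (\<lambda>B. A (if v \<in> B then B - {v} else insert v B)) = a"
    unfolding a_def by (intro expect_cong) auto
  have "prb p V (\<lambda>B. A (if v \<in> B then B - {v} else insert v B)) = p * b + (1 - p) * a"
    by (subst expect_split[OF assms(3,4)]) (simp only: 1 2)
  moreover have "prb p V A = p * a + (1 - p) * b"
    unfolding a_def b_def by (rule expect_split[OF assms(3,4)])
  moreover have "p * b + (1 - p) * a \<le> ?R * (p * a + (1 - p) * b)"
  proof -
    have "?R * (p * a + (1 - p) * b) = p * b + (1 - p) * a + p / (1 - p) * (p * a) + (1 - p) / p * ((1 - p) * b)"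
      using assms by (simp add: field_simps)
    then show ?thesis using assms nn by simp
  qed
  ultimately show ?thesis by simp
qed

text \<open>Two independent configurations may be exchanged on a set \<open>D B\<close> of sites, provided that this
  set can be recovered after the exchange.\<close>

lemma expect_exchange_le:
  fixes A :: "'a set \<Rightarrow> 'a set \<Rightarrow> bool"
  assumes p: "0 \<le> p" "p \<le> 1" and V: "finite V"
    and D: "\<And>B C. B \<subseteq> V \<Longrightarrow> C \<subseteq> V \<Longrightarrow> A B C \<Longrightarrow> D ((B \<inter> D B) \<union> (C - D B)) = D B"
    and A': "\<And>B C. B \<subseteq> V \<Longrightarrow> C \<subseteq> V \<Longrightarrow> A B C \<Longrightarrow> A' ((B \<inter> D B) \<union> (C - D B))"
  shows "expect p V (\<lambda>B. prb p V (A B)) \<le> prb p V A'"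
proof -
  define w where "w B = (\<Prod>v\<in>V. if v \<in> B then p else 1 - p)" for B
  have w0: "0 \<le> w B" for B unfolding w_def using p by (intro prod_nonneg) auto
  let ?P = "{(B, C). B \<subseteq> V \<and> C \<subseteq> V \<and> A B C}"
  let ?Q = "{B. B \<subseteq> V \<and> A' B} \<times> Pow V"
  \<comment> \<open>At every site the two bits are either kept or swapped, so \<open>j\<close>
    preserves the product of the weights. On pairs satisfying \<open>A\<close> the first component
    still determines \<open>D B\<close>, so the same exchange applied again undoes
    \<open>j\<close>.\<close>
  define j where "j = (\<lambda>(B, C). ((B \<inter> D B) \<union> (C - D B), (C \<inter> D B) \<union> (B - D B)))"
  have fin: "finite (Pow V \<times> Pow V)" using V by simp
  have w2: "w (fst (j x)) * w (snd (j x)) = w (fst x) * w (snd x)" for x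
  proof -
    obtain B C where x: "x = (B, C)" by (cases x)
    show ?thesis unfolding x j_def w_def
      unfolding fst_conv snd_conv case_prod_conv prod.distrib[symmetric]
      by (rule prod.cong) auto
  qed
  have inj: "inj_on j ?P"
  proof (rule inj_on_inverseI)
    fix x assume "x \<in> ?P"
    then show "(\<lambda>(B, C). ((B \<inter> D B) \<union> (C - D B), (C \<inter> D B) \<union> (B - D B))) (j x) = x"
      unfolding j_def by (auto simp: D)
  qed
  have jQ: "j ` ?P \<subseteq> ?Q"
    unfolding j_def using A' by auto
  have "expect p V (\<lambda>B. prb p V (A B)) = (\<Sum>B\<in>Pow V. \<Sum>C\<in>Pow V. w B * w C * of_bool (A B C))"
    unfolding expect_def w_def by (simp add: sum_distrib_left mult.assoc)
  also have "\<dots> = (\<Sum>x\<in>Pow V \<times> Pow V. w (fst x) * w (snd x) * of_bool (A (fst x) (snd x)))"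
    by (simp add: sum.cartesian_product case_prod_beta)
  also have "\<dots> = (\<Sum>x\<in>?P. w (fst x) * w (snd x))"
    by (rule sum.mono_neutral_cong_right[OF fin]) auto
  also have "\<dots> = (\<Sum>x\<in>?P. w (fst (j x)) * w (snd (j x)))"
    by (simp add: w2)
  also have "\<dots> = (\<Sum>x\<in>j ` ?P. w (fst x) * w (snd x))"
    by (simp add: sum.reindex[OF inj])
  also have "\<dots> \<le> (\<Sum>x\<in>?Q. w (fst x) * w (snd x))"
    by (rule sum_mono2) (use V jQ w0 in auto)
  also have "\<dots> = (\<Sum>B\<in>{B. B \<subseteq> V \<and> A' B}. w B) * (\<Sum>C\<in>Pow V. w C)"
    by (simp add: sum_product sum.cartesian_product case_prod_beta)
  also have "(\<Sum>C\<in>Pow V. w C) = expect p V (\<lambda>_. 1)"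
    by (simp add: expect_def w_def)
  also have "(\<Sum>B\<in>{B. B \<subseteq> V \<and> A' B}. w B) = (\<Sum>B\<in>Pow V. w B * of_bool (A' B))"
    by (rule sum.mono_neutral_cong_left) (use V in auto)
  finally have "expect p V (\<lambda>B. prb p V (A B)) \<le> (\<Sum>B\<in>Pow V. w B * of_bool (A' B)) * expect p V (\<lambda>_. 1)" .
  then show ?thesis unfolding expect_const[OF V] by (simp only: expect_def w_def mult_1_right)
qed

subsection \<open>Rays in the plane\<close>

fun move :: "vertex \<Rightarrow> half_edge \<Rightarrow> vertex" where
  "move (x, y) North = (x, y + 1)"
| "move (x, y) East = (x + 1, y)"
| "move (x, y) South = (x, y - 1)"
| "move (x, y) West = (x - 1, y)"

definition site_of :: "(vertex \<Rightarrow> bool) \<Rightarrow> vertex \<Rightarrow> site_state" where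
  "site_of \<omega> v = (if \<omega> v then if even (fst v - snd v) then NW_Mirror else NE_Mirror else No_Mirror)"

text \<open>The Manhattan model is unrolled to the plane. A ray is recorded when it arrives at a vertex:
  \<open>(v, h)\<close> stands for a ray about to be scattered at \<open>v\<close>, which it reached moving in direction \<open>h\<close>.\<close>

definition step :: "(vertex \<Rightarrow> bool) \<Rightarrow> directed_edge \<Rightarrow> directed_edge" where
  "step \<omega> s = (let h = paired (site_of \<omega> (fst s)) (opposite (snd s)) in (move (fst s) h, h))"

definition ray :: "(vertex \<Rightarrow> bool) \<Rightarrow> directed_edge \<Rightarrow> nat \<Rightarrow> directed_edge" where
  "ray \<omega> s k = (step \<omega> ^^ k) s"

abbreviation col :: "directed_edge \<Rightarrow> int" where "col s \<equiv> fst (fst s)"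
abbreviation row :: "directed_edge \<Rightarrow> int" where "row s \<equiv> snd (fst s)"

lemma ray_0 [simp]: "ray \<omega> s 0 = s"
  by (simp add: ray_def)

lemma ray_Suc: "ray \<omega> s (Suc k) = step \<omega> (ray \<omega> s k)"
  by (simp add: ray_def)

lemma ray_add: "ray \<omega> s (k + l) = ray \<omega> (ray \<omega> s k) l"
  by (induction l) (simp_all add: ray_Suc)

lemma step_cong: "\<omega> (fst s) = \<omega>' (fst s) \<Longrightarrow> step \<omega> s = step \<omega>' s"
  by (simp add: step_def site_of_def)

lemma ray_cong:
  assumes "\<And>i. i < k \<Longrightarrow> \<omega> (fst (ray \<omega> s i)) = \<omega>' (fst (ray \<omega> s i))"
  shows "ray \<omega> s k = ray \<omega>' s k"
  using assms
proof (induction k)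
  case (Suc k)
  have "ray \<omega> s k = ray \<omega>' s k"
    by (rule Suc.IH) (rule Suc.prems, simp)
  then show ?case using step_cong[of \<omega> "ray \<omega> s k" \<omega>', OF Suc.prems[of k, OF lessI]] by (simp only: ray_Suc)
qed simp

section \<open>Reversibility and translations of the dynamics\<close>

lemma opposite_opposite [simp]: "opposite (opposite h) = h"
  by (cases h) auto

lemma paired_paired [simp]: "paired m (paired m h) = h"
  by (cases m; cases h) auto

lemma move_opposite [simp]: "move (move v h) (opposite h) = v"
  by (cases v; cases h) auto

text \<open>A state names the vertex where the ray is about to be scattered, so the reversed ray is
  about to be scattered at the vertex it came from; direction and vertex both change.\<close>

definition reversed :: "directed_edge \<Rightarrow> directed_edge" where
  "reversed s = (move (fst s) (opposite (snd s)), opposite (snd s))"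

lemma reversed_reversed [simp]: "reversed (reversed s) = s"
  using move_opposite[of "fst s" "opposite (snd s)"] by (simp add: reversed_def)

lemma fst_reversed_step [simp]: "fst (reversed (step \<omega> s)) = fst s"
  by (simp add: reversed_def step_def Let_def)

lemma step_reversed_step: "step \<omega> (reversed (step \<omega> s)) = reversed s"
  by (simp add: reversed_def step_def Let_def)

lemma ray_reversed:
  assumes "i \<le> k"
  shows "ray \<omega> (reversed (ray \<omega> s k)) i = reversed (ray \<omega> s (k - i))"
  using assms
proof (induction i)
  case (Suc i)
  then obtain j where j: "k = Suc (i + j)" by (metis Suc_le_eq less_natE)
  have "k - i = Suc j" "k - Suc i = j" using j by auto
  then show ?case using Suc by (simp add: ray_Suc step_reversed_step)
qed simp

lemma step_inj: "step \<omega> s = step \<omega> s' \<Longrightarrow> s = s'"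
  by (metis reversed_reversed step_reversed_step)

lemma col_step: "\<bar>col (step \<omega> s) - col s\<bar> \<le> 1"
  by (cases s; cases "fst s"; cases "paired (site_of \<omega> (fst s)) (opposite (snd s))")
     (auto simp: step_def Let_def)

lemma step_East: "col (step \<omega> s) > col s \<Longrightarrow> step \<omega> s = ((col s + 1, row s), East)"
  by (cases s; cases "fst s"; cases "paired (site_of \<omega> (fst s)) (opposite (snd s))")
     (auto simp: step_def Let_def)

lemma step_West: "col (step \<omega> s) < col s \<Longrightarrow> step \<omega> s = ((col s - 1, row s), West)"
  by (cases s; cases "fst s"; cases "paired (site_of \<omega> (fst s)) (opposite (snd s))")
     (auto simp: step_def Let_def)

definition translate :: "vertex \<Rightarrow> directed_edge \<Rightarrow> directed_edge" where
  "translate c s = ((col s + fst c, row s + snd c), snd s)"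

lemma move_translate: "move (x + a, y + b) h = (fst (move (x, y) h) + a, snd (move (x, y) h) + b)"
  by (cases h) auto

text \<open>The type of a mirror depends on the parity of x - y, so translations preserving this
  parity are the symmetries of the model.\<close>

lemma step_translate:
  assumes "even (fst c - snd c)"
  shows "step \<omega> (translate c s) = translate c (step (\<lambda>(x, y). \<omega> (x + fst c, y + snd c)) s)"
proof -
  obtain x y h where s: "s = ((x, y), h)" by (metis prod.exhaust)
  have e: "even (x + fst c - (y + snd c)) \<longleftrightarrow> even (x - y)"
    using assms by presburger
  then have "site_of \<omega> (x + fst c, y + snd c) = site_of (\<lambda>(x, y). \<omega> (x + fst c, y + snd c)) (x, y)"
    by (simp add: site_of_def)
  then show ?thesis
    by (simp add: s step_def translate_def Let_def move_translate)
qed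

lemma ray_translate:
  assumes "even (fst c - snd c)"
  shows "ray \<omega> (translate c s) k = translate c (ray (\<lambda>(x, y). \<omega> (x + fst c, y + snd c)) s k)"
  by (induction k) (simp_all add: ray_Suc step_translate[OF assms])

lemma col_translate [simp]: "col (translate c s) = col s + fst c"
  by (simp add: translate_def)

text \<open>The orientation of the Manhattan lattice; rays travel either always along or always against it.\<close>

definition oriented :: "directed_edge \<Rightarrow> bool" where
  "oriented s = (case snd s of East \<Rightarrow> even (row s) | West \<Rightarrow> odd (row s)
     | South \<Rightarrow> even (col s) | North \<Rightarrow> odd (col s))"

lemma oriented_step [simp]: "oriented (step \<omega> s) = oriented s"
proof -
  obtain x y h where s: "s = ((x, y), h)" by (metis prod.exhaust)
  show ?thesis
    by (cases h) (auto simp: s step_def site_of_def oriented_def Let_def)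
qed

lemma oriented_ray [simp]: "oriented (ray \<omega> s k) = oriented s"
  by (induction k) (simp_all add: ray_Suc)

section \<open>Crossings and reflections of a slab of columns\<close>

definition cross :: "(vertex \<Rightarrow> bool) \<Rightarrow> int \<Rightarrow> int \<Rightarrow> int \<Rightarrow> int \<Rightarrow> bool" where
  "cross \<omega> a b y r \<longleftrightarrow> (\<exists>k. (\<forall>i<k. col (ray \<omega> ((a, y), East) i) \<in> {a..b}) \<and>
     ray \<omega> ((a, y), East) k = ((b + 1, r), East))"

definition turn_back :: "(vertex \<Rightarrow> bool) \<Rightarrow> int \<Rightarrow> int \<Rightarrow> int \<Rightarrow> int \<Rightarrow> bool" where
  "turn_back \<omega> a b y r \<longleftrightarrow> (\<exists>k. (\<forall>i<k. col (ray \<omega> ((a, y), East) i) \<in> {a..b}) \<and>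
     ray \<omega> ((a, y), East) k = ((a - 1, r), West))"

text \<open>Both runs stop at the first time outside \<open>S\<close>. Hence exit rows are unique,
  and a ray cannot both cross and turn back.\<close>

lemma run_unique:
  assumes "\<forall>i<k. col (ray \<omega> s i) \<in> S" "ray \<omega> s k = s'" "col s' \<notin> S"
    and "\<forall>i<l. col (ray \<omega> s i) \<in> S" "ray \<omega> s l = s''" "col s'' \<notin> S"
  shows "s' = s''"
  using assms by (metis linorder_neqE_nat)

lemma cross_unique:
  assumes "cross \<omega> a b y r" "cross \<omega> a b y r'"
  shows "r = r'"
proof -
  have "((b + 1, r), East) = ((b + 1, r'), East)"
    using assms unfolding cross_def by (elim exE conjE) (rule run_unique[where S = "{a..b}"], auto)
  then show ?thesis by simp
qed

lemma turn_back_unique: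
  assumes "turn_back \<omega> a b y r" "turn_back \<omega> a b y r'"
  shows "r = r'"
proof -
  have "((a - 1, r), West) = ((a - 1, r'), West)"
    using assms unfolding turn_back_def by (elim exE conjE) (rule run_unique[where S = "{a..b}"], auto)
  then show ?thesis by simp
qed

lemma not_cross_if_turn_back:
  assumes "turn_back \<omega> a b y r"
  shows "\<not> cross \<omega> a b y r'"
proof
  assume "cross \<omega> a b y r'"
  then have "((a - 1, r), West) = ((b + 1, r'), East)"
    using assms unfolding turn_back_def cross_def
    by (elim exE conjE) (rule run_unique[where S = "{a..b}"], auto)
  then show False by simp
qed

lemma run_cong:
  assumes "\<forall>i<k. col (ray \<omega> s i) \<in> S" "\<And>x z. x \<in> S \<Longrightarrow> \<omega> (x, z) = \<omega>' (x, z)" "i \<le> k"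
  shows "ray \<omega> s i = ray \<omega>' s i"
proof (rule ray_cong)
  fix j assume "j < i"
  then show "\<omega> (fst (ray \<omega> s j)) = \<omega>' (fst (ray \<omega> s j))"
    using assms(1,3) assms(2)[of "col (ray \<omega> s j)" "row (ray \<omega> s j)"] by simp
qed

lemma cross_cong:
  assumes "cross \<omega> a b y r" "\<And>x z. x \<in> {a..b} \<Longrightarrow> \<omega> (x, z) = \<omega>' (x, z)"
  shows "cross \<omega>' a b y r"
proof -
  obtain k where k: "\<forall>i<k. col (ray \<omega> ((a, y), East) i) \<in> {a..b}" "ray \<omega> ((a, y), East) k = ((b + 1, r), East)"
    using assms unfolding cross_def by blast
  then show ?thesis
    unfolding cross_def using run_cong[of k \<omega> _ "{a..b}" \<omega>', OF k(1) assms(2)] by (intro exI[of _ k]) auto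
qed

lemma turn_back_cong:
  assumes "turn_back \<omega> a b y r" "\<And>x z. x \<in> {a..b} \<Longrightarrow> \<omega> (x, z) = \<omega>' (x, z)"
  shows "turn_back \<omega>' a b y r"
proof -
  obtain k where k: "\<forall>i<k. col (ray \<omega> ((a, y), East) i) \<in> {a..b}" "ray \<omega> ((a, y), East) k = ((a - 1, r), West)"
    using assms unfolding turn_back_def by blast
  then show ?thesis
    unfolding turn_back_def using run_cong[of k \<omega> _ "{a..b}" \<omega>', OF k(1) assms(2)] by (intro exI[of _ k]) auto
qed

text \<open>Orientation is conserved, and an eastbound ray is oriented exactly in even rows, a
  westbound one in odd rows. So a crossing keeps the parity of the row and a reflection changes
  it.\<close>

lemma cross_even: "cross \<omega> a b y r \<Longrightarrow> even r = even y"
proof -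
  assume "cross \<omega> a b y r"
  then obtain k where "ray \<omega> ((a, y), East) k = ((b + 1, r), East)" unfolding cross_def by blast
  then have "oriented ((a, y), East) = oriented ((b + 1, r), East)"
    by (metis oriented_ray)
  then show ?thesis by (simp add: oriented_def)
qed

lemma turn_back_even: "turn_back \<omega> a b y r \<Longrightarrow> even r = odd y"
proof -
  assume "turn_back \<omega> a b y r"
  then obtain k where "ray \<omega> ((a, y), East) k = ((a - 1, r), West)" unfolding turn_back_def by blast
  then have "oriented ((a, y), East) = oriented ((a - 1, r), West)"
    by (metis oriented_ray)
  then show ?thesis by (auto simp: oriented_def)
qed

lemma runs_append:
  assumes "\<forall>i<k. col (ray \<omega> s i) \<in> S" "ray \<omega> s k = s'" "\<forall>i<l. col (ray \<omega> s' i) \<in> S"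
  shows "\<forall>i<k + l. col (ray \<omega> s i) \<in> S"
proof (intro allI impI)
  fix i assume i: "i < k + l"
  show "col (ray \<omega> s i) \<in> S"
  proof (cases "i < k")
    case False
    then have "ray \<omega> s i = ray \<omega> s' (i - k)"
      using assms(2) ray_add[of \<omega> s k "i - k"] by simp
    then show ?thesis using assms(3) i False by auto
  qed (use assms in auto)
qed

text \<open>As states are arrivals, a crossing of \<open>a..b\<close> ends in the state that enters
  the slab starting at column \<open>b + 1\<close>, so crossings of adjacent slabs concatenate
  without any adjustment.\<close>

lemma cross_trans:
  assumes "cross \<omega> a b y r" "cross \<omega> (b + 1) c r r'" "a \<le> b + 1" "b \<le> c"
  shows "cross \<omega> a c y r'"
proof -
  obtain k l where k: "\<forall>i<k. col (ray \<omega> ((a, y), East) i) \<in> {a..b}" "ray \<omega> ((a, y), East) k = ((b + 1, r), East)"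
    and l: "\<forall>i<l. col (ray \<omega> ((b + 1, r), East) i) \<in> {b+1..c}" "ray \<omega> ((b + 1, r), East) l = ((c + 1, r'), East)"
    using assms unfolding cross_def by blast
  have "\<forall>i<k + l. col (ray \<omega> ((a, y), East) i) \<in> {a..c}"
    by (rule runs_append[OF _ k(2)]) (use k(1) l(1) assms in fastforce)+
  then show ?thesis
    unfolding cross_def using k(2) l(2) by (intro exI[of _ "k + l"]) (simp add: ray_add)
qed

lemma cross_translate:
  assumes "even (i - j)"
  shows "cross \<omega> (a + i) (b + i) (y + j) (r + j) \<longleftrightarrow> cross (\<lambda>(x, y). \<omega> (x + i, y + j)) a b y r"
proof -
  have t: "((a + i, y + j), East) = translate (i, j) ((a, y), East)" by (simp add: translate_def)
  have c: "translate (i, j) s = ((b + i + 1, r + j), East) \<longleftrightarrow> s = ((b + 1, r), East)" for s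
    by (cases s; cases "fst s") (auto simp: translate_def)
  show ?thesis
    unfolding cross_def t using assms by (simp add: ray_translate c)
qed

lemma turn_back_translate:
  assumes "even (i - j)"
  shows "turn_back \<omega> (a + i) (b + i) (y + j) (r + j) \<longleftrightarrow> turn_back (\<lambda>(x, y). \<omega> (x + i, y + j)) a b y r"
proof -
  have t: "((a + i, y + j), East) = translate (i, j) ((a, y), East)" by (simp add: translate_def)
  have c: "translate (i, j) s = ((a + i - 1, r + j), West) \<longleftrightarrow> s = ((a - 1, r), West)" for s
    by (cases s; cases "fst s") (auto simp: translate_def)
  show ?thesis
    unfolding turn_back_def t using assms by (simp add: ray_translate c)
qed

lemma first_arrival_East:
  assumes "col s \<le> b" "col (ray \<omega> s k) > b"
  obtains l r where "l \<le> k" "\<forall>i<l. col (ray \<omega> s i) \<le> b" "ray \<omega> s l = ((b + 1, r), East)"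
proof -
  define l where "l = (LEAST l. col (ray \<omega> s l) > b)"
  have l: "col (ray \<omega> s l) > b" unfolding l_def by (rule LeastI[of _ k]) (use assms in auto)
  have le: "l \<le> k" unfolding l_def by (rule Least_le) (use assms in auto)
  have lt: "col (ray \<omega> s i) \<le> b" if "i < l" for i
    using not_less_Least[of i "\<lambda>l. col (ray \<omega> s l) > b"] that unfolding l_def by auto
  obtain l' where l': "l = Suc l'" using l assms by (cases l) auto
  have "col (ray \<omega> s l') \<le> b" using lt l' by simp
  moreover have "col (step \<omega> (ray \<omega> s l')) > b" using l l' by (simp add: ray_Suc)
  ultimately have "col (ray \<omega> s l') = b" using col_step[of \<omega> "ray \<omega> s l'"] by linarith
  then have "ray \<omega> s l = ((b + 1, row (ray \<omega> s l')), East)"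
    using step_East[of "ray \<omega> s l'" \<omega>] \<open>col (step \<omega> (ray \<omega> s l')) > b\<close> l' by (simp add: ray_Suc)
  then show ?thesis using that le lt by blast
qed

lemma first_arrival_West:
  assumes "col s \<ge> a" "col (ray \<omega> s k) < a"
  obtains l r where "l \<le> k" "\<forall>i<l. col (ray \<omega> s i) \<ge> a" "ray \<omega> s l = ((a - 1, r), West)"
proof -
  define l where "l = (LEAST l. col (ray \<omega> s l) < a)"
  have l: "col (ray \<omega> s l) < a" unfolding l_def by (rule LeastI[of _ k]) (use assms in auto)
  have le: "l \<le> k" unfolding l_def by (rule Least_le) (use assms in auto)
  have lt: "col (ray \<omega> s i) \<ge> a" if "i < l" for i
    using not_less_Least[of i "\<lambda>l. col (ray \<omega> s l) < a"] that unfolding l_def by auto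
  obtain l' where l': "l = Suc l'" using l assms by (cases l) auto
  have "col (ray \<omega> s l') \<ge> a" using lt l' by simp
  moreover have "col (step \<omega> (ray \<omega> s l')) < a" using l l' by (simp add: ray_Suc)
  ultimately have "col (ray \<omega> s l') = a" using col_step[of \<omega> "ray \<omega> s l'"] by linarith
  then have "ray \<omega> s l = ((a - 1, row (ray \<omega> s l')), West)"
    using step_West[of \<omega> "ray \<omega> s l'"] \<open>col (step \<omega> (ray \<omega> s l')) < a\<close> l' by (simp add: ray_Suc)
  then show ?thesis using that le lt by blast
qed

lemma cross_prefix:
  assumes "cross \<omega> a c y r" "a \<le> b" "b \<le> c"
  obtains q where "cross \<omega> a b y q"
proof -
  obtain k where k: "\<forall>i<k. col (ray \<omega> ((a, y), East) i) \<in> {a..c}" "ray \<omega> ((a, y), East) k = ((c + 1, r), East)"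
    using assms unfolding cross_def by blast
  obtain l q where l: "l \<le> k" "\<forall>i<l. col (ray \<omega> ((a, y), East) i) \<le> b" "ray \<omega> ((a, y), East) l = ((b + 1, q), East)"
    by (rule first_arrival_East[of "((a, y), East)" b \<omega> k]) (use assms k in auto)
  have "cross \<omega> a b y q" unfolding cross_def using l k by (intro exI[of _ l]) auto
  then show ?thesis using that by blast
qed

subsection \<open>Periodic environments\<close>

lemma run_reversed:
  assumes "\<forall>i<k. col (ray \<omega> s i) \<in> S" "ray \<omega> s k = s'"
  shows "\<forall>i<k. col (ray \<omega> (reversed s') i) \<in> S" "ray \<omega> (reversed s') k = reversed s"
proof -
  show "ray \<omega> (reversed s') k = reversed s"
    using ray_reversed[of k k \<omega> s] assms by simp
  show "\<forall>i<k. col (ray \<omega> (reversed s') i) \<in> S"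
  proof (intro allI impI)
    fix i assume i: "i < k"
    \<comment> \<open>Reversing the state of time \<open>k - i\<close> leads to the vertex of time
      \<open>k - i - 1\<close>, so the times \<open>i < k\<close> run again through exactly the
      vertices of times below \<open>k\<close>.\<close>
    then obtain j where j: "k - i = Suc j" "j < k" by (metis Suc_diff_Suc Suc_le_lessD diff_le_self)
    have "ray \<omega> (reversed s') i = reversed (ray \<omega> s (k - i))"
      using ray_reversed[of i k \<omega> s] assms i by simp
    then show "col (ray \<omega> (reversed s') i) \<in> S"
      using assms j by (simp add: ray_Suc)
  qed
qed

lemma reversed_East [simp]: "reversed ((x, y), East) = ((x - 1, y), West)"
  by (simp add: reversed_def)

lemma reversed_West [simp]: "reversed ((x, y), West) = ((x + 1, y), East)"
  by (simp add: reversed_def)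

lemma turn_back_sym: "turn_back \<omega> a b y r \<Longrightarrow> turn_back \<omega> a b r y"
proof -
  assume "turn_back \<omega> a b y r"
  then obtain k where k: "\<forall>i<k. col (ray \<omega> ((a, y), East) i) \<in> {a..b}" "ray \<omega> ((a, y), East) k = ((a - 1, r), West)"
    unfolding turn_back_def by blast
  show ?thesis
    unfolding turn_back_def using run_reversed[OF k] by (intro exI[of _ k]) simp
qed

lemma cross_if_run_West:
  assumes "\<forall>i<k. col (ray \<omega> ((b, y), West) i) \<in> {a..b}" "ray \<omega> ((b, y), West) k = ((a - 1, r), West)"
  shows "cross \<omega> a b r y"
  unfolding cross_def using run_reversed[OF assms] by (intro exI[of _ k]) simp

text \<open>The mechanism that destroys crossings: the ray from \<open>y\<close> leaves the first
  slab at \<open>r\<close>, is reflected into \<open>q\<close>, and then follows the crossing from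
  \<open>z\<close> backwards.\<close>

lemma turn_back_compose:
  assumes "cross \<omega> a b y r" "cross \<omega> a b z q" "turn_back \<omega> (b + 1) c r q" "a \<le> b" "b \<le> c"
  shows "turn_back \<omega> a c y z"
proof -
  obtain k where k: "\<forall>i<k. col (ray \<omega> ((a, y), East) i) \<in> {a..b}" "ray \<omega> ((a, y), East) k = ((b + 1, r), East)"
    using assms(1) unfolding cross_def by blast
  obtain l where l: "\<forall>i<l. col (ray \<omega> ((a, z), East) i) \<in> {a..b}" "ray \<omega> ((a, z), East) l = ((b + 1, q), East)"
    using assms(2) unfolding cross_def by blast
  obtain m where m: "\<forall>i<m. col (ray \<omega> ((b + 1, r), East) i) \<in> {b+1..c}" "ray \<omega> ((b + 1, r), East) m = ((b, q), West)"
    using assms(3) unfolding turn_back_def by auto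
  note l' = run_reversed[OF l]
  have 1: "\<forall>i<k + m. col (ray \<omega> ((a, y), East) i) \<in> {a..c}"
    by (rule runs_append[OF _ k(2)]) (use k m assms in fastforce)+
  have 2: "ray \<omega> ((a, y), East) (k + m) = ((b, q), West)"
    using k m by (simp add: ray_add)
  have 3: "\<forall>i<k + m + l. col (ray \<omega> ((a, y), East) i) \<in> {a..c}"
    by (rule runs_append[OF 1 2]) (use l' assms in fastforce)
  have 4: "ray \<omega> ((a, y), East) (k + m + l) = ((a - 1, z), West)"
    using 2 l' by (simp add: ray_add)
  show ?thesis unfolding turn_back_def using 3 4 by blast
qed

text \<open>Evenness of \<open>N\<close> makes the vertical translation by \<open>N\<close>
  compatible with the types of the mirrors.\<close>

definition periodic :: "int \<Rightarrow> (vertex \<Rightarrow> bool) \<Rightarrow> bool" where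
  "periodic N \<omega> \<longleftrightarrow> 0 < N \<and> even N \<and> (\<forall>x y. \<omega> (x, y + N) = \<omega> (x, y))"

lemma periodic_mult:
  assumes "periodic N \<omega>"
  shows "\<omega> (x, y + k * N) = \<omega> (x, y)"
proof -
  have nat: "\<omega> (x, y + int m * N) = \<omega> (x, y)" for m y
  proof (induction m)
    case (Suc m)
    have "\<omega> (x, y + int (Suc m) * N) = \<omega> (x, (y + int m * N) + N)"
      by (simp add: algebra_simps)
    then show ?case using Suc assms unfolding periodic_def by simp
  qed simp
  show ?thesis
  proof (cases "k \<ge> 0")
    case True
    then show ?thesis using nat[of y "nat k"] by simp
  next
    case False
    then show ?thesis using nat[of "y + k * N" "nat (-k)"] by simp
  qed
qed

lemma ray_periodic:
  assumes "periodic N \<omega>"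
  shows "ray \<omega> (translate (0, k * N) s) m = translate (0, k * N) (ray \<omega> s m)"
proof -
  have "even N" using assms by (simp add: periodic_def)
  then show ?thesis
    using periodic_mult[OF assms] by (simp add: ray_translate)
qed

lemma cross_periodic:
  assumes "periodic N \<omega>"
  shows "cross \<omega> a b (y + k * N) (r + k * N) \<longleftrightarrow> cross \<omega> a b y r"
proof -
  have "even N" using assms by (simp add: periodic_def)
  then show ?thesis
    using periodic_mult[OF assms] cross_translate[of 0 "k * N" \<omega> a b y r] by simp
qed

lemma turn_back_periodic:
  assumes "periodic N \<omega>"
  shows "turn_back \<omega> a b (y + k * N) (r + k * N) \<longleftrightarrow> turn_back \<omega> a b y r"
proof -
  have "even N" using assms by (simp add: periodic_def)
  then show ?thesis
    using periodic_mult[OF assms] turn_back_translate[of 0 "k * N" \<omega> a b y r] by simp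
qed

text \<open>The dynamics on the slab is injective on finitely many states modulo the period, and an entering
  state has its predecessor outside, hence it cannot recur.\<close>

lemma ray_leaves:
  assumes N: "periodic N \<omega>"
  shows "\<exists>k. col (ray \<omega> ((a, y), East) k) \<notin> {a..b}"
proof (rule ccontr)
  let ?s = "((a, y), East)"
  assume "\<not> ?thesis"
  then have stay: "col (ray \<omega> ?s k) \<in> {a..b}" for k by auto
  have N0: "N > 0" using N by (simp add: periodic_def)
  define f where "f k = (col (ray \<omega> ?s k), row (ray \<omega> ?s k) mod N, snd (ray \<omega> ?s k))" for k
  have fin: "finite (UNIV :: half_edge set)"
    by (rule finite_subset[of _ "{North, East, South, West}"]) (auto intro: half_edge.exhaust)
  have "f k \<in> {a..b} \<times> {0..<N} \<times> UNIV" for k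
    using stay[of k] N0 unfolding f_def by simp
  then have "range f \<subseteq> {a..b} \<times> {0..<N} \<times> UNIV" by blast
  then have "finite (range f)" by (rule finite_subset) (use fin in auto)
  then have "\<not> inj f" using finite_imageD infinite_UNIV_nat by blast
  then obtain i j where ij: "i < j" "f i = f j"
    unfolding inj_def by (metis linorder_neqE_nat)
  have tr: "\<exists>c. ray \<omega> ?s j = translate (0, c * N) (ray \<omega> ?s i)"
  proof -
    have "(row (ray \<omega> ?s j) - row (ray \<omega> ?s i)) mod N = 0"
      using ij unfolding f_def by (simp add: mod_diff_cong[of _ N] mod_eq_dvd_iff[symmetric] dvd_eq_mod_eq_0[symmetric])
    then obtain c where "row (ray \<omega> ?s j) - row (ray \<omega> ?s i) = c * N"
      by (metis dvd_def mod_0_imp_dvd mult.commute)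
    then have "ray \<omega> ?s j = translate (0, c * N) (ray \<omega> ?s i)"
      using ij unfolding f_def translate_def by (intro prod_eqI) auto
    then show ?thesis by blast
  qed
  then obtain c where c: "ray \<omega> ?s j = translate (0, c * N) (ray \<omega> ?s i)" by blast
  \<comment> \<open>Injectivity of \<open>step\<close> pulls the coincidence of times i and j back
    to times 0 and \<open>j - i\<close>, so a translate of the entering state recurs.\<close>
  have "ray \<omega> ?s (j - m) = translate (0, c * N) (ray \<omega> ?s (i - m))" if "m \<le> i" for m
    using that
  proof (induction m)
    case (Suc m)
    then have s: "j - m = Suc (j - Suc m)" "i - m = Suc (i - Suc m)" using ij by auto
    have "ray \<omega> ?s (j - m) = translate (0, c * N) (ray \<omega> ?s (i - m))"
      using Suc by simp
    then have "step \<omega> (ray \<omega> ?s (j - Suc m)) = step \<omega> (translate (0, c * N) (ray \<omega> ?s (i - Suc m)))"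
      unfolding s ray_Suc using ray_periodic[OF N, of c "ray \<omega> ?s (i - Suc m)" 1]
      by (simp add: ray_Suc)
    then show ?case by (rule step_inj)
  qed (use c in simp)
  from this[of i] have "ray \<omega> ?s (j - i) = translate (0, c * N) ?s" by simp
  moreover obtain m where "j - i = Suc m" using ij by (metis Suc_diff_Suc)
  ultimately have "step \<omega> (ray \<omega> ?s m) = ((a, y + c * N), East)"
    by (simp add: ray_Suc translate_def)
  then have "fst (ray \<omega> ?s m) = (a - 1, y + c * N)"
    using fst_reversed_step[of \<omega> "ray \<omega> ?s m"] by simp
  then show False using stay[of m] by simp
qed

lemma cross_or_turn_back:
  assumes N: "periodic N \<omega>" and ab: "a \<le> b"
  shows "(\<exists>r. cross \<omega> a b y r) \<or> (\<exists>r. turn_back \<omega> a b y r)"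
proof -
  let ?s = "((a, y), East)"
  define k where "k = (LEAST k. col (ray \<omega> ?s k) \<notin> {a..b})"
  have k: "col (ray \<omega> ?s k) \<notin> {a..b}"
    unfolding k_def using ray_leaves[OF N] by (rule LeastI_ex)
  have lt: "\<forall>i<k. col (ray \<omega> ?s i) \<in> {a..b}"
    using not_less_Least unfolding k_def by blast
  obtain l where l: "k = Suc l" using k ab by (cases k) auto
  define s where "s = ray \<omega> ?s l"
  have s: "col s \<in> {a..b}" unfolding s_def using lt l by blast
  have ks: "ray \<omega> ?s k = step \<omega> s" by (simp add: l s_def ray_Suc)
  show ?thesis
  proof (cases "col (step \<omega> s) > b")
    case True
    then have "col (step \<omega> s) > col s" "col s = b" using s col_step[of \<omega> s] by auto
    then have "ray \<omega> ?s k = ((b + 1, row s), East)" using step_East[of s \<omega>] ks by simp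
    then show ?thesis unfolding cross_def using lt by blast
  next
    case False
    then have "col (step \<omega> s) < a" using k ks by auto
    then have "col (step \<omega> s) < col s" "col s = a" using s col_step[of \<omega> s] by auto
    then have "ray \<omega> ?s k = ((a - 1, row s), West)" using step_West[of \<omega> s] ks by simp
    then show ?thesis unfolding turn_back_def using lt by blast
  qed
qed

section \<open>Balance between crossings from even and from odd rows\<close>

lemma card_even_eq_odd:
  assumes "0 < N" "even (N :: int)"
  shows "card {y \<in> {0..<N}. even y} = card {y \<in> {0..<N}. odd y}"
proof (rule bij_betw_same_card)
  show "bij_betw (\<lambda>y. y + 1) {y \<in> {0..<N}. even y} {y \<in> {0..<N}. odd y}"
  proof (rule bij_betw_byWitness[where f' = "\<lambda>y. y - 1"])
    show "(\<lambda>y. y + 1) ` {y \<in> {0..<N}. even y} \<subseteq> {y \<in> {0..<N}. odd y}"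
    proof
      fix x assume "x \<in> (\<lambda>y. y + 1) ` {y \<in> {0..<N}. even y}"
      then obtain y where y: "x = y + 1" "0 \<le> y" "y < N" "even y" by auto
      have "y \<noteq> N - 1" using y assms by auto
      then show "x \<in> {y \<in> {0..<N}. odd y}" using y by auto
    qed
    show "(\<lambda>y. y - 1) ` {y \<in> {0..<N}. odd y} \<subseteq> {y \<in> {0..<N}. even y}"
    proof
      fix x assume "x \<in> (\<lambda>y. y - 1) ` {y \<in> {0..<N}. odd y}"
      then obtain y where y: "x = y - 1" "0 \<le> y" "y < N" "odd y" by auto
      have "y \<noteq> 0" using y by auto
      then show "x \<in> {y \<in> {0..<N}. even y}" using y by auto
    qed
  qed auto
qed

text \<open>A ray that does not cross turns back, and turning back is a symmetric, single-valued
  relation between rows of opposite parity that commutes with the period. Reduced modulo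
  \<open>N\<close>, it injects the rows of one parity without crossing into those of the
  other.\<close>

lemma card_not_cross_le:
  assumes N: "periodic N \<omega>" and ab: "a \<le> b"
  shows "card {y \<in> {0..<N}. even y = e \<and> \<not> (\<exists>r. cross \<omega> a b y r)}
    \<le> card {y \<in> {0..<N}. even y \<noteq> e \<and> \<not> (\<exists>r. cross \<omega> a b y r)}" (is "card ?E \<le> card ?O")
proof -
  have N0: "N > 0" "even N" using N by (simp_all add: periodic_def)
  define f where "f y = (SOME r. turn_back \<omega> a b y r)" for y
  have f: "turn_back \<omega> a b y (f y)" if "y \<in> ?E" for y
    unfolding f_def by (rule someI_ex) (use that cross_or_turn_back[OF N ab, of y] in blast)
  have "card ((\<lambda>y. f y mod N) ` ?E) \<le> card ?O"
  proof (rule card_mono)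
    show "(\<lambda>y. f y mod N) ` ?E \<subseteq> ?O"
    proof
      fix x assume "x \<in> (\<lambda>y. f y mod N) ` ?E"
      then obtain y where y: "y \<in> ?E" "x = f y mod N" by blast
      have x: "x = f y + (- (f y div N)) * N" using y minus_div_mult_eq_mod[of "f y" N] by simp
      have "turn_back \<omega> a b x (y + (- (f y div N)) * N)"
        unfolding x turn_back_periodic[OF N] by (rule turn_back_sym) (rule f[OF y(1)])
      then have "\<not> cross \<omega> a b x r" for r using not_cross_if_turn_back by blast
      moreover have "even (f y) = odd y" using turn_back_even[OF f[OF y(1)]] .
      moreover have "even x = even (f y)" using x N0 by simp
      moreover have "x \<in> {0..<N}" using y N0 by simp
      ultimately show "x \<in> ?O" using y by auto
    qed
    show "finite ?O" by (rule finite_subset[of _ "{0..<N}"]) auto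
  qed
  moreover have "inj_on (\<lambda>y. f y mod N) ?E"
  proof (rule inj_onI)
    fix y y' assume y: "y \<in> ?E" "y' \<in> ?E" "f y mod N = f y' mod N"
    define c where "c = f y' div N - f y div N"
    have "f y' = f y + c * N"
      using y(3) unfolding c_def by (simp add: left_diff_distrib minus_mod_eq_div_mult[symmetric])
    then have "turn_back \<omega> a b (f y + c * N) (y' + (-c) * N + c * N)"
      using turn_back_sym[OF f[OF y(2)]] by simp
    then have "turn_back \<omega> a b (f y) (y' + (-c) * N)"
      unfolding turn_back_periodic[OF N] .
    then have "y = y' + (-c) * N"
      using turn_back_unique turn_back_sym[OF f[OF y(1)]] by blast
    then have "y mod N = y' mod N" by (metis mod_mult_self1)
    then show "y = y'" using y by simp
  qed
  ultimately show ?thesis by (simp add: card_image)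
qed

text \<open>The two injections equate the numbers of rows without crossing, and there are as many
  even rows as odd ones. This is the zero net flux of the Manhattan orientation through the
  slab.\<close>

lemma card_cross_even_eq_odd:
  assumes N: "periodic N \<omega>" and ab: "a \<le> b"
  shows "card {y \<in> {0..<N}. even y \<and> (\<exists>r. cross \<omega> a b y r)}
    = card {y \<in> {0..<N}. odd y \<and> (\<exists>r. cross \<omega> a b y r)}"
proof -
  have "card {y \<in> {0..<N}. even y \<and> \<not> (\<exists>r. cross \<omega> a b y r)}
    = card {y \<in> {0..<N}. odd y \<and> \<not> (\<exists>r. cross \<omega> a b y r)}"
    using card_not_cross_le[OF N ab, of True] card_not_cross_le[OF N ab, of False] by simp
  moreover have split: "card {y \<in> {0..<N}. P y \<and> (\<exists>r. cross \<omega> a b y r)} +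
      card {y \<in> {0..<N}. P y \<and> \<not> (\<exists>r. cross \<omega> a b y r)} = card {y \<in> {0..<N}. P y}" for P
  proof (subst card_Un_disjoint[symmetric])
    show "finite {y \<in> {0..<N}. P y \<and> (\<exists>r. cross \<omega> a b y r)}"
      "finite {y \<in> {0..<N}. P y \<and> \<not> (\<exists>r. cross \<omega> a b y r)}"
      by (rule finite_subset[of _ "{0..<N}"]; auto)+
  qed (auto intro!: arg_cong[where f = card])
  moreover have "card {y \<in> {0..<N}. even y} = card {y \<in> {0..<N}. odd y}"
    using N by (intro card_even_eq_odd) (simp_all add: periodic_def)
  ultimately show ?thesis using split[of even] split[of odd] by linarith
qed

text \<open>The planar crossing lemma. The potential at \<open>(x, y)\<close> is the net number of eastward steps
  of the first path from column \<open>x\<close> to column \<open>x + 1\<close> below height \<open>y\<close>; it cannot change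
  along a path avoiding the first one.\<close>

lemma disjoint_paths_ordered:
  fixes u w :: "nat \<Rightarrow> int \<times> int" and T :: int
  assumes T: "1 \<le> T"
    and u: "\<And>i. i < k \<Longrightarrow> \<bar>fst (u (Suc i)) - fst (u i)\<bar> + \<bar>snd (u (Suc i)) - snd (u i)\<bar> = 1"
      "u 0 = (0, y0)" "u k = (T + 1, y1)" "\<And>i. 0 < i \<Longrightarrow> i < k \<Longrightarrow> fst (u i) \<in> {1..T}"
    and w: "\<And>i. i < l \<Longrightarrow> \<bar>fst (w (Suc i)) - fst (w i)\<bar> + \<bar>snd (w (Suc i)) - snd (w i)\<bar> = 1"
      "w 0 = (0, z0)" "w l = (T + 1, z1)" "\<And>i. 0 < i \<Longrightarrow> i < l \<Longrightarrow> fst (w i) \<in> {1..T}"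
    and disj: "\<And>i j. i \<le> k \<Longrightarrow> j \<le> l \<Longrightarrow> u i \<noteq> w j"
  shows "y0 < z0 \<longleftrightarrow> y1 < z1"
proof -
  \<comment> \<open>The signed contribution of step i to the potential: +1 for a step from column x
    to x + 1 below height y, and -1 for the opposite step.\<close>
  define c :: "nat \<Rightarrow> int \<Rightarrow> int \<Rightarrow> int" where
    "c i x y = of_bool (fst (u i) = x \<and> fst (u (Suc i)) = x + 1 \<and> snd (u i) < y)
      - of_bool (fst (u i) = x + 1 \<and> fst (u (Suc i)) = x \<and> snd (u i) < y)" for i x y
  define F where "F x y = (\<Sum>i<k. c i x y)" for x y
  \<comment> \<open>The two potentials differ by the steps between columns x and x + 1 at height
    exactly y, and each such step has (x, y) as an endpoint.\<close>
  have vert: "F x (y + 1) = F x y" if "\<And>i. i \<le> k \<Longrightarrow> u i \<noteq> (x, y)" for x y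
    unfolding F_def
  proof (rule sum.cong)
    fix i assume "i \<in> {..<k}"
    then have i: "i < k" by simp
    have "u i \<noteq> (x, y)" "u (Suc i) \<noteq> (x, y)" using that i by auto
    moreover have "\<bar>fst (u (Suc i)) - fst (u i)\<bar> + \<bar>snd (u (Suc i)) - snd (u i)\<bar> = 1" using u(1) i .
    ultimately show "c i x (y + 1) = c i x y"
      unfolding c_def by (cases "u i"; cases "u (Suc i)") auto
  qed simp
  have horz: "F x y = F (x + 1) y" if ne: "\<And>i. i \<le> k \<Longrightarrow> u i \<noteq> (x + 1, y)" and x: "0 \<le> x" "x + 1 \<le> T" for x y
  proof -
    \<comment> \<open>The difference of the potentials counts net entries into the half-column x + 1
      below y, since passing its upper end would visit (x + 1, y). It telescopes to zero because
      both ends of the path lie in columns 0 and T + 1.\<close>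
    define g :: "nat \<Rightarrow> int" where "g i = of_bool (fst (u i) = x + 1 \<and> snd (u i) < y)" for i
    have "c i x y - c i (x + 1) y = g (Suc i) - g i" if i: "i < k" for i
    proof -
      have "u i \<noteq> (x + 1, y)" "u (Suc i) \<noteq> (x + 1, y)" using ne i by auto
      moreover have "\<bar>fst (u (Suc i)) - fst (u i)\<bar> + \<bar>snd (u (Suc i)) - snd (u i)\<bar> = 1" using u(1) i .
      ultimately show ?thesis
        unfolding c_def g_def by (cases "u i"; cases "u (Suc i)") (auto simp: of_bool_def split: if_splits)
    qed
    then have "F x y - F (x + 1) y = (\<Sum>i<k. g (Suc i) - g i)"
      unfolding F_def sum_subtractf[symmetric] by (intro sum.cong) auto
    also have "\<dots> = g k - g 0" by (rule sum_lessThan_telescope)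
    also have "\<dots> = 0" unfolding g_def using u x by simp
    finally show ?thesis by simp
  qed
  have k0: "k > 0" using u T by (cases k) auto
  have l0: "l > 0" using w T by (cases l) auto
  \<comment> \<open>At interior times the path is in columns 1 to T, so only its first step joins
    columns 0 and 1. In the same way only the last step joins T and T + 1.\<close>
  have F0: "F 0 y = of_bool (y0 < y)" for y
  proof -
    have "fst (u (Suc 0)) \<ge> 1"
      using u(3) u(4)[of "Suc 0"] T k0 by (cases "k = Suc 0") auto
    then have u1: "fst (u (Suc 0)) = 1" using u(1)[of 0] u(2) k0 by auto
    have "c i 0 y = 0" if "i < k" "i \<noteq> 0" for i
    proof -
      have "fst (u i) \<ge> 1" using u(4)[of i] that by auto
      moreover have "fst (u (Suc i)) \<ge> 1" using u(3) u(4)[of "Suc i"] that T by (cases "Suc i = k") auto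
      ultimately show ?thesis unfolding c_def by auto
    qed
    then have "F 0 y = c 0 0 y"
      unfolding F_def using k0 by (subst sum.remove[of _ 0]) auto
    then show ?thesis unfolding c_def using u1 u by simp
  qed
  have FT: "F T y = of_bool (y1 < y)" for y
  proof -
    obtain m where m: "k = Suc m" using k0 by (cases k) auto
    have "fst (u m) \<le> T"
      using u(2) u(4)[of m] T m by (cases "m = 0") auto
    then have um: "u m = (T, y1)" using u(1)[of m] u(3) m by (cases "u m") auto
    have "c i T y = 0" if "i < k" "i \<noteq> m" for i
    proof -
      have "fst (u i) \<le> T" using u(2) u(4)[of i] that T by (cases "i = 0") auto
      moreover have "fst (u (Suc i)) \<le> T" using u(4)[of "Suc i"] that m by auto
      ultimately show ?thesis unfolding c_def by auto
    qed
    then have "F T y = c m T y"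
      unfolding F_def using m by (subst sum.remove[of _ m]) auto
    then show ?thesis unfolding c_def using um u m by simp
  qed
  \<comment> \<open>The end point of w in column T + 1 is left out because \<open>horz\<close>
    reaches only column T; the last step is horizontal, so the row \<open>z1\<close> is already
    attained before it.\<close>
  have const: "F (fst (w j)) (snd (w j)) = F 0 z0" if "j < l" for j
    using that
  proof (induction j)
    case 0
    then show ?case using w by simp
  next
    case (Suc j)
    have IH: "F (fst (w j)) (snd (w j)) = F 0 z0" using Suc by simp
    obtain x y where wj: "w j = (x, y)" by (cases "w j")
    obtain x' y' where wj': "w (Suc j) = (x', y')" by (cases "w (Suc j)")
    have ne: "u i \<noteq> (x, y)" "u i \<noteq> (x', y')" if "i \<le> k" for i
      using disj[of i j] disj[of i "Suc j"] that Suc wj wj' by auto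
    have adj: "\<bar>x' - x\<bar> + \<bar>y' - y\<bar> = 1" using w(1)[of j] Suc wj wj' by simp
    have x: "0 \<le> x" "x \<le> T" using w(2) w(4)[of j] Suc wj T by (cases "j = 0"; auto)+
    have x': "0 \<le> x'" "x' \<le> T" using w(4)[of "Suc j"] Suc wj' by auto
    consider "x' = x + 1" "y' = y" | "x' = x - 1" "y' = y" | "x' = x" "y' = y + 1" | "x' = x" "y' = y - 1"
      using adj by linarith
    then have "F x' y' = F x y"
    proof cases
      case 1
      then show ?thesis using horz[of x y] ne x x' by simp
    next
      case 2
      then show ?thesis using horz[of x' y] ne x x' by simp
    next
      case 3
      then show ?thesis using vert[of x y] ne by simp
    next
      case 4
      then show ?thesis using vert[of x y'] ne by simp
    qed
    then show ?case using IH wj wj' by simp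
  qed
  obtain m where m: "l = Suc m" using l0 by (cases l) auto
  have "fst (w m) \<le> T"
    using w(2) w(4)[of m] T m by (cases "m = 0") auto
  then have "w m = (T, z1)" using w(1)[of m] w(3) m by (cases "w m") auto
  then have "F T z1 = F 0 z0" using const[of m] m by simp
  then show ?thesis using F0 FT by (simp add: of_bool_def split: if_splits)
qed

text \<open>A change of order between entrance and exit forces the paths to share a point, whatever
  the two environments are. The parity hypothesis excludes a coincidence of the end points, so the
  common point lies inside the slab.\<close>

lemma rays_meet:
  assumes T: "1 \<le> T" and "cross \<omega> 1 T y y'" "cross \<omega>' 1 T z z'"
    and "odd (y - z)" and "(y < z) \<noteq> (y' < z')"
  shows "\<exists>i j. (\<forall>i'\<le>i. col (ray \<omega> ((1, y), East) i') \<in> {1..T}) \<and>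
    (\<forall>j'\<le>j. col (ray \<omega>' ((1, z), East) j') \<in> {1..T}) \<and>
    fst (ray \<omega> ((1, y), East) i) = fst (ray \<omega>' ((1, z), East) j)"
proof -
  obtain k where k: "\<forall>i<k. col (ray \<omega> ((1, y), East) i) \<in> {1..T}" "ray \<omega> ((1, y), East) k = ((T + 1, y'), East)"
    using assms unfolding cross_def by blast
  obtain l where l: "\<forall>i<l. col (ray \<omega>' ((1, z), East) i) \<in> {1..T}" "ray \<omega>' ((1, z), East) l = ((T + 1, z'), East)"
    using assms unfolding cross_def by blast
  \<comment> \<open>The ray is preceded by the point in column 0 from which it enters, which makes
    it a path from column 0 to column T + 1.\<close>
  define P where "P \<omega> y i = (case i of 0 \<Rightarrow> (0, y) | Suc i \<Rightarrow> fst (ray \<omega> ((1, y), East) i))" for \<omega> i and y :: int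
  have P0: "P \<omega> y 0 = (0, y)" for \<omega> y by (simp add: P_def)
  have PS: "P \<omega> y (Suc i) = fst (ray \<omega> ((1, y), East) i)" for \<omega> y i by (simp add: P_def)
  have adj: "\<bar>fst (P \<omega> y (Suc i)) - fst (P \<omega> y i)\<bar> + \<bar>snd (P \<omega> y (Suc i)) - snd (P \<omega> y i)\<bar> = 1" for \<omega> y i
  proof (cases i)
    case (Suc j)
    define s where "s = ray \<omega> ((1, y), East) j"
    have "\<bar>col (step \<omega> s) - col s\<bar> + \<bar>row (step \<omega> s) - row s\<bar> = 1"
      by (cases s; cases "fst s"; cases "paired (site_of \<omega> (fst s)) (opposite (snd s))")
        (auto simp: step_def Let_def)
    then show ?thesis unfolding Suc PS by (simp add: s_def ray_Suc)
  qed (simp add: P_def)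
  have cu: "fst (P \<omega> y i) \<in> {1..T}" if "0 < i" "i < Suc k" for i
    using that k PS by (cases i) auto
  have cw: "fst (P \<omega>' z i) \<in> {1..T}" if "0 < i" "i < Suc l" for i
    using that l PS by (cases i) auto
  have uk: "P \<omega> y (Suc k) = (T + 1, y')" and wl: "P \<omega>' z (Suc l) = (T + 1, z')"
    using k l PS by auto
  have "\<exists>i j. i \<le> Suc k \<and> j \<le> Suc l \<and> P \<omega> y i = P \<omega>' z j"
  proof (rule ccontr)
    assume "\<not> ?thesis"
    then have "P \<omega> y i \<noteq> P \<omega>' z j" if "i \<le> Suc k" "j \<le> Suc l" for i j using that by blast
    then have "y < z \<longleftrightarrow> y' < z'"
      by (intro disjoint_paths_ordered[of T "Suc k" "P \<omega> y" y y' "Suc l" "P \<omega>' z"])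
        (use T adj P0 uk wl cu cw in auto)
    then show False using assms by simp
  qed
  then obtain i j where ij: "i \<le> Suc k" "j \<le> Suc l" "P \<omega> y i = P \<omega>' z j" by blast
  have par: "odd (y' - z')" using cross_even[OF assms(2)] cross_even[OF assms(3)] assms(4) by simp
  have ri: "(i = 0 \<and> fst (P \<omega> y i) = 0) \<or> (i = Suc k \<and> fst (P \<omega> y i) = T + 1) \<or>
      (0 < i \<and> i < Suc k \<and> fst (P \<omega> y i) \<in> {1..T})"
    using cu[of i] ij(1) P0[of \<omega> y] uk by (metis bot_nat_0.not_eq_extremum fst_conv le_neq_implies_less)
  have rj: "(j = 0 \<and> fst (P \<omega>' z j) = 0) \<or> (j = Suc l \<and> fst (P \<omega>' z j) = T + 1) \<or>
      (0 < j \<and> j < Suc l \<and> fst (P \<omega>' z j) \<in> {1..T})"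
    using cw[of j] ij(2) P0[of \<omega>' z] wl by (metis bot_nat_0.not_eq_extremum fst_conv le_neq_implies_less)
  have "fst (P \<omega> y i) = fst (P \<omega>' z j)" using ij(3) by simp
  then have range: "i = 0 \<longleftrightarrow> j = 0" "i = Suc k \<longleftrightarrow> j = Suc l"
    using ri rj T by auto
  have "i \<noteq> 0"
  proof
    assume "i = 0"
    then have "j = 0" using range by simp
    then have "y = z" using ij(3) \<open>i = 0\<close> P0 by simp
    then show False using assms(4) by simp
  qed
  moreover have "i \<noteq> Suc k"
  proof
    assume "i = Suc k"
    then have "j = Suc l" using range by simp
    then have "y' = z'" using ij(3) \<open>i = Suc k\<close> uk wl by simp
    then show False using par by simp
  qed
  ultimately have "0 < i" "i < Suc k" "0 < j" "j < Suc l"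
    using ri rj range by auto
  then obtain i0 j0 where "i = Suc i0" "j = Suc j0" "i0 < k" "j0 < l"
    by (metis Suc_less_eq gr0_conv_Suc)
  then show ?thesis using ij(3) k(1) l(1) PS by (rule_tac x = i0 in exI, rule_tac x = j0 in exI) auto
qed

text \<open>In the Manhattan orientation every vertex has two outgoing edges. The two states send
  the oriented ray into one or the other, and the reversal of the second ray leaves along one of the
  two.\<close>

lemma joined_by_some_state:
  assumes "oriented (v, h)" "\<not> oriented (v, h')"
  shows "step \<omega> (v, h) = reversed (v, h') \<or> step (fun_upd \<omega> v (\<not> \<omega> v)) (v, h) = reversed (v, h')"
  using assms
  by (cases v; cases h; cases h'; cases "\<omega> v")
     (auto simp: step_def reversed_def site_of_def oriented_def Let_def)

lemma turn_back_if_joined: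
  assumes y: "\<forall>i'\<le>i. col (ray \<omega> ((a, y), East) i') \<in> {a..b}"
    and z: "\<forall>j'\<le>j. col (ray \<omega> ((a, z), East) j') \<in> {a..b}"
    and joined: "step \<omega> (ray \<omega> ((a, y), East) i) = reversed (ray \<omega> ((a, z), East) j)"
  shows "turn_back \<omega> a b y z"
proof -
  define s where "s = ray \<omega> ((a, z), East) j"
  have "\<forall>j'<j. col (ray \<omega> ((a, z), East) j') \<in> {a..b}" using z by simp
  note r = run_reversed[OF this s_def[symmetric]]
  have 1: "\<forall>i'<Suc i. col (ray \<omega> ((a, y), East) i') \<in> {a..b}" using y by simp
  have 2: "ray \<omega> ((a, y), East) (Suc i) = reversed s" using joined by (simp add: s_def ray_Suc)
  have "\<forall>i'<Suc i + j. col (ray \<omega> ((a, y), East) i') \<in> {a..b}"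
    by (rule runs_append[OF 1 2 r(1)])
  moreover have "ray \<omega> ((a, y), East) (Suc i + j) = ((a - 1, z), West)"
    unfolding ray_add 2 r(2) by simp
  ultimately show ?thesis unfolding turn_back_def by blast
qed

subsection \<open>Gates\<close>

text \<open>At an even column and even row a mirror is NW. It deflects the eastbound ray to the
  south, the empty site below lets it pass, and the mirror two rows down sends it east
  again.\<close>

lemma cross_gate_column:
  assumes "even t" "even r" "\<not> \<omega> (t, r - 1)" "\<omega> (t, r - 2)"
  shows "cross \<omega> t t r (if \<omega> (t, r) then r - 2 else r)"
proof (cases "\<omega> (t, r)")
  case True
  have 1: "step \<omega> ((t, r), East) = ((t, r - 1), South)"
    and 2: "step \<omega> ((t, r - 1), South) = ((t, r - 2), South)"
    and 3: "step \<omega> ((t, r - 2), South) = ((t + 1, r - 2), East)"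
    using assms True by (simp_all add: step_def site_of_def Let_def)
  have r: "ray \<omega> ((t, r), East) (Suc 0) = ((t, r - 1), South)"
    "ray \<omega> ((t, r), East) (Suc (Suc 0)) = ((t, r - 2), South)"
    "ray \<omega> ((t, r), East) (Suc (Suc (Suc 0))) = ((t + 1, r - 2), East)"
    by (simp_all only: ray_Suc ray_0 1 2 3)
  have "\<forall>i<Suc (Suc (Suc 0)). col (ray \<omega> ((t, r), East) i) \<in> {t..t}"
    unfolding less_Suc_eq using r by auto
  then show ?thesis unfolding cross_def using r(3) True by (intro exI[of _ "Suc (Suc (Suc 0))"]) auto
next
  case False
  then have "ray \<omega> ((t, r), East) (Suc 0) = ((t + 1, r), East)"
    by (simp add: ray_Suc step_def site_of_def Let_def)
  then show ?thesis unfolding cross_def using False by (intro exI[of _ "Suc 0"]) auto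
qed

text \<open>A gate is an even column which the ray crosses once, and where the mirror at the row of arrival
  decides whether the ray is displaced by two rows.\<close>

definition gates :: "(vertex \<Rightarrow> bool) \<Rightarrow> int \<Rightarrow> int \<Rightarrow> int \<Rightarrow> bool \<Rightarrow> int set" where
  "gates \<omega> a c y \<beta> = {t. even t \<and> a < t \<and> t < c \<and>
     (\<exists>r. cross \<omega> a (t - 1) y r \<and> \<not> \<omega> (t, r - 1) \<and> \<omega> (t, r - 2) \<and> \<omega> (t, r) = \<beta> \<and>
       (\<exists>e. cross \<omega> (t + 1) c (if \<beta> then r - 2 else r) e))}"

lemma gates_subset: "gates \<omega> a c y \<beta> \<subseteq> {t \<in> {a<..<c}. even t}"
  by (auto simp: gates_def)

lemma finite_gates [simp]: "finite (gates \<omega> a c y \<beta>)"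
  by (rule finite_subset[of _ "{a<..<c}"]) (auto simp: gates_def)

lemma gates_disjoint: "gates \<omega> a c y True \<inter> gates \<omega> a c y False = {}"
  unfolding gates_def using cross_unique by blast

lemma gates_cong:
  assumes "\<And>x z. x \<in> {a..c} \<Longrightarrow> \<omega> (x, z) = \<omega>' (x, z)"
  shows "gates \<omega> a c y \<beta> = gates \<omega>' a c y \<beta>"
proof -
  have c: "cross \<omega> p q u v \<longleftrightarrow> cross \<omega>' p q u v" if "a \<le> p" "q \<le> c" for p q u v
    using cross_cong[of \<omega> p q u v \<omega>'] cross_cong[of \<omega>' p q u v \<omega>] assms that by auto
  have "even t \<and> a < t \<and> t < c \<and>
     (\<exists>r. cross \<omega> a (t - 1) y r \<and> \<not> \<omega> (t, r - 1) \<and> \<omega> (t, r - 2) \<and> \<omega> (t, r) = \<beta> \<and>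
       (\<exists>e. cross \<omega> (t + 1) c (if \<beta> then r - 2 else r) e)) \<longleftrightarrow> even t \<and> a < t \<and> t < c \<and>
     (\<exists>r. cross \<omega>' a (t - 1) y r \<and> \<not> \<omega>' (t, r - 1) \<and> \<omega>' (t, r - 2) \<and> \<omega>' (t, r) = \<beta> \<and>
       (\<exists>e. cross \<omega>' (t + 1) c (if \<beta> then r - 2 else r) e))" for t
  proof (cases "a < t \<and> t < c")
    case True
    then have "\<omega> (t, z) = \<omega>' (t, z)" for z using assms by simp
    then show ?thesis using c[of a "t - 1"] c[of "t + 1" c] True by simp
  qed blast
  then show ?thesis unfolding gates_def by blast
qed

lemma gates_translate:
  assumes "even j"
  shows "gates \<omega> a c (y + j) \<beta> = gates (\<lambda>(x, y). \<omega> (x, y + j)) a c y \<beta>"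
proof -
  have c: "cross \<omega> p q (u + j) (v + j) \<longleftrightarrow> cross (\<lambda>(x, y). \<omega> (x, y + j)) p q u v" for p q u v
    using cross_translate[of 0 j \<omega> p q u v] assms by simp
  have ex: "(\<exists>r. P r) \<longleftrightarrow> (\<exists>r. P (r + j))" for P :: "int \<Rightarrow> bool"
    by (metis diff_add_cancel)
  have e: "(\<exists>e. cross \<omega> p q (u + j) e) \<longleftrightarrow> (\<exists>e. cross (\<lambda>(x, y). \<omega> (x, y + j)) p q u e)" for p q u
    by (subst ex) (simp add: c)
  have eq: "r + j - 1 = (r - 1) + j" "r + j - 2 = (r - 2) + j" for r by simp_all
  have body: "(cross \<omega> a (t - 1) (y + j) (r + j) \<and> \<not> \<omega> (t, r + j - 1) \<and> \<omega> (t, r + j - 2) \<and> \<omega> (t, r + j) = \<beta> \<and>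
       (\<exists>e. cross \<omega> (t + 1) c (if \<beta> then r + j - 2 else r + j) e)) \<longleftrightarrow>
     (cross (\<lambda>(x, y). \<omega> (x, y + j)) a (t - 1) y r \<and> \<not> (\<lambda>(x, y). \<omega> (x, y + j)) (t, r - 1) \<and>
       (\<lambda>(x, y). \<omega> (x, y + j)) (t, r - 2) \<and> (\<lambda>(x, y). \<omega> (x, y + j)) (t, r) = \<beta> \<and>
       (\<exists>e. cross (\<lambda>(x, y). \<omega> (x, y + j)) (t + 1) c (if \<beta> then r - 2 else r) e))" for t r
    unfolding eq by (cases \<beta>) (simp_all only: c e if_True if_False prod.case)
  show ?thesis
    unfolding gates_def by (rule Collect_cong) (subst ex, simp only: body)
qed

text \<open>The ray passes column t only once, so it is a concatenation of a piece left of t, the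
  gate, and a piece restarted to the right of it. Gates on either side are determined by the columns
  of that side and its entrance row.\<close>

lemma gates_split:
  assumes "even y" "even t" "a < t" "t < c"
    and r: "cross \<omega> a (t - 1) y r" "\<not> \<omega> (t, r - 1)" "\<omega> (t, r - 2)"
    and r': "r' = (if \<omega> (t, r) then r - 2 else r)" "cross \<omega> (t + 1) c r' e"
  shows "cross \<omega> a c y e"
    and "gates \<omega> a c y \<gamma> =
      gates \<omega> a (t - 1) y \<gamma> \<union> (if \<gamma> = \<omega> (t, r) then {t} else {}) \<union> gates \<omega> (t + 1) c r' \<gamma>"
proof -
  have er: "even r" using cross_even[OF r(1)] assms by simp
  have col: "cross \<omega> t t r r'" unfolding r' by (rule cross_gate_column) fact+
  have at: "cross \<omega> a t y r'"
    using cross_trans[of \<omega> a "t - 1" y r t r'] r col assms by simp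
  show "cross \<omega> a c y e"
    using cross_trans[OF at r'(2)] assms by simp
  have tc: "cross \<omega> t c r e"
    using cross_trans[OF col r'(2)] assms by simp
  have left: "t1 \<in> gates \<omega> a c y \<gamma> \<longleftrightarrow> t1 \<in> gates \<omega> a (t - 1) y \<gamma>" if t1: "t1 < t" for t1
  proof (cases "even t1 \<and> a < t1")
    case True
    \<comment> \<open>Gates sit in even columns, so an odd column separates two of them and neither
      of the intermediate slabs is empty.\<close>
    then have le: "t1 + 1 \<le> t - 1" "t1 < t - 1" using t1 \<open>even t\<close> by presburger+
    have "(\<exists>e. cross \<omega> (t1 + 1) c q' e) \<longleftrightarrow> (\<exists>e. cross \<omega> (t1 + 1) (t - 1) q' e)"
      if q: "cross \<omega> a (t1 - 1) y q" "\<not> \<omega> (t1, q - 1)" "\<omega> (t1, q - 2)" "q' = (if \<omega> (t1, q) then q - 2 else q)" for q q'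
    proof
      assume "\<exists>e. cross \<omega> (t1 + 1) c q' e"
      then obtain f where "cross \<omega> (t1 + 1) c q' f" by blast
      then obtain g where "cross \<omega> (t1 + 1) (t - 1) q' g"
        by (rule cross_prefix[where b = "t - 1"]) (use le assms in auto)
      then show "\<exists>e. cross \<omega> (t1 + 1) (t - 1) q' e" by blast
    next
      assume "\<exists>e. cross \<omega> (t1 + 1) (t - 1) q' e"
      then obtain f where f: "cross \<omega> (t1 + 1) (t - 1) q' f" by blast
      have eq: "even q" using cross_even[OF q(1)] assms by simp
      have "cross \<omega> t1 t1 q q'" unfolding q(4) by (rule cross_gate_column) (use True eq q in auto)
      then have "cross \<omega> a t1 y q'"
        using cross_trans[of \<omega> a "t1 - 1" y q t1 q'] q(1) True by simp
      then have "cross \<omega> a (t - 1) y f"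
        by (rule cross_trans[OF _ f]) (use True le in auto)
      then have "f = r" using r(1) cross_unique by blast
      then have "cross \<omega> (t1 + 1) c q' e"
        using cross_trans[OF f, of c e] tc le assms by simp
      then show "\<exists>e. cross \<omega> (t1 + 1) c q' e" by blast
    qed
    then have "(cross \<omega> a (t1 - 1) y q \<and> \<not> \<omega> (t1, q - 1) \<and> \<omega> (t1, q - 2) \<and> \<omega> (t1, q) = \<gamma> \<and>
        (\<exists>e. cross \<omega> (t1 + 1) c (if \<gamma> then q - 2 else q) e)) \<longleftrightarrow>
      (cross \<omega> a (t1 - 1) y q \<and> \<not> \<omega> (t1, q - 1) \<and> \<omega> (t1, q - 2) \<and> \<omega> (t1, q) = \<gamma> \<and>
        (\<exists>e. cross \<omega> (t1 + 1) (t - 1) (if \<gamma> then q - 2 else q) e))" for q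
      by (cases "cross \<omega> a (t1 - 1) y q \<and> \<not> \<omega> (t1, q - 1) \<and> \<omega> (t1, q - 2) \<and> \<omega> (t1, q) = \<gamma>") blast+
    moreover have "t1 < c" using t1 assms by simp
    ultimately show ?thesis using True le t1 unfolding gates_def mem_Collect_eq by simp
  next
    case False
    then show ?thesis unfolding gates_def by blast
  qed
  have right: "t1 \<in> gates \<omega> a c y \<gamma> \<longleftrightarrow> t1 \<in> gates \<omega> (t + 1) c r' \<gamma>" if t1: "t < t1" for t1
  proof (cases "even t1 \<and> t1 < c")
    case True
    then have le: "t + 1 \<le> t1 - 1" "t + 1 < t1" using t1 \<open>even t\<close> by presburger+
    have "cross \<omega> a (t1 - 1) y q \<longleftrightarrow> cross \<omega> (t + 1) (t1 - 1) r' q" for q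
    proof
      assume q: "cross \<omega> a (t1 - 1) y q"
      obtain q0 where q0: "cross \<omega> (t + 1) (t1 - 1) r' q0"
        using cross_prefix[OF r'(2), of "t1 - 1"] le True by auto
      have "cross \<omega> a (t1 - 1) y q0"
        by (rule cross_trans[OF at q0]) (use le assms in auto)
      then show "cross \<omega> (t + 1) (t1 - 1) r' q" using q q0 cross_unique by blast
    next
      assume "cross \<omega> (t + 1) (t1 - 1) r' q"
      then show "cross \<omega> a (t1 - 1) y q"
        by (rule cross_trans[OF at]) (use le assms in auto)
    qed
    then show ?thesis using True le assms t1 unfolding gates_def by auto
  next
    case False
    then show ?thesis unfolding gates_def by blast
  qed
  have mid: "t \<in> gates \<omega> a c y \<gamma> \<longleftrightarrow> \<gamma> = \<omega> (t, r)"
  proof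
    assume "t \<in> gates \<omega> a c y \<gamma>"
    then show "\<gamma> = \<omega> (t, r)"
      unfolding gates_def using cross_unique[OF r(1)] by blast
  next
    assume "\<gamma> = \<omega> (t, r)"
    then show "t \<in> gates \<omega> a c y \<gamma>"
      unfolding gates_def using assms by blast
  qed
  have bl: "t1 \<notin> gates \<omega> a (t - 1) y \<gamma>" if "t \<le> t1" for t1
    using that gates_subset[of \<omega> a "t - 1" y \<gamma>] by auto
  have br: "t1 \<notin> gates \<omega> (t + 1) c r' \<gamma>" if "t1 \<le> t" for t1
    using that gates_subset[of \<omega> "t + 1" c r' \<gamma>] by auto
  show "gates \<omega> a c y \<gamma> =
      gates \<omega> a (t - 1) y \<gamma> \<union> (if \<gamma> = \<omega> (t, r) then {t} else {}) \<union> gates \<omega> (t + 1) c r' \<gamma>"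
  proof (rule set_eqI)
    fix t1
    consider "t1 < t" | "t1 = t" | "t < t1" by linarith
    then show "t1 \<in> gates \<omega> a c y \<gamma> \<longleftrightarrow> t1 \<in> gates \<omega> a (t - 1) y \<gamma> \<union>
        (if \<gamma> = \<omega> (t, r) then {t} else {}) \<union> gates \<omega> (t + 1) c r' \<gamma>"
      by cases (use left right mid bl br in auto)
  qed
qed

text \<open>The parameter \<open>d\<close> below is the exit row the ray would have if all its gates were inactive.\<close>

definition gate_event :: "(vertex \<Rightarrow> bool) \<Rightarrow> int \<Rightarrow> int \<Rightarrow> int \<Rightarrow> int set \<Rightarrow> int set \<Rightarrow> int \<Rightarrow> bool" where
  "gate_event \<omega> a c y Z U d \<longleftrightarrow> cross \<omega> a c y (d - 2 * int (card U)) \<and>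
     gates \<omega> a c y False = Z \<and> gates \<omega> a c y True = U"

text \<open>Inserting the mirror at the gate lowers the ray by two rows, and lowering the
  environment to the right of t by two rows carries the continuation along. The other gates persist
  and the exit row falls by two, so the parameter \<open>d\<close> is the same on both
  sides.\<close>

lemma gate_event_activate:
  assumes "even y" "even t" "a < t" "t < c" and t: "t \<notin> Z" "t \<notin> U"
    and r: "cross \<omega> a (t - 1) y r"
    and left: "\<And>x z. x < t \<Longrightarrow> \<omega>' (x, z) = \<omega> (x, z)"
    and mid: "\<omega>' (t, r - 1) = \<omega> (t, r - 1)" "\<omega>' (t, r - 2) = \<omega> (t, r - 2)" "\<not> \<omega> (t, r)" "\<omega>' (t, r)"
    and right: "\<And>x z. t < x \<Longrightarrow> \<omega>' (x, z) = \<omega> (x, z + 2)"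
  shows "gate_event \<omega>' a c y Z (insert t U) d \<longleftrightarrow> gate_event \<omega> a c y (insert t Z) U d"
proof -
  have r': "cross \<omega>' a (t - 1) y r"
    by (rule cross_cong[OF r]) (use left in auto)
  have shift_site: "cross \<omega>' (t + 1) c (u - 2) (v - 2) \<longleftrightarrow> cross \<omega> (t + 1) c u v" for u v
  proof -
    have "cross \<omega> (t + 1) c u v \<longleftrightarrow> cross (\<lambda>(x, y). \<omega> (x, y + 2)) (t + 1) c (u - 2) (v - 2)"
      using cross_translate[of 0 2 \<omega> "t + 1" c "u - 2" "v - 2"] by simp
    also have "\<dots> \<longleftrightarrow> cross \<omega>' (t + 1) c (u - 2) (v - 2)"
      using cross_cong[of \<omega>' "t + 1" c "u - 2" "v - 2" "\<lambda>(x, y). \<omega> (x, y + 2)"]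
        cross_cong[of "\<lambda>(x, y). \<omega> (x, y + 2)" "t + 1" c "u - 2" "v - 2" \<omega>'] right by auto
    finally show ?thesis by simp
  qed
  have gshift: "gates \<omega>' (t + 1) c (r - 2) \<gamma> = gates \<omega> (t + 1) c r \<gamma>" for \<gamma>
  proof -
    have "gates \<omega> (t + 1) c r \<gamma> = gates (\<lambda>(x, y). \<omega> (x, y + 2)) (t + 1) c (r - 2) \<gamma>"
      using gates_translate[of 2 \<omega> "t + 1" c "r - 2" \<gamma>] by simp
    also have "\<dots> = gates \<omega>' (t + 1) c (r - 2) \<gamma>"
      by (rule gates_cong) (use right in auto)
    finally show ?thesis by simp
  qed
  have gleft: "gates \<omega>' a (t - 1) y \<gamma> = gates \<omega> a (t - 1) y \<gamma>" for \<gamma>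
    by (rule gates_cong) (use left in auto)
  have in1: "t \<in> gates \<omega> a c y False \<longleftrightarrow> \<not> \<omega> (t, r - 1) \<and> \<omega> (t, r - 2) \<and> (\<exists>e. cross \<omega> (t + 1) c r e)"
    unfolding gates_def mem_Collect_eq using cross_unique[OF r] r assms by (metis (full_types))
  have "t \<in> gates \<omega>' a c y True \<longleftrightarrow> \<not> \<omega>' (t, r - 1) \<and> \<omega>' (t, r - 2) \<and> (\<exists>e. cross \<omega>' (t + 1) c (r - 2) e)"
    unfolding gates_def mem_Collect_eq using cross_unique[OF r'] r' assms by (metis (full_types))
  moreover have "(\<exists>e. cross \<omega>' (t + 1) c (r - 2) e) \<longleftrightarrow> (\<exists>e. cross \<omega> (t + 1) c r e)"
    using shift_site[of r] by (metis add_diff_cancel_right')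
  ultimately have in2: "t \<in> gates \<omega>' a c y True \<longleftrightarrow> t \<in> gates \<omega> a c y False"
    using in1 mid by simp
  show ?thesis
  proof (cases "t \<in> gates \<omega> a c y False")
    case False
    then show ?thesis using in2 unfolding gate_event_def by blast
  next
    case True
    then obtain e where e: "\<not> \<omega> (t, r - 1)" "\<omega> (t, r - 2)" "cross \<omega> (t + 1) c r e" using in1 by blast
    define L R where "L \<gamma> = gates \<omega> a (t - 1) y \<gamma>" and "R \<gamma> = gates \<omega> (t + 1) c r \<gamma>" for \<gamma>
    have tL: "t \<notin> L \<gamma>" "t \<notin> R \<gamma>" for \<gamma>
      unfolding L_def R_def using gates_subset[of \<omega> a "t - 1" y \<gamma>] gates_subset[of \<omega> "t + 1" c r \<gamma>] by auto
    have e0: "r = (if \<omega> (t, r) then r - 2 else r)" using mid by simp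
    note s = gates_split[OF assms(1-4) r e(1,2) e0 e(3)]
    have e': "\<not> \<omega>' (t, r - 1)" "\<omega>' (t, r - 2)" "r - 2 = (if \<omega>' (t, r) then r - 2 else r)"
      "cross \<omega>' (t + 1) c (r - 2) (e - 2)"
      using e mid shift_site by auto
    note s' = gates_split[OF assms(1-4) r' e']
    have g: "gates \<omega> a c y False = insert t (L False \<union> R False)" "gates \<omega> a c y True = L True \<union> R True"
      using s(2)[of False] s(2)[of True] mid unfolding L_def R_def by auto
    have g': "gates \<omega>' a c y False = L False \<union> R False" "gates \<omega>' a c y True = insert t (L True \<union> R True)"
      using s'(2)[of False] s'(2)[of True] mid gshift gleft unfolding L_def R_def by auto
    have f: "finite (L True \<union> R True)" unfolding L_def R_def by simp
    have ge: "gate_event \<omega>' a c y Z (insert t U) d \<longleftrightarrow>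
        e - 2 = d - 2 * int (card (insert t U)) \<and> L False \<union> R False = Z \<and> L True \<union> R True = U"
      unfolding gate_event_def g' using s'(1) cross_unique[OF s'(1)] tL t
      by (metis Un_iff insert_ident)
    have ge': "gate_event \<omega> a c y (insert t Z) U d \<longleftrightarrow>
        e = d - 2 * int (card U) \<and> L False \<union> R False = Z \<and> L True \<union> R True = U"
      unfolding gate_event_def g using s(1) cross_unique[OF s(1)] tL t
      by (metis Un_iff insert_ident)
    show ?thesis unfolding ge ge' using f t by auto
  qed
qed

subsection \<open>Anticoncentration of binomial variables\<close>

text \<open>Induction adding one independent bit: with q = p (1 - p), the fourth moment grows by 6 q
  times the second moment plus the fourth moment of a single bit, which is at most q.\<close>

lemma expect_centred_moments:
  fixes p :: real and S :: "'a set"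
  assumes "finite S" and p: "0 < p" "p < 1"
  defines "X \<equiv> \<lambda>B. real (card B) - p * card S"
  shows "expect p S X = 0" "expect p S (\<lambda>B. X B ^ 2) = p * (1 - p) * card S"
    "expect p S (\<lambda>B. X B ^ 4) \<le> 3 * (p * (1 - p) * card S) ^ 2 + p * (1 - p) * card S"
  using assms(1) unfolding X_def
proof (induction S rule: finite_induct)
  case empty
  case 1 show ?case by simp
  case 2 show ?case by simp
  case 3 show ?case by simp
next
  case (insert v S)
  define q where "q = p * (1 - p)"
  define X where "X B = real (card B) - p * card S" for B :: "'a set"
  have q0: "0 < q" using p by (simp add: q_def)
  have X1: "real (card (insert v B)) - p * card (insert v S) = X B + (1 - p)" if "B \<subseteq> S" for B
  proof -
    have "finite B" "v \<notin> B" using that insert finite_subset by auto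
    then show ?thesis using insert by (simp add: X_def algebra_simps)
  qed
  have X0: "real (card B) - p * card (insert v S) = X B - p" for B :: "'a set"
    using insert by (simp add: X_def algebra_simps)
  have split: "expect p (insert v S) (\<lambda>B. (real (card B) - p * card (insert v S)) ^ m)
      = expect p S (\<lambda>B. p * (X B + (1 - p)) ^ m + (1 - p) * (X B - p) ^ m)" for m
  proof -
    have "expect p (insert v S) (\<lambda>B. (real (card B) - p * card (insert v S)) ^ m)
      = p * expect p S (\<lambda>B. (real (card (insert v B)) - p * card (insert v S)) ^ m)
        + (1 - p) * expect p S (\<lambda>B. (real (card B) - p * card (insert v S)) ^ m)"
      by (rule expect_insert) fact+
    also have "expect p S (\<lambda>B. (real (card (insert v B)) - p * card (insert v S)) ^ m)
      = expect p S (\<lambda>B. (X B + (1 - p)) ^ m)"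
      by (intro expect_cong) (simp only: X1)
    finally show ?thesis by (simp only: X0 expect_add expect_cmult)
  qed
  have IH: "expect p S X = 0" "expect p S (\<lambda>B. X B ^ 2) = q * card S"
    "expect p S (\<lambda>B. X B ^ 4) \<le> 3 * (q * card S) ^ 2 + q * card S"
    using insert.IH unfolding X_def q_def by auto
  have c: "card (insert v S) = Suc (card S)" using insert by simp
  case 1
  have "expect p S (\<lambda>B. p * (X B + (1 - p)) ^ 1 + (1 - p) * (X B - p) ^ 1) = expect p S X"
    by (intro expect_cong) (simp add: algebra_simps)
  then show ?case using split[of 1] IH by simp
  case 2
  have "expect p S (\<lambda>B. p * (X B + (1 - p)) ^ 2 + (1 - p) * (X B - p) ^ 2) = expect p S (\<lambda>B. X B ^ 2 + q)"
    by (intro expect_cong) (simp add: q_def algebra_simps power2_eq_square)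
  also have "\<dots> = q * card S + q"
    using IH(2) insert.hyps by (simp only: expect_add expect_const)
  also have "\<dots> = q * card (insert v S)"
    unfolding c by (simp add: algebra_simps)
  finally show ?case unfolding split[of 2] q_def .
  case 3
  \<comment> \<open>Four times the third centred moment of a single bit, which multiplies the
    vanishing mean of \<open>X\<close>; \<open>s\<close> is the fourth centred moment of that
    bit.\<close>
  define t where "t = 4 * (p * (1 - p) ^ 3 - (1 - p) * p ^ 3)"
  define s where "s = p * (1 - p) ^ 4 + (1 - p) * p ^ 4"
  have "expect p S (\<lambda>B. p * (X B + (1 - p)) ^ 4 + (1 - p) * (X B - p) ^ 4)
    = expect p S (\<lambda>B. X B ^ 4 + (6 * q) * X B ^ 2 + t * X B + s)"
    by (intro expect_cong) (simp add: q_def t_def s_def algebra_simps power2_eq_square power3_eq_cube power4_eq_xxxx)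
  also have "\<dots> = expect p S (\<lambda>B. X B ^ 4) + 6 * q * (q * card S) + s"
    using IH(1,2) insert.hyps by (simp only: expect_add expect_cmult expect_const mult_zero_right add_0_right)
  also have "\<dots> \<le> 3 * (q * card S) ^ 2 + q * card S + 6 * q * (q * card S) + q"
  proof -
    have "s = q * ((1 - p) ^ 3 + p ^ 3)"
      by (simp add: s_def q_def algebra_simps power2_eq_square power3_eq_cube power4_eq_xxxx)
    moreover have "(1 - p) ^ 3 + p ^ 3 \<le> 1"
    proof -
      have "(1 - p) ^ 3 + p ^ 3 = 1 - 3 * q" by (simp add: q_def algebra_simps power2_eq_square power3_eq_cube)
      then show ?thesis using q0 by simp
    qed
    ultimately have "s \<le> q" using q0 mult_left_mono[of "(1 - p) ^ 3 + p ^ 3" 1 q] by simp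
    then show ?thesis using IH(3) by simp
  qed
  also have "\<dots> \<le> 3 * (q * card (insert v S)) ^ 2 + q * card (insert v S)"
  proof -
    have "0 \<le> 3 * q * q" using q0 by simp
    then show ?thesis unfolding c by (simp add: algebra_simps power2_eq_square)
  qed
  finally show ?case unfolding split q_def .
qed

text \<open>A second moment argument: \<open>Q\<close> has mean at least \<open>2n\<^sup>2\<close> and second moment at most 32 times the
  squared mean, whatever the centre \<open>b\<close>.\<close>

lemma binomial_anticoncentration:
  fixes p :: real and S :: "'a set"
  assumes "finite S" and p: "0 < p" "p < 1" and n: "1 \<le> n" and S: "2 * n\<^sup>2 \<le> p * (1 - p) * card S"
  shows "1 / 128 \<le> prb p S (\<lambda>B. n \<le> \<bar>real (card B) - b\<bar>)"
proof -
  define X where "X B = real (card B) - p * card S" for B :: "'a set"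
  define V where "V = p * (1 - p) * card S"
  define \<beta> where "\<beta> = b - p * card S"
  define A where "A = V + \<beta>\<^sup>2"
  define P where "P = prb p S (\<lambda>B. n \<le> \<bar>real (card B) - b\<bar>)"
  \<comment> \<open>The value 64 A balances the terms: with second moment at most 32 A^2 the
    quadratic term below costs A / 4, the truncation at n^2 costs at most A / 2, and the remaining A
    / 4 is paid by 32 A P. This gives 1 / 128.\<close>
  define \<mu> where "\<mu> = 64 * A"
  have m: "expect p S X = 0" "expect p S (\<lambda>B. X B ^ 2) = V" "expect p S (\<lambda>B. X B ^ 4) \<le> 3 * V\<^sup>2 + V"
    using expect_centred_moments[OF assms(1) p] unfolding X_def V_def by simp_all
  have "1 \<le> n\<^sup>2" using n by simp
  then have V1: "1 \<le> V" and nV: "2 * n\<^sup>2 \<le> V" using S unfolding V_def by linarith+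
  have A0: "1 \<le> A" "2 * n\<^sup>2 \<le> A" using V1 nV unfolding A_def by (auto intro: add_increasing2)
  have eq: "real (card B) - b = X B - \<beta>" for B :: "'a set" by (simp add: X_def \<beta>_def)
  have Q1: "expect p S (\<lambda>B. (X B - \<beta>)\<^sup>2) = A"
  proof -
    have "expect p S (\<lambda>B. (X B - \<beta>)\<^sup>2) = expect p S (\<lambda>B. X B ^ 2 + (- 2 * \<beta>) * X B + \<beta>\<^sup>2)"
      by (intro expect_cong) (simp add: power2_eq_square algebra_simps)
    then show ?thesis using m assms(1) by (simp add: expect_add expect_diff expect_cmult A_def del: mult_minus_left)
  qed
  have Q2: "expect p S (\<lambda>B. ((X B - \<beta>)\<^sup>2)\<^sup>2) \<le> 32 * A\<^sup>2"
  proof -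
    have "expect p S (\<lambda>B. ((X B - \<beta>)\<^sup>2)\<^sup>2) \<le> expect p S (\<lambda>B. 8 * X B ^ 4 + 8 * \<beta> ^ 4)"
    proof (intro expect_mono)
      fix B
      have "(X B - \<beta>)\<^sup>2 \<le> 2 * ((X B)\<^sup>2 + \<beta>\<^sup>2)"
        using zero_le_power2[of "X B + \<beta>"] by (simp add: power2_eq_square algebra_simps)
      then have "((X B - \<beta>)\<^sup>2)\<^sup>2 \<le> (2 * ((X B)\<^sup>2 + \<beta>\<^sup>2))\<^sup>2" by (intro power_mono) auto
      also have "\<dots> \<le> 8 * X B ^ 4 + 8 * \<beta> ^ 4"
        using zero_le_power2[of "(X B)\<^sup>2 - \<beta>\<^sup>2"] by (simp add: power2_eq_square power4_eq_xxxx algebra_simps)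
      finally show "((X B - \<beta>)\<^sup>2)\<^sup>2 \<le> 8 * X B ^ 4 + 8 * \<beta> ^ 4" .
    qed (use p in auto)
    also have "\<dots> = 8 * expect p S (\<lambda>B. X B ^ 4) + 8 * \<beta> ^ 4"
      using assms(1) by (simp add: expect_add expect_cmult)
    also have "\<dots> \<le> 8 * (3 * V\<^sup>2 + V) + 8 * \<beta> ^ 4" using m by simp
    also have "\<dots> \<le> 32 * A\<^sup>2"
    proof -
      have "V \<le> V\<^sup>2" using V1 by (simp add: power2_eq_square)
      moreover have "A\<^sup>2 = V\<^sup>2 + 2 * (V * \<beta>\<^sup>2) + \<beta> ^ 4"
        by (simp add: A_def power2_eq_square power4_eq_xxxx algebra_simps)
      moreover have "0 \<le> V * \<beta>\<^sup>2" "0 \<le> \<beta> ^ 4" using V1 by simp_all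
      moreover have "8 * (3 * w + v) + 8 * t \<le> 32 * a"
        if "v \<le> w" "a = w + 2 * u + t" "0 \<le> u" "0 \<le> t" for v w a u t :: real
        using that by simp
      ultimately show ?thesis by blast
    qed
    finally show ?thesis .
  qed
  have \<mu>0: "\<mu> > 0" using A0 by (simp add: \<mu>_def)
  have "A \<le> expect p S (\<lambda>B. n\<^sup>2 + (1 / (2 * \<mu>)) * ((X B - \<beta>)\<^sup>2)\<^sup>2 + (\<mu> / 2) * of_bool (n \<le> \<bar>X B - \<beta>\<bar>))"
    unfolding Q1[symmetric]
  proof (intro expect_mono)
    fix B
    let ?Q = "(X B - \<beta>)\<^sup>2"
    show "?Q \<le> n\<^sup>2 + (1 / (2 * \<mu>)) * ?Q\<^sup>2 + (\<mu> / 2) * of_bool (n \<le> \<bar>X B - \<beta>\<bar>)"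
    proof (cases "n \<le> \<bar>X B - \<beta>\<bar>")
      case True
      \<comment> \<open>A tangent bound, obtained from the square of Q - \<mu>, takes the place of
        the Cauchy-Schwarz inequality.\<close>
      have "0 \<le> (1 / (2 * \<mu>)) * (?Q - \<mu>)\<^sup>2" using \<mu>0 by simp
      also have "\<dots> = (1 / (2 * \<mu>)) * ?Q\<^sup>2 - ?Q + \<mu> / 2"
        using \<mu>0 by (simp add: power2_eq_square field_simps)
      finally have "?Q \<le> (1 / (2 * \<mu>)) * ?Q\<^sup>2 + \<mu> / 2" by simp
      then show ?thesis using True zero_le_power2[of n] by (simp only: of_bool_eq(2) mult_1_right)
    next
      case False
      then have "\<bar>X B - \<beta>\<bar>\<^sup>2 \<le> n\<^sup>2" by (intro power_mono) auto
      then have "?Q \<le> n\<^sup>2" by simp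
      moreover have "0 \<le> (1 / (2 * \<mu>)) * ?Q\<^sup>2" using \<mu>0 by simp
      ultimately show ?thesis using False by simp
    qed
  qed (use p in auto)
  also have "\<dots> = n\<^sup>2 + (1 / (2 * \<mu>)) * expect p S (\<lambda>B. ((X B - \<beta>)\<^sup>2)\<^sup>2) + (\<mu> / 2) * P"
    using assms(1) unfolding P_def eq by (simp only: expect_add expect_cmult expect_const)
  also have "\<dots> \<le> A / 2 + (1 / (2 * \<mu>)) * (32 * A\<^sup>2) + (\<mu> / 2) * P"
  proof -
    have "(1 / (2 * \<mu>)) * expect p S (\<lambda>B. ((X B - \<beta>)\<^sup>2)\<^sup>2) \<le> (1 / (2 * \<mu>)) * (32 * A\<^sup>2)"
      using Q2 \<mu>0 by (intro mult_left_mono) auto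
    then show ?thesis using A0 by linarith
  qed
  also have "\<dots> = A / 2 + A / 4 + 32 * (A * P)"
    using A0 by (simp add: \<mu>_def power2_eq_square field_simps)
  finally have "A * (1 / 128) \<le> A * P" by simp
  then show ?thesis using A0 unfolding P_def by (simp only: mult_le_cancel_left_pos)
qed

subsection \<open>Slabs of the cylinder\<close>

definition slab :: "nat \<Rightarrow> int \<Rightarrow> int \<Rightarrow> vertex set" where
  "slab n a b = {a..b} \<times> {0..<2 * int n}"

text \<open>A set of mirrors on one period, unrolled to the plane. Sites outside \<open>B\<close>
  have no mirror, so unions of configurations on disjoint slabs behave as independent pieces of one
  environment.\<close>

definition env :: "nat \<Rightarrow> vertex set \<Rightarrow> vertex \<Rightarrow> bool" where
  "env n B = (\<lambda>(x, y). (x, y mod (2 * int n)) \<in> B)"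

lemma finite_slab [simp]: "finite (slab n a b)"
  by (simp add: slab_def)

lemma slab_Un: "a \<le> b + 1 \<Longrightarrow> b \<le> c \<Longrightarrow> slab n a b \<union> slab n (b + 1) c = slab n a c"
  by (auto simp: slab_def)

lemma periodic_env: "n > 0 \<Longrightarrow> periodic (2 * int n) (env n B)"
  by (simp add: periodic_def env_def)

lemma env_Int_slab: "n > 0 \<Longrightarrow> x \<in> {a..b} \<Longrightarrow> env n (B \<inter> slab n a b) (x, z) = env n B (x, z)"
  by (simp add: env_def slab_def)

lemma env_Un: "env n (B \<union> C) v \<longleftrightarrow> env n B v \<or> env n C v"
  by (auto simp: env_def split: prod.split)

lemma env_outside: "B \<subseteq> slab n a b \<Longrightarrow> x \<notin> {a..b} \<Longrightarrow> \<not> env n B (x, z)"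
  by (auto simp: env_def slab_def)

definition shift_site :: "nat \<Rightarrow> int \<Rightarrow> int \<Rightarrow> vertex \<Rightarrow> vertex" where
  "shift_site n i j = (\<lambda>(x, y). (x + i, (y + j) mod (2 * int n)))"

lemma mod_add_cancel_range:
  assumes "(y + j) mod N = (y' + j) mod N" "y \<in> {0..<N}" "y' \<in> {0..<N}"
  shows "y = (y' :: int)"
proof -
  have "(y + j - j) mod N = (y' + j - j) mod N" using assms(1) by (rule mod_diff_cong) simp
  then show ?thesis using assms by simp
qed

lemma inj_on_shift_site: "inj_on (shift_site n i j) (slab n a b)"
  by (auto simp: inj_on_def shift_site_def slab_def intro: mod_add_cancel_range[of _ j "2 * int n"])

lemma shift_slab:
  assumes "n > 0"
  shows "shift_site n i j ` slab n a b = slab n (a + i) (b + i)"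
proof
  show "shift_site n i j ` slab n a b \<subseteq> slab n (a + i) (b + i)"
    using assms by (auto simp: shift_site_def slab_def)
  show "slab n (a + i) (b + i) \<subseteq> shift_site n i j ` slab n a b"
  proof
    fix v assume "v \<in> slab n (a + i) (b + i)"
    then obtain x y where v: "v = (x, y)" "x \<in> {a+i..b+i}" "y \<in> {0..<2 * int n}" by (auto simp: slab_def)
    have "v = shift_site n i j (x - i, (y - j) mod (2 * int n))"
      using v by (simp add: shift_site_def mod_add_left_eq)
    moreover have "(x - i, (y - j) mod (2 * int n)) \<in> slab n a b"
      using v assms by (simp add: slab_def)
    ultimately show "v \<in> shift_site n i j ` slab n a b" by blast
  qed
qed

lemma env_shift:
  assumes "n > 0" "B \<subseteq> slab n a b"
  shows "env n (shift_site n i j ` B) (x + i, y + j) = env n B (x, y)"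
proof
  assume "env n (shift_site n i j ` B) (x + i, y + j)"
  then obtain y' where y': "(x, y') \<in> B" "(y + j) mod (2 * int n) = (y' + j) mod (2 * int n)"
    by (auto simp: env_def shift_site_def)
  have "(y mod (2 * int n) + j) mod (2 * int n) = (y' + j) mod (2 * int n)"
    using y' by (simp add: mod_add_left_eq)
  then have "y mod (2 * int n) = y'"
    by (rule mod_add_cancel_range) (use y' assms in \<open>auto simp: slab_def\<close>)
  then show "env n B (x, y)" using y' by (simp add: env_def)
next
  assume "env n B (x, y)"
  then have "(x, y mod (2 * int n)) \<in> B" by (simp add: env_def)
  then have "shift_site n i j (x, y mod (2 * int n)) \<in> shift_site n i j ` B" by simp
  then show "env n (shift_site n i j ` B) (x + i, y + j)"
    by (simp add: shift_site_def env_def mod_add_left_eq)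
qed

lemma expect_shift:
  assumes "n > 0"
  shows "expect p (slab n (a + i) (b + i)) F = expect p (slab n a b) (\<lambda>B. F (shift_site n i j ` B))"
  using expect_reindex[of "slab n a b" "shift_site n i j" p F] inj_on_shift_site[of n i j a b]
  by (simp add: shift_slab[OF assms])

definition crosses :: "nat \<Rightarrow> int \<Rightarrow> int \<Rightarrow> int \<Rightarrow> vertex set \<Rightarrow> bool" where
  "crosses n a b y B \<longleftrightarrow> (\<exists>r. cross (env n B) a b y r)"

lemma cross_cong_iff:
  assumes "\<And>x z. x \<in> {a..b} \<Longrightarrow> \<omega> (x, z) = \<omega>' (x, z)"
  shows "cross \<omega> a b y r \<longleftrightarrow> cross \<omega>' a b y r"
  using assms cross_cong[of \<omega> a b y r \<omega>'] cross_cong[of \<omega>' a b y r \<omega>] by blast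

lemma crosses_cong:
  assumes "\<And>x z. x \<in> {a..b} \<Longrightarrow> env n B (x, z) = env n C (x, z)"
  shows "crosses n a b y B \<longleftrightarrow> crosses n a b y C"
  unfolding crosses_def using cross_cong_iff[of a b "env n B" "env n C", OF assms] by metis

lemma crosses_shift:
  assumes "n > 0" "B \<subseteq> slab n c d" "even (i - j)"
  shows "crosses n (a + i) (b + i) (y + j) (shift_site n i j ` B) \<longleftrightarrow> crosses n a b y B"
proof -
  have "(\<lambda>(x, y). env n (shift_site n i j ` B) (x + i, y + j)) = env n B"
    using env_shift[OF assms(1,2)] by auto
  then have "cross (env n (shift_site n i j ` B)) (a + i) (b + i) (y + j) (r + j) \<longleftrightarrow> cross (env n B) a b y r" for r
    using cross_translate[OF assms(3)] by simp
  then show ?thesis unfolding crosses_def by (metis diff_add_cancel)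
qed

lemma prb_crosses_shift:
  assumes "n > 0" "even (i - j)"
  shows "prb p (slab n (a + i) (b + i)) (crosses n (a + i) (b + i) (y + j)) = prb p (slab n a b) (crosses n a b y)"
  by (subst expect_shift[OF assms(1), of p a i b _ j], rule expect_cong, subst crosses_shift[OF assms(1) _ assms(2)]) auto

lemma prb_superset:
  assumes "n > 0" "slab n a b \<subseteq> V" "finite V"
    and A: "\<And>B C. (\<And>x z. x \<in> {a..b} \<Longrightarrow> env n B (x, z) = env n C (x, z)) \<Longrightarrow> A B \<longleftrightarrow> A C"
  shows "prb p V A = prb p (slab n a b) A"
proof -
  have "prb p V A = expect p V (\<lambda>B. of_bool (A (B \<inter> slab n a b)))"
    by (intro expect_cong arg_cong[where f = of_bool] A) (simp add: env_Int_slab[OF assms(1)])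
  also have "\<dots> = prb p (slab n a b) A"
    by (rule expect_restrict[where F = "\<lambda>B. of_bool (A B)"]) fact+
  finally show ?thesis .
qed

lemmas prb_crosses_superset = prb_superset[OF _ _ _ crosses_cong]

text \<open>One reference row and one reference column suffice: translations by even amounts reach
  every even row and every odd first column, and the balance of parities reaches the odd
  rows.\<close>

definition mass :: "real \<Rightarrow> nat \<Rightarrow> int \<Rightarrow> real" where
  "mass p n L = prb p (slab n 1 L) (crosses n 1 L 0)"

lemma prb_crosses_even:
  assumes "n > 0" "odd a" "even y"
  shows "prb p (slab n a b) (crosses n a b y) = mass p n (b - a + 1)"
  unfolding mass_def
  using prb_crosses_shift[of n "a - 1" y p 1 "b - a + 1" 0] assms by simp

lemma mass_antimono:
  assumes "n > 0" "0 \<le> p" "p \<le> 1" "1 \<le> L" "L \<le> L'"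
  shows "mass p n L' \<le> mass p n L"
proof -
  have "mass p n L' \<le> prb p (slab n 1 L') (crosses n 1 L 0)"
    unfolding mass_def
    by (intro prb_mono) (use assms in \<open>auto simp: crosses_def elim: cross_prefix\<close>)
  also have "\<dots> = mass p n L"
    unfolding mass_def by (rule prb_crosses_superset) (use assms in \<open>auto simp: slab_def\<close>)
  finally show ?thesis .
qed

lemma card_even_range: "card {y \<in> {0..<2 * int n}. even y} = n"
proof -
  have "{y \<in> {0..<2 * int n}. even y} = (\<lambda>i. 2 * int i) ` {..<n}"
  proof safe
    fix y assume y: "y \<in> {0..<2 * int n}" "even y"
    then obtain k where "y = 2 * k" by (elim evenE)
    then have "y = 2 * int (nat k)" "nat k \<in> {..<n}" using y by auto
    then show "y \<in> (\<lambda>i. 2 * int i) ` {..<n}" by blast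
  qed auto
  then show ?thesis by (simp add: card_image inj_on_def)
qed

lemma sum_of_bool_card:
  "finite I \<Longrightarrow> (\<Sum>i\<in>I. of_bool (P i)) = (of_nat (card {i \<in> I. P i}) :: real)"
  by (simp add: Int_def)

text \<open>A vertical translation by one row is not a symmetry. Instead, the expected numbers of
  even and odd crossings agree, and within each parity all rows have the same crossing
  probability.\<close>

lemma prb_crosses_odd:
  assumes "n > 0" "1 \<le> L" "odd y"
  shows "prb p (slab n 1 L) (crosses n 1 L y) = mass p n L"
proof -
  let ?N = "2 * int n"
  have row: "prb p (slab n 1 L) (crosses n 1 L z) = prb p (slab n 1 L) (crosses n 1 L y)" if "odd z" for z
    using prb_crosses_shift[of n 0 "z - y" p 1 L y] assms that by simp
  have count: "(\<Sum>z\<in>{z \<in> {0..<?N}. Q z}. prb p (slab n 1 L) (crosses n 1 L z))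
      = expect p (slab n 1 L) (\<lambda>B. real (card {z \<in> {0..<?N}. Q z \<and> crosses n 1 L z B}))" for Q
    unfolding expect_sum[symmetric]
  proof (intro expect_cong)
    fix B
    have "finite {z \<in> {0..<?N}. Q z}" by (rule finite_subset[of _ "{0..<?N}"]) auto
    then show "(\<Sum>z\<in>{z \<in> {0..<?N}. Q z}. of_bool (crosses n 1 L z B))
        = real (card {z \<in> {0..<?N}. Q z \<and> crosses n 1 L z B})"
      by (subst sum_of_bool_card) (auto intro!: arg_cong[where f = card])
  qed
  have "n * mass p n L = (\<Sum>z\<in>{z \<in> {0..<?N}. even z}. prb p (slab n 1 L) (crosses n 1 L z))"
    using prb_crosses_even[of n 1 _ p L] assms card_even_range[of n] by simp
  also have "\<dots> = expect p (slab n 1 L) (\<lambda>B. real (card {z \<in> {0..<?N}. even z \<and> crosses n 1 L z B}))"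
    by (rule count)
  also have "\<dots> = expect p (slab n 1 L) (\<lambda>B. real (card {z \<in> {0..<?N}. odd z \<and> crosses n 1 L z B}))"
    unfolding crosses_def
    by (intro expect_cong, subst card_cross_even_eq_odd[OF periodic_env]) (use assms in auto)
  also have "\<dots> = (\<Sum>z\<in>{z \<in> {0..<?N}. odd z}. prb p (slab n 1 L) (crosses n 1 L z))"
    by (rule count[symmetric])
  also have "\<dots> = (\<Sum>z\<in>{z \<in> {0..<?N}. odd z}. prb p (slab n 1 L) (crosses n 1 L y))"
    by (rule sum.cong[OF refl]) (rule row, simp)
  also have "\<dots> = n * prb p (slab n 1 L) (crosses n 1 L y)"
    using card_even_eq_odd[of ?N] assms card_even_range[of n] by simp
  finally show ?thesis using assms by simp
qed

lemma expect_slab_three: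
  assumes "a \<le> t" "t \<le> c"
  shows "expect p (slab n a c) F = expect p (slab n a (t - 1)) (\<lambda>B1. expect p (slab n t t)
    (\<lambda>B2. expect p (slab n (t + 1) c) (\<lambda>B3. F (B1 \<union> B2 \<union> B3))))"
proof -
  have "slab n a c = slab n a (t - 1) \<union> (slab n t t \<union> slab n (t + 1) c)"
    using assms by (auto simp: slab_def)
  then have "expect p (slab n a c) F = expect p (slab n a (t - 1)) (\<lambda>B1. expect p (slab n t t \<union> slab n (t + 1) c) (\<lambda>B. F (B1 \<union> B)))"
    by (simp only:) (rule expect_union, auto simp: slab_def)
  also have "\<dots> = expect p (slab n a (t - 1)) (\<lambda>B1. expect p (slab n t t) (\<lambda>B2. expect p (slab n (t + 1) c) (\<lambda>B3. F (B1 \<union> (B2 \<union> B3)))))"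
    by (intro expect_cong expect_union) (auto simp: slab_def)
  finally show ?thesis by (simp only: Un_assoc)
qed

lemma env_three:
  assumes "B1 \<subseteq> slab n a (t - 1)" "B2 \<subseteq> slab n t t" "B3 \<subseteq> slab n (t + 1) c"
  shows "x < t \<Longrightarrow> env n (B1 \<union> B2 \<union> B3) (x, z) = env n B1 (x, z)"
    "env n (B1 \<union> B2 \<union> B3) (t, z) = env n B2 (t, z)"
    "t < x \<Longrightarrow> env n (B1 \<union> B2 \<union> B3) (x, z) = env n B3 (x, z)"
  using assms by (auto simp: env_def slab_def)

lemma mod_neq_mod_diff:
  assumes "0 < k" "k < N"
  shows "(r - k) mod N \<noteq> r mod (N :: int)"
proof
  assume "(r - k) mod N = r mod N"
  then have "N dvd (r - k) - r" by (simp add: mod_eq_dvd_iff)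
  then have "N dvd k" by simp
  then show False using assms zdvd_not_zless by blast
qed

definition gate_set :: "nat \<Rightarrow> int \<Rightarrow> int \<Rightarrow> vertex set \<Rightarrow> int set" where
  "gate_set n T y B = gates (env n B) 1 T y True \<union> gates (env n B) 1 T y False"

definition gate_columns :: "int \<Rightarrow> int set" where
  "gate_columns T = {t. even t \<and> 1 < t \<and> t < T}"

lemma finite_gate_columns [simp]: "finite (gate_columns T)"
  by (rule finite_subset[of _ "{1..T}"]) (auto simp: gate_columns_def)

lemma gate_set_subset: "gate_set n T y B \<subseteq> gate_columns T"
  by (auto simp: gate_set_def gates_def gate_columns_def)

lemma gate_set_crosses:
  assumes "even y" "t \<in> gate_set n T y B"
  shows "crosses n 1 T y B"
proof -
  let ?\<omega> = "env n B"
  obtain r e where t: "even t" "1 < t" "t < T" and r: "cross ?\<omega> 1 (t - 1) y r" "\<not> ?\<omega> (t, r - 1)" "?\<omega> (t, r - 2)"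
    and e: "cross ?\<omega> (t + 1) T (if ?\<omega> (t, r) then r - 2 else r) e"
    using assms(2) unfolding gate_set_def gates_def by fastforce
  show ?thesis unfolding crosses_def using gates_split(1)[OF assms(1) t r refl e] by blast
qed

text \<open>Three independent requirements: a crossing up to column t - 1, two prescribed bits in
  column t, and a crossing from column t + 1 on. Both crossings are over slabs shorter than T, so
  each has probability at least the mass of T.\<close>

lemma prb_gate_ge:
  assumes n: "n \<ge> 2" and p: "0 < p" "p < 1" and "even y" and t: "t \<in> gate_columns T"
  shows "p * (1 - p) * (mass p n T)\<^sup>2 \<le> prb p (slab n 1 T) (\<lambda>B. t \<in> gate_set n T y B)"
proof -
  let ?N = "2 * int n" and ?m = "mass p n T"
  have t': "even t" "1 < t" "t < T" using t by (auto simp: gate_columns_def)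
  have m0: "0 \<le> ?m" unfolding mass_def using p by (intro expect_nonneg) auto
  have m1: "?m \<le> mass p n (t - 1)" "?m \<le> mass p n (T - t)"
    using mass_antimono[of n p "t - 1" T] mass_antimono[of n p "T - t" T] n p t' by auto
  have inner: "p * (1 - p) * ?m * of_bool (crosses n 1 (t - 1) y B1) \<le> expect p (slab n t t)
    (\<lambda>B2. expect p (slab n (t + 1) T) (\<lambda>B3. of_bool (t \<in> gate_set n T y (B1 \<union> B2 \<union> B3))))"
    (is "_ \<le> ?R") if B1: "B1 \<subseteq> slab n 1 (t - 1)" for B1
  proof (cases "crosses n 1 (t - 1) y B1")
    case True
    then obtain r where r: "cross (env n B1) 1 (t - 1) y r" unfolding crosses_def by blast
    have er: "even r" using cross_even[OF r] assms by simp
    let ?v = "(t, (r - 1) mod ?N)" and ?w = "(t, (r - 2) mod ?N)"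
    have vw: "?v \<noteq> ?w" using mod_neq_mod_diff[of 1 ?N "r - 1"] n by simp
    have "p * (1 - p) * ?m = expect p (slab n t t) (\<lambda>B2. ?m * of_bool (?v \<notin> B2 \<and> ?w \<in> B2))"
      using vw n by (subst expect_cmult, subst prb_absent_present) (auto simp: slab_def)
    also have "\<dots> \<le> ?R"
    proof (intro expect_mono)
      fix B2 assume B2: "B2 \<subseteq> slab n t t"
      show "?m * of_bool (?v \<notin> B2 \<and> ?w \<in> B2) \<le>
        expect p (slab n (t + 1) T) (\<lambda>B3. of_bool (t \<in> gate_set n T y (B1 \<union> B2 \<union> B3)))"
      proof (cases "?v \<notin> B2 \<and> ?w \<in> B2")
        case bits: True
        define r' where "r' = (if env n B2 (t, r) then r - 2 else r)"
        have "even r'" using er by (simp add: r'_def)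
        then have "?m \<le> prb p (slab n (t + 1) T) (crosses n (t + 1) T r')"
          using prb_crosses_even[of n "t + 1" r' p T] m1 t' n by simp
        also have "\<dots> \<le> prb p (slab n (t + 1) T) (\<lambda>B3. t \<in> gate_set n T y (B1 \<union> B2 \<union> B3))"
        proof (rule prb_mono)
          fix B3 assume B3: "B3 \<subseteq> slab n (t + 1) T" and "crosses n (t + 1) T r' B3"
          then obtain e where e: "cross (env n B3) (t + 1) T r' e" unfolding crosses_def by blast
          let ?\<omega> = "env n (B1 \<union> B2 \<union> B3)"
          note E = env_three[OF B1 B2 B3]
          have 1: "cross ?\<omega> 1 (t - 1) y r" by (rule cross_cong[OF r]) (simp add: E)
          have 2: "cross ?\<omega> (t + 1) T r' e" by (rule cross_cong[OF e]) (simp add: E)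
          have 3: "\<not> ?\<omega> (t, r - 1)" "?\<omega> (t, r - 2)" using bits unfolding E(2) by (simp_all add: env_def)
          have 4: "\<exists>e. cross ?\<omega> (t + 1) T (if ?\<omega> (t, r) then r - 2 else r) e"
            using 2 unfolding E(2) r'_def by blast
          have "t \<in> gates ?\<omega> 1 T y (?\<omega> (t, r))"
            unfolding gates_def mem_Collect_eq using 1 3 4 t' by blast
          then show "t \<in> gate_set n T y (B1 \<union> B2 \<union> B3)"
            unfolding gate_set_def by (cases "?\<omega> (t, r)") auto
        qed (use p in auto)
        finally show ?thesis using bits by simp
      qed (use p in \<open>auto intro!: expect_nonneg\<close>)
    qed (use p in auto)
    finally show ?thesis using True by simp
  qed (use p in \<open>auto intro!: expect_nonneg\<close>)
  have "p * (1 - p) * ?m\<^sup>2 \<le> p * (1 - p) * ?m * prb p (slab n 1 (t - 1)) (crosses n 1 (t - 1) y)"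
    using prb_crosses_even[of n 1 y p "t - 1"] m1 assms m0 p
    by (simp add: power2_eq_square mult_left_mono)
  also have "\<dots> = expect p (slab n 1 (t - 1)) (\<lambda>B1. p * (1 - p) * ?m * of_bool (crosses n 1 (t - 1) y B1))"
    by (simp only: expect_cmult)
  also have "\<dots> \<le> prb p (slab n 1 T) (\<lambda>B. t \<in> gate_set n T y B)"
    unfolding expect_slab_three[of 1 t T, OF less_imp_le[OF t'(2)] less_imp_le[OF t'(3)]]
    by (intro expect_mono inner) (use p in auto)
  finally show ?thesis .
qed

text \<open>Given the columns left of t, the row r of arrival is fixed. Toggling the bit at (t, r)
  exchanges the weights 1 - p and p, and translating the columns right of t preserves their law.
  With \<open>n \<ge> 2\<close> the rows r, r - 1 and r - 2 are distinct on the cylinder, so the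
  toggle leaves the rest of the gate intact.\<close>

lemma prb_gate_event_activate:
  assumes n: "n \<ge> 2" and "even y" and t: "t \<in> gate_columns T" "t \<notin> Z" "t \<notin> U"
  shows "(1 - p) * prb p (slab n 1 T) (\<lambda>B. gate_event (env n B) 1 T y Z (insert t U) d)
    = p * prb p (slab n 1 T) (\<lambda>B. gate_event (env n B) 1 T y (insert t Z) U d)"
proof -
  let ?N = "2 * int n"
  have t': "even t" "1 < t" "t < T" using t by (auto simp: gate_columns_def)
  define E where "E B = (of_bool (gate_event (env n B) 1 T y (insert t Z) U d) :: real)" for B
  define E' where "E' B = (of_bool (gate_event (env n B) 1 T y Z (insert t U) d) :: real)" for B
  let ?V2 = "slab n t t" and ?V3 = "slab n (t + 1) T"
  have inner: "(1 - p) * expect p ?V2 (\<lambda>B2. expect p ?V3 (\<lambda>B3. E' (B1 \<union> B2 \<union> B3)))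
      = p * expect p ?V2 (\<lambda>B2. expect p ?V3 (\<lambda>B3. E (B1 \<union> B2 \<union> B3)))"
    if B1: "B1 \<subseteq> slab n 1 (t - 1)" for B1
  proof -
    have req: "\<exists>r. cross (env n B1) 1 (t - 1) y r \<and> env n B2 (t, r) = \<beta>"
      if B2: "B2 \<subseteq> ?V2" and B3: "B3 \<subseteq> ?V3" and g: "t \<in> gates (env n (B1 \<union> B2 \<union> B3)) 1 T y \<beta>" for B2 B3 \<beta>
    proof -
      note E = env_three[OF B1 B2 B3]
      obtain r where r: "cross (env n (B1 \<union> B2 \<union> B3)) 1 (t - 1) y r" "env n (B1 \<union> B2 \<union> B3) (t, r) = \<beta>"
        using g unfolding gates_def by blast
      have "cross (env n B1) 1 (t - 1) y r" by (rule cross_cong[OF r(1)]) (simp add: E)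
      then show ?thesis using r(2) by (auto simp: E)
    qed
    show ?thesis
    proof (cases "crosses n 1 (t - 1) y B1")
      case False
      have "E' (B1 \<union> B2 \<union> B3) = 0" "E (B1 \<union> B2 \<union> B3) = 0" if "B2 \<subseteq> ?V2" "B3 \<subseteq> ?V3" for B2 B3
        using req[OF that, of True] req[OF that, of False] False
        unfolding E_def E'_def gate_event_def crosses_def by auto
      then have "expect p ?V2 (\<lambda>B2. expect p ?V3 (\<lambda>B3. E' (B1 \<union> B2 \<union> B3))) = expect p ?V2 (\<lambda>B2. expect p ?V3 (\<lambda>B3. 0))"
        "expect p ?V2 (\<lambda>B2. expect p ?V3 (\<lambda>B3. E (B1 \<union> B2 \<union> B3))) = expect p ?V2 (\<lambda>B2. expect p ?V3 (\<lambda>B3. 0))"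
        by (intro expect_cong; simp)+
      then show ?thesis by simp
    next
      case True
      then obtain r where r: "cross (env n B1) 1 (t - 1) y r" unfolding crosses_def by blast
      let ?v = "(t, r mod ?N)"
      let ?W = "?V2 - {?v}"
      have v: "?v \<in> ?V2" using n by (simp add: slab_def)
      define J J' where "J B2 = expect p ?V3 (\<lambda>B3. E (B1 \<union> B2 \<union> B3))"
        and "J' B2 = expect p ?V3 (\<lambda>B3. E' (B1 \<union> B2 \<union> B3))" for B2
      \<comment> \<open>Without a mirror at \<open>?v\<close> the gate cannot be active, and with
        one it cannot be inactive. So exactly one term of each splitting at \<open>?v\<close>
        survives, and the two survivors are matched below.\<close>
      have J'0: "expect p ?W J' = 0"
      proof -
        have "expect p ?W J' = expect p ?W (\<lambda>B2. expect p ?V3 (\<lambda>B3. 0))"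
          unfolding J'_def
        proof (intro expect_cong)
          fix B2 B3 assume B: "B2 \<subseteq> ?W" "B3 \<subseteq> ?V3"
          then have "B2 \<subseteq> ?V2" by auto
          moreover have "\<not> env n B2 (t, r)" using B by (auto simp: env_def)
          ultimately have "t \<notin> gates (env n (B1 \<union> B2 \<union> B3)) 1 T y True"
            using req[of B2 B3 True] B cross_unique[OF r] by blast
          then show "E' (B1 \<union> B2 \<union> B3) = 0" unfolding E'_def gate_event_def by auto
        qed
        then show ?thesis by simp
      qed
      have J0: "expect p ?W (\<lambda>B2. J (insert ?v B2)) = 0"
      proof -
        have "expect p ?W (\<lambda>B2. J (insert ?v B2)) = expect p ?W (\<lambda>B2. expect p ?V3 (\<lambda>B3. 0))"
          unfolding J_def
        proof (intro expect_cong)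
          fix B2 B3 assume B: "B2 \<subseteq> ?W" "B3 \<subseteq> ?V3"
          then have "insert ?v B2 \<subseteq> ?V2" using v by auto
          moreover have "env n (insert ?v B2) (t, r)" by (auto simp: env_def)
          ultimately have "t \<notin> gates (env n (B1 \<union> insert ?v B2 \<union> B3)) 1 T y False"
            using req[of "insert ?v B2" B3 False] B cross_unique[OF r] by blast
          then show "E (B1 \<union> insert ?v B2 \<union> B3) = 0" unfolding E_def gate_event_def by auto
        qed
        then show ?thesis by simp
      qed
      have "expect p ?W (\<lambda>B2. J' (insert ?v B2)) = expect p ?W J"
      proof (intro expect_cong)
        fix B2 assume B2: "B2 \<subseteq> ?W"
        then have B2': "B2 \<subseteq> ?V2" "insert ?v B2 \<subseteq> ?V2" using v by auto
        have "J' (insert ?v B2) = expect p ?V3 (\<lambda>B3. E' (B1 \<union> insert ?v B2 \<union> shift_site n 0 (-2) ` B3))"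
          unfolding J'_def using expect_shift[of n p "t + 1" 0 T _ "-2"] n by simp
        also have "\<dots> = J B2"
          unfolding J_def
        proof (intro expect_cong)
          fix B3 assume B3: "B3 \<subseteq> ?V3"
          have sB3: "shift_site n 0 (-2) ` B3 \<subseteq> ?V3"
            using shift_slab[of n 0 "-2" "t + 1" T] B3 n by fastforce
          note E1 = env_three[OF B1 B2'(1) B3]
          note E2 = env_three[OF B1 B2'(2) sB3]
          let ?w = "env n (B1 \<union> B2 \<union> B3)" and ?w' = "env n (B1 \<union> insert ?v B2 \<union> shift_site n 0 (-2) ` B3)"
          have "gate_event (?w') 1 T y Z (insert t U) d
            \<longleftrightarrow> gate_event (?w) 1 T y (insert t Z) U d"
          proof (rule gate_event_activate[OF \<open>even y\<close> t' t(2,3)])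
            show "cross (?w) 1 (t - 1) y r"
              by (rule cross_cong[OF r]) (simp add: E1)
            show "?w' (t, r - 1) = ?w (t, r - 1)"
              "?w' (t, r - 2) = ?w (t, r - 2)"
              using mod_neq_mod_diff[of 1 ?N r] mod_neq_mod_diff[of 2 ?N r] n
              unfolding E1(2) E2(2) by (auto simp: env_def)
            show "\<not> ?w (t, r)" using B2 unfolding E1(2) by (auto simp: env_def)
            show "?w' (t, r)" unfolding E2(2) by (auto simp: env_def)
          next
            fix x z :: int assume x: "t < x"
            show "?w' (x, z) = ?w (x, z + 2)"
              using env_shift[of n B3 "t + 1" T 0 "-2" x "z + 2"] B3 n unfolding E1(3)[OF x] E2(3)[OF x] by simp
          next
            fix x z :: int assume x: "x < t"
            show "?w' (x, z) = ?w (x, z)"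
              unfolding E1(1)[OF x] E2(1)[OF x] ..
          qed
          then show "E' (B1 \<union> insert ?v B2 \<union> shift_site n 0 (-2) ` B3) = E (B1 \<union> B2 \<union> B3)"
            unfolding E_def E'_def by simp
        qed
        finally show "J' (insert ?v B2) = J B2" .
      qed
      then show ?thesis
        unfolding J_def[symmetric] J'_def[symmetric]
        using J0 J'0 expect_split[OF finite_slab v, of p J] expect_split[OF finite_slab v, of p J'] by simp
    qed
  qed
  show ?thesis
    unfolding expect_slab_three[of 1 t T, OF less_imp_le[OF t'(2)] less_imp_le[OF t'(3)]] expect_cmult[symmetric]
    unfolding E_def[symmetric] E'_def[symmetric] 
    by (rule expect_cong) (simp add: inner expect_cmult)
qed

text \<open>Each activation contributes the odds p / (1 - p). Hence, given all gates and the
  parameter \<open>d\<close>, the active gates form a random subset with independent bits of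
  parameter p.\<close>

lemma prb_gate_event:
  assumes n: "n \<ge> 2" and "even y" and "finite U" "U \<subseteq> gate_columns T" "Z \<inter> U = {}"
  shows "(1 - p) ^ card U * prb p (slab n 1 T) (\<lambda>B. gate_event (env n B) 1 T y Z U d)
    = p ^ card U * prb p (slab n 1 T) (\<lambda>B. gate_event (env n B) 1 T y (Z \<union> U) {} d)"
  using assms(3-5)
proof (induction U arbitrary: Z rule: finite_induct)
  case (insert t U)
  let ?P = "\<lambda>Z U. prb p (slab n 1 T) (\<lambda>B. gate_event (env n B) 1 T y Z U d)"
  have "(1 - p) ^ card (insert t U) * ?P Z (insert t U) = (1 - p) ^ card U * ((1 - p) * ?P Z (insert t U))"
    using insert by simp
  also have "(1 - p) * ?P Z (insert t U) = p * ?P (insert t Z) U"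
    by (rule prb_gate_event_activate[OF n \<open>even y\<close>]) (use insert in auto)
  also have "(1 - p) ^ card U * (p * ?P (insert t Z) U) = p * ((1 - p) ^ card U * ?P (insert t Z) U)"
    by simp
  also have "(1 - p) ^ card U * ?P (insert t Z) U = p ^ card U * ?P (insert t Z \<union> U) {}"
    by (rule insert.IH) (use insert in auto)
  finally show ?case using insert by simp
qed simp

lemma expect_eq_sum_powers:
  assumes "finite S"
  shows "expect p S F = (\<Sum>U\<in>Pow S. p ^ card U * (1 - p) ^ card (S - U) * F U)"
  unfolding expect_def
proof (rule sum.cong)
  fix U assume "U \<in> Pow S"
  then have "S \<inter> U = U" "S \<inter> - U = S - U" by auto
  then show "(\<Prod>v\<in>S. if v \<in> U then p else 1 - p) * F U = p ^ card U * (1 - p) ^ card (S - U) * F U"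
    using assms by (simp add: prod.If_cases)
qed simp

subsection \<open>Dispersion of the exit row\<close>

text \<open>The window is the set of exit rows for which a ray stays between two consecutive lifts
  of another one; avoiding it forces a meeting. Its position is left free because the other ray is
  independent.\<close>

definition exits_avoiding :: "nat \<Rightarrow> int \<Rightarrow> int \<Rightarrow> int \<Rightarrow> vertex set \<Rightarrow> bool" where
  "exits_avoiding n T y \<alpha> B \<longleftrightarrow>
     (\<exists>e. cross (env n B) 1 T y e \<and> \<not> (\<alpha> < e \<and> e < \<alpha> + 2 * int n))"

text \<open>The law of the exit row is a mixture over the row \<open>d\<close> of the path with all
  gates inactive. The weight \<kappa> d, a probability for inactive gates divided by (1 - p) to the
  number of gates, is the probability that the gates are \<open>S\<close> and this row is
  \<open>d\<close>.\<close>

lemma exit_law_given_gates: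
  assumes n: "n \<ge> 2" and p: "0 < p" "p < 1" and y: "even y" and S: "S \<subseteq> gate_columns T"
  shows "\<exists>D \<kappa>. finite D \<and> (\<forall>d. 0 \<le> \<kappa> d) \<and> (\<forall>c.
    prb p (slab n 1 T) (\<lambda>B. \<exists>e. cross (env n B) 1 T y e \<and> c e \<and> gate_set n T y B = S)
      = (\<Sum>d\<in>D. \<kappa> d * prb p S (\<lambda>U. c (d - 2 * int (card U)))))"
proof -
  let ?V = "slab n 1 T"
  have fS: "finite S" by (rule finite_subset[OF S]) simp
  define e0 where "e0 B = (SOME e. cross (env n B) 1 T y e)" for B
  \<comment> \<open>Without a crossing \<open>e0\<close> is an arbitrary row. All that matters is
    that \<open>D\<close> is finite and contains the parameter of every configuration with a
    crossing.\<close>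
  define D where "D = (\<lambda>B. e0 B + 2 * int (card (gates (env n B) 1 T y True))) ` Pow ?V"
  have fD: "finite D" by (simp add: D_def)
  define \<kappa> where "\<kappa> d = prb p ?V (\<lambda>B. gate_event (env n B) 1 T y S {} d) / (1 - p) ^ card S" for d
  have \<kappa>0: "0 \<le> \<kappa> d" for d
    unfolding \<kappa>_def using p by (intro divide_nonneg_nonneg expect_nonneg) auto
  have law: "prb p ?V (\<lambda>B. gate_event (env n B) 1 T y (S - U) U d) = \<kappa> d * (p ^ card U * (1 - p) ^ card (S - U))"
    if U: "U \<in> Pow S" for U d
  proof -
    have fU: "finite U" using U fS finite_subset by auto
    have "(1 - p) ^ card U * prb p ?V (\<lambda>B. gate_event (env n B) 1 T y (S - U) U d)
        = p ^ card U * prb p ?V (\<lambda>B. gate_event (env n B) 1 T y (S - U \<union> U) {} d)"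
      by (rule prb_gate_event[OF n y fU]) (use U S in auto)
    moreover have "S - U \<union> U = S" using U by auto
    moreover have "(1 - p) ^ card S = (1 - p) ^ card U * (1 - p) ^ card (S - U)"
      using U fS fU by (simp add: power_add[symmetric] card_Diff_subset card_mono)
    ultimately show ?thesis
      unfolding \<kappa>_def using p by (simp add: field_simps)
  qed
  have "prb p ?V (\<lambda>B. \<exists>e. cross (env n B) 1 T y e \<and> c e \<and> gate_set n T y B = S)
      = (\<Sum>d\<in>D. \<kappa> d * prb p S (\<lambda>U. c (d - 2 * int (card U))))" for c
  proof -
    let ?ind = "\<lambda>B d U. of_bool (c (d - 2 * int (card U))) * of_bool (gate_event (env n B) 1 T y (S - U) U d) :: real"
    have "of_bool (\<exists>e. cross (env n B) 1 T y e \<and> c e \<and> gate_set n T y B = S) = (\<Sum>d\<in>D. \<Sum>U\<in>Pow S. ?ind B d U)"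
      if B: "B \<subseteq> ?V" for B
    proof (cases "(\<exists>e. cross (env n B) 1 T y e) \<and> gate_set n T y B = S")
      case True
      then have e: "cross (env n B) 1 T y (e0 B)" unfolding e0_def using someI_ex by metis
      define U0 where "U0 = gates (env n B) 1 T y True"
      define d0 where "d0 = e0 B + 2 * int (card U0)"
      have gs: "gate_set n T y B = S" using True ..
      have Z0: "gates (env n B) 1 T y False = S - U0"
        using gates_disjoint[of "env n B" 1 T y] gs unfolding U0_def gate_set_def by auto
      have U0: "U0 \<in> Pow S" using gs unfolding U0_def gate_set_def by auto
      have d0: "d0 \<in> D" using B unfolding D_def d0_def U0_def by blast
      have ge: "gate_event (env n B) 1 T y (S - U) U d \<longleftrightarrow> U = U0 \<and> d = d0" for U d
      proof
        assume g: "gate_event (env n B) 1 T y (S - U) U d"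
        then have U: "U = U0" unfolding gate_event_def U0_def by simp
        have "e0 B = d - 2 * int (card U)"
          using g by (intro cross_unique[OF e]) (simp add: gate_event_def)
        then show "U = U0 \<and> d = d0" using U by (simp add: d0_def)
      next
        assume "U = U0 \<and> d = d0"
        then show "gate_event (env n B) 1 T y (S - U) U d"
          unfolding gate_event_def using e Z0 by (simp add: d0_def U0_def)
      qed
      have "(\<Sum>d\<in>D. \<Sum>U\<in>Pow S. ?ind B d U) = (\<Sum>d\<in>D. \<Sum>U\<in>Pow S. if U = U0 then (if d = d0 then of_bool (c (e0 B)) else 0) else 0)"
        by (intro sum.cong refl) (auto simp: ge d0_def)
      also have "\<dots> = of_bool (c (e0 B))"
        using U0 d0 fS fD by (simp add: sum.delta)
      also have "\<dots> = of_bool (\<exists>e. cross (env n B) 1 T y e \<and> c e \<and> gate_set n T y B = S)"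
        using e gs cross_unique[OF e] by (intro arg_cong[where f = of_bool] iffI) blast+
      finally show ?thesis by simp
    next
      case False
      have "\<not> gate_event (env n B) 1 T y (S - U) U d" if "U \<in> Pow S" for U d
      proof
        assume "gate_event (env n B) 1 T y (S - U) U d"
        then have "(\<exists>e. cross (env n B) 1 T y e) \<and> gate_set n T y B = S"
          unfolding gate_event_def gate_set_def using that by auto
        then show False using False by simp
      qed
      then have "(\<Sum>d\<in>D. \<Sum>U\<in>Pow S. ?ind B d U) = 0"
        by (intro sum.neutral ballI) simp
      moreover have "of_bool (\<exists>e. cross (env n B) 1 T y e \<and> c e \<and> gate_set n T y B = S) = (0 :: real)"
        using False by auto
      ultimately show ?thesis by simp
    qed
    then have "prb p ?V (\<lambda>B. \<exists>e. cross (env n B) 1 T y e \<and> c e \<and> gate_set n T y B = S)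
        = expect p ?V (\<lambda>B. \<Sum>d\<in>D. \<Sum>U\<in>Pow S. ?ind B d U)"
      by (rule expect_cong)
    also have "\<dots> = (\<Sum>d\<in>D. \<Sum>U\<in>Pow S. of_bool (c (d - 2 * int (card U))) *
        prb p ?V (\<lambda>B. gate_event (env n B) 1 T y (S - U) U d))"
      by (simp only: expect_sum expect_cmult)
    also have "\<dots> = (\<Sum>d\<in>D. \<Sum>U\<in>Pow S. of_bool (c (d - 2 * int (card U))) *
        (\<kappa> d * (p ^ card U * (1 - p) ^ card (S - U))))"
      by (intro sum.cong refl) (simp only: law)
    also have "\<dots> = (\<Sum>d\<in>D. \<kappa> d * prb p S (\<lambda>U. c (d - 2 * int (card U))))"
      unfolding expect_eq_sum_powers[OF fS] sum_distrib_left
      by (intro sum.cong refl) (simp only: mult_ac)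
    finally show ?thesis .
  qed
  then show ?thesis using fD \<kappa>0 by blast
qed

lemma prb_avoid_given_gates:
  fixes p :: real
  assumes n: "n \<ge> 2" and p: "0 < p" "p < 1" and y: "even y" and S: "S \<subseteq> gate_columns T"
    and K: "2 * (real n)\<^sup>2 \<le> p * (1 - p) * card S"
  shows "prb p (slab n 1 T) (\<lambda>B. crosses n 1 T y B \<and> gate_set n T y B = S)
    \<le> 128 * prb p (slab n 1 T) (\<lambda>B. exits_avoiding n T y \<alpha> B \<and> gate_set n T y B = S)"
proof -
  have fS: "finite S" by (rule finite_subset[OF S]) simp
  obtain D \<kappa> where \<kappa>: "\<And>d. 0 \<le> \<kappa> d" and law: "\<And>c. prb p (slab n 1 T) (\<lambda>B. \<exists>e. cross (env n B) 1 T y e \<and> c e \<and> gate_set n T y B = S)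
      = (\<Sum>d\<in>D. \<kappa> d * prb p S (\<lambda>U. c (d - 2 * int (card U))))"
    using exit_law_given_gates[OF n p y S] by blast
  let ?c = "\<lambda>e. \<not> (\<alpha> < e \<and> e < \<alpha> + 2 * int n)"
  have anti: "1 / 128 \<le> prb p S (\<lambda>U. ?c (d - 2 * int (card U)))" for d
  proof -
    \<comment> \<open>The number of active gates that would put the exit row at the centre \<alpha>
      + n of the window. One gate moves the exit by two rows, so a deviation of n from it is more
      than enough to leave the window.\<close>
    let ?b = "(real_of_int d - real_of_int \<alpha> - real n) / 2"
    have "1 / 128 \<le> prb p S (\<lambda>U. real n \<le> \<bar>real (card U) - ?b\<bar>)"
      by (rule binomial_anticoncentration[OF fS p _ K]) (use n in auto)
    also have "\<dots> \<le> prb p S (\<lambda>U. ?c (d - 2 * int (card U)))"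
    proof (rule prb_mono)
      fix U assume far: "real n \<le> \<bar>real (card U) - ?b\<bar>"
      show "?c (d - 2 * int (card U))"
      proof
        assume "\<alpha> < d - 2 * int (card U) \<and> d - 2 * int (card U) < \<alpha> + 2 * int n"
        then have "real_of_int \<alpha> < d - 2 * real (card U)" "d - 2 * real (card U) < \<alpha> + 2 * real n"
          by linarith+
        then show False using far n by (simp add: abs_if field_simps split: if_splits)
      qed
    qed (use p in auto)
    finally show ?thesis .
  qed
  have "prb p (slab n 1 T) (\<lambda>B. crosses n 1 T y B \<and> gate_set n T y B = S) = (\<Sum>d\<in>D. \<kappa> d * 1)"
    using law[of "\<lambda>_. True"] fS by (simp add: crosses_def)
  also have "\<dots> \<le> (\<Sum>d\<in>D. 128 * (\<kappa> d * prb p S (\<lambda>U. ?c (d - 2 * int (card U)))))"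
  proof (rule sum_mono)
    fix d
    have "\<kappa> d * (1 / 128) \<le> \<kappa> d * prb p S (\<lambda>U. ?c (d - 2 * int (card U)))"
      by (rule mult_left_mono[OF anti \<kappa>])
    then show "\<kappa> d * 1 \<le> 128 * (\<kappa> d * prb p S (\<lambda>U. ?c (d - 2 * int (card U))))" by simp
  qed
  also have "\<dots> = 128 * prb p (slab n 1 T) (\<lambda>B. \<exists>e. cross (env n B) 1 T y e \<and> ?c e \<and> gate_set n T y B = S)"
    unfolding law[of ?c] sum_distrib_left ..
  also have "(\<lambda>B. \<exists>e. cross (env n B) 1 T y e \<and> ?c e \<and> gate_set n T y B = S) =
      (\<lambda>B. exits_avoiding n T y \<alpha> B \<and> gate_set n T y B = S)"
    by (auto simp: exits_avoiding_def fun_eq_iff)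
  finally show ?thesis .
qed

lemma card_gate_columns: "card (gate_columns (2 * int \<tau>)) = \<tau> - 1"
proof -
  have "gate_columns (2 * int \<tau>) = (\<lambda>i. 2 * int i) ` {1..<\<tau>}"
  proof safe
    fix t assume "t \<in> gate_columns (2 * int \<tau>)"
    then obtain k where "t = 2 * k" "1 < t" "t < 2 * int \<tau>" by (auto simp: gate_columns_def elim: evenE)
    then have "t = 2 * int (nat k)" "nat k \<in> {1..<\<tau>}" by auto
    then show "t \<in> (\<lambda>i. 2 * int i) ` {1..<\<tau>}" by blast
  qed (auto simp: gate_columns_def)
  then show ?thesis by (simp add: card_image inj_on_def)
qed

lemma mass_bounds:
  assumes "0 \<le> p" "p \<le> 1"
  shows "0 \<le> mass p n L" "mass p n L \<le> 1"
  unfolding mass_def using assms by (auto intro: expect_nonneg prb_le_1)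

text \<open>A first moment argument, counting the columns that are gates.\<close>

lemma prb_many_gates:
  fixes p :: real
  assumes n: "n \<ge> 2" and p: "0 < p" "p < 1" and y: "even y" and T: "T = 2 * int \<tau>"
    and K: "0 \<le> K" "K \<le> p * (1 - p) * mass p n T * (real \<tau> - 1) / 2" and \<tau>: "\<tau> > 1"
  shows "p * (1 - p) * (mass p n T)\<^sup>2 / 2 \<le> prb p (slab n 1 T)
    (\<lambda>B. crosses n 1 T y B \<and> K \<le> card (gate_set n T y B))"
proof -
  let ?V = "slab n 1 T" and ?m = "mass p n T" and ?G = "gate_columns T"
  define P where "P = prb p ?V (\<lambda>B. crosses n 1 T y B \<and> K \<le> card (gate_set n T y B))"
  have m: "0 \<le> ?m" using mass_bounds p by simp
  have cG: "real (card ?G) = real \<tau> - 1" using card_gate_columns[of \<tau>] T \<tau> by (simp add: of_nat_diff)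
  have "(real \<tau> - 1) * (p * (1 - p) * ?m\<^sup>2) = (\<Sum>t\<in>?G. p * (1 - p) * ?m\<^sup>2)"
    by (simp add: cG)
  also have "\<dots> \<le> (\<Sum>t\<in>?G. prb p ?V (\<lambda>B. t \<in> gate_set n T y B))"
    by (intro sum_mono prb_gate_ge n p y)
  also have "\<dots> = expect p ?V (\<lambda>B. \<Sum>t\<in>?G. of_bool (t \<in> gate_set n T y B))"
    by (simp only: expect_sum)
  also have "\<dots> \<le> expect p ?V (\<lambda>B. K * of_bool (crosses n 1 T y B) +
      (real \<tau> - 1) * of_bool (crosses n 1 T y B \<and> K \<le> card (gate_set n T y B)))"
  proof (intro expect_mono)
    fix B
    have eq: "{t \<in> ?G. t \<in> gate_set n T y B} = gate_set n T y B" using gate_set_subset by blast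
    have s: "(\<Sum>t\<in>?G. of_bool (t \<in> gate_set n T y B)) = real (card (gate_set n T y B))"
      by (subst sum_of_bool_card) (simp_all only: finite_gate_columns eq)
    have le: "real (card (gate_set n T y B)) \<le> real \<tau> - 1"
      unfolding cG[symmetric] using gate_set_subset[of n T y B] by (simp add: card_mono)
    show "(\<Sum>t\<in>?G. of_bool (t \<in> gate_set n T y B)) \<le> K * of_bool (crosses n 1 T y B) +
      (real \<tau> - 1) * of_bool (crosses n 1 T y B \<and> K \<le> card (gate_set n T y B))"
    proof (cases "crosses n 1 T y B")
      case False
      then have "gate_set n T y B = {}" using gate_set_crosses[OF y] by blast
      then show ?thesis using False by simp
    next
      case True
      show ?thesis
      proof (cases "K \<le> card (gate_set n T y B)")
        case big: True
        then show ?thesis using s le K(1) True by simp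
      qed (use True s in simp)
    qed
  qed (use p in auto)
  also have "\<dots> = K * ?m + (real \<tau> - 1) * P"
    unfolding P_def expect_add expect_cmult using prb_crosses_even[of n 1 y p T] n y by simp
  also have "\<dots> \<le> (real \<tau> - 1) * (p * (1 - p) * ?m\<^sup>2 / 2) + (real \<tau> - 1) * P"
  proof -
    \<comment> \<open>\<open>K\<close> is at most half of the average number of gates guaranteed per
      crossing, so crossings with few gates account for at most half of the first moment.\<close>
    have "K * ?m \<le> p * (1 - p) * ?m * (real \<tau> - 1) / 2 * ?m" by (rule mult_right_mono[OF K(2) m])
    then show ?thesis by (simp add: power2_eq_square mult_ac)
  qed
  finally have le: "(real \<tau> - 1) * (p * (1 - p) * ?m\<^sup>2) \<le> (real \<tau> - 1) * (p * (1 - p) * ?m\<^sup>2 / 2) + (real \<tau> - 1) * P" .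
  have half: "a * b \<le> a * (b / 2) + c \<Longrightarrow> a * (b / 2) \<le> c" for a b c :: real
    by simp
  have "(real \<tau> - 1) * (p * (1 - p) * ?m\<^sup>2 / 2) \<le> (real \<tau> - 1) * P"
    by (rule half[OF le])
  then show ?thesis using \<tau> unfolding P_def by (subst (asm) mult_le_cancel_left_pos) auto
qed

text \<open>Gate sets of at least 2 n^2 / (p (1 - p)) elements give the number of active gates a
  variance of at least 2 n^2. Summing the conditional bound over them loses 128 from dispersion and
  2 from the first moment.\<close>

lemma prb_exits_avoiding:
  fixes p :: real
  assumes n: "n \<ge> 2" and p: "0 < p" "p < 1" and y: "even y" and T: "T = 2 * int \<tau>" and \<tau>: "\<tau> > 1"
    and K: "2 * (real n)\<^sup>2 \<le> (p * (1 - p))\<^sup>2 * mass p n T * (real \<tau> - 1) / 2"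
  shows "p * (1 - p) * (mass p n T)\<^sup>2 / 256 \<le> prb p (slab n 1 T) (exits_avoiding n T y \<alpha>)"
proof -
  let ?V = "slab n 1 T" and ?q = "p * (1 - p)"
  define k where "k = 2 * (real n)\<^sup>2 / ?q"
  have q0: "0 < ?q" using p by simp
  have k: "k \<le> ?q * mass p n T * (real \<tau> - 1) / 2" "0 \<le> k"
  proof -
    have "?q * mass p n T * (real \<tau> - 1) / 2 * ?q = ?q\<^sup>2 * mass p n T * (real \<tau> - 1) / 2"
      by (simp only: power2_eq_square mult_ac times_divide_eq_left times_divide_eq_right)
    then show "k \<le> ?q * mass p n T * (real \<tau> - 1) / 2"
      unfolding k_def pos_divide_le_eq[OF q0] using K by linarith
    show "0 \<le> k" unfolding k_def using q0 by (intro divide_nonneg_nonneg) auto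
  qed
  define \<S> where "\<S> = {S \<in> Pow (gate_columns T). k \<le> card S}"
  have f: "finite \<S>" by (simp add: \<S>_def)
  have part: "(\<Sum>S\<in>\<S>. of_bool (A \<and> gate_set n T y B = S)) = (of_bool (A \<and> k \<le> card (gate_set n T y B)) :: real)" for A B
  proof -
    have "(\<Sum>S\<in>\<S>. of_bool (A \<and> gate_set n T y B = S)) = (\<Sum>S\<in>\<S>. if S = gate_set n T y B then of_bool A else 0 :: real)"
      by (intro sum.cong) auto
    then show ?thesis using f gate_set_subset[of n T y B] by (auto simp: \<S>_def sum.delta)
  qed
  have "?q * (mass p n T)\<^sup>2 / 2 \<le> prb p ?V (\<lambda>B. crosses n 1 T y B \<and> k \<le> card (gate_set n T y B))"
    using prb_many_gates[OF n p y T k(2,1) \<tau>] .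
  also have "\<dots> = (\<Sum>S\<in>\<S>. prb p ?V (\<lambda>B. crosses n 1 T y B \<and> gate_set n T y B = S))"
    unfolding expect_sum[symmetric] part ..
  also have "\<dots> \<le> (\<Sum>S\<in>\<S>. 128 * prb p ?V (\<lambda>B. exits_avoiding n T y \<alpha> B \<and> gate_set n T y B = S))"
  proof (rule sum_mono)
    fix S assume "S \<in> \<S>"
    then have "S \<subseteq> gate_columns T" "2 * (real n)\<^sup>2 \<le> ?q * card S"
      using q0 by (auto simp: \<S>_def k_def pos_divide_le_eq mult.commute)
    then show "prb p ?V (\<lambda>B. crosses n 1 T y B \<and> gate_set n T y B = S)
        \<le> 128 * prb p ?V (\<lambda>B. exits_avoiding n T y \<alpha> B \<and> gate_set n T y B = S)"
      by (rule prb_avoid_given_gates[OF n p y])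
  qed
  also have "\<dots> = 128 * prb p ?V (\<lambda>B. exits_avoiding n T y \<alpha> B \<and> k \<le> card (gate_set n T y B))"
    unfolding sum_distrib_left[symmetric] expect_sum[symmetric] part ..
  also have "\<dots> \<le> 128 * prb p ?V (exits_avoiding n T y \<alpha>)"
    using p by (intro mult_left_mono prb_mono) auto
  finally show ?thesis by simp
qed

subsection \<open>Meeting of independent rays\<close>

definition proj :: "nat \<Rightarrow> vertex \<Rightarrow> vertex" where
  "proj n v = (fst v, snd v mod (2 * int n))"

lemma env_proj: "env n B w \<longleftrightarrow> proj n w \<in> B"
  by (simp add: env_def proj_def split: prod.split)

definition site :: "nat \<Rightarrow> vertex set \<Rightarrow> int \<Rightarrow> nat \<Rightarrow> vertex" where
  "site n B y i = proj n (fst (ray (env n B) ((1, y), East) i))"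

definition inside :: "nat \<Rightarrow> int \<Rightarrow> vertex set \<Rightarrow> int \<Rightarrow> nat \<Rightarrow> bool" where
  "inside n T B y i \<longleftrightarrow> (\<forall>i'\<le>i. col (ray (env n B) ((1, y), East) i') \<in> {1..T})"

lemma inside_mono: "inside n T B y i \<Longrightarrow> j \<le> i \<Longrightarrow> inside n T B y j"
  by (simp add: inside_def)

lemma site_in_slab: "n > 0 \<Longrightarrow> inside n T B y i \<Longrightarrow> site n B y i \<in> slab n 1 T"
  by (simp add: inside_def site_def proj_def slab_def)

lemma ray_env_translate:
  assumes "n > 0"
  shows "ray (env n B) ((1, y + k * (2 * int n)), East) i
    = translate (0, k * (2 * int n)) (ray (env n B) ((1, y), East) i)"
  using ray_periodic[OF periodic_env[OF assms, of B], of k "((1, y), East)" i] by (simp add: translate_def)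

text \<open>If the exit order is not e < e', the paths themselves meet. Otherwise e' is beyond e +
  2n by parity, and the second path lowered by one period starts below the first and ends above
  it.\<close>

lemma sites_meet:
  assumes n: "n > 0" and T: "1 \<le> T" and "odd (y - z)" "y < z"
    and y: "cross (env n B) 1 T y e" and z: "cross (env n C) 1 T z e'"
    and order: "\<not> (e < e' \<and> e' < e + 2 * int n)" and "z < y + 2 * int n"
  shows "\<exists>i j. inside n T B y i \<and> inside n T C z j \<and> site n B y i = site n C z j"
proof (cases "e < e'")
  case False
  then show ?thesis
    using rays_meet[OF T y z] assms unfolding inside_def site_def by metis
next
  case True
  let ?N = "2 * int n"
  have ge: "e + ?N \<le> e'" using order True by simp
  have "odd (e - e')" using cross_even[OF y] cross_even[OF z] assms by simp
  then have "e' \<noteq> e + ?N" by auto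
  then have lt: "e < e' - ?N" using ge by simp
  have z': "cross (env n C) 1 T (z - ?N) (e' - ?N)"
    using cross_periodic[OF periodic_env[OF n, of C], of 1 T z "-1" e'] z by simp
  obtain i j where ij: "\<forall>i'\<le>i. col (ray (env n B) ((1, y), East) i') \<in> {1..T}"
    "\<forall>j'\<le>j. col (ray (env n C) ((1, z - ?N), East) j') \<in> {1..T}"
    "fst (ray (env n B) ((1, y), East) i) = fst (ray (env n C) ((1, z - ?N), East) j)"
    using rays_meet[OF T y z'] assms lt by auto
  have tr: "ray (env n C) ((1, z - ?N), East) j' = translate (0, - ?N) (ray (env n C) ((1, z), East) j')" for j'
    using ray_env_translate[OF n, of C z "-1" j'] by simp
  have "inside n T C z j" using ij(2) unfolding inside_def tr by simp
  moreover have "site n B y i = site n C z j"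
    unfolding site_def ij(3) tr by (simp add: proj_def translate_def)
  ultimately show ?thesis using ij(1) unfolding inside_def by blast
qed

text \<open>The choice is asymmetric: earliest along the first ray, then earliest along the second.
  Thus the sites used by the first ray before the meeting are disjoint from those used by the
  second, which is what the exchange of environments needs.\<close>

definition first_meeting :: "nat \<Rightarrow> int \<Rightarrow> int \<Rightarrow> int \<Rightarrow> vertex \<Rightarrow> vertex set \<Rightarrow> vertex set \<Rightarrow> bool" where
  "first_meeting n T y z v B C \<longleftrightarrow> (\<exists>i j. inside n T B y i \<and> inside n T C z j \<and>
     site n B y i = v \<and> site n C z j = v \<and>
     (\<forall>i'<i. \<forall>j'\<le>j. site n B y i' \<noteq> site n C z j') \<and> (\<forall>j'<j. site n C z j' \<noteq> v))"

lemma first_meeting_exists: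
  assumes "inside n T B y i" "inside n T C z j" "site n B y i = site n C z j" and n: "n > 0"
  shows "\<exists>v\<in>slab n 1 T. first_meeting n T y z v B C"
proof -
  define P where "P i \<longleftrightarrow> inside n T B y i \<and> (\<exists>j. inside n T C z j \<and> site n B y i = site n C z j)" for i
  define i0 where "i0 = (LEAST i. P i)"
  have Pi0: "P i0" unfolding i0_def by (rule LeastI[of P i]) (use assms in \<open>auto simp: P_def\<close>)
  define Q where "Q j \<longleftrightarrow> inside n T C z j \<and> site n B y i0 = site n C z j" for j
  define j0 where "j0 = (LEAST j. Q j)"
  have Qj0: "Q j0" unfolding j0_def using Pi0 by (intro LeastI_ex[of Q]) (auto simp: P_def Q_def)
  have i': "site n B y i' \<noteq> site n C z j'" if "i' < i0" "j' \<le> j0" for i' j'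
  proof -
    have "\<not> P i'" using that not_less_Least unfolding i0_def by blast
    then show ?thesis using that Pi0 Qj0 inside_mono[of n T B y i0 i'] inside_mono[of n T C z j0 j']
      unfolding P_def Q_def by auto
  qed
  have j': "site n C z j' \<noteq> site n C z j0" if "j' < j0" for j'
  proof -
    have "\<not> Q j'" using that not_less_Least unfolding j0_def by blast
    then show ?thesis using that Qj0 inside_mono[of n T C z j0 j'] unfolding Q_def by auto
  qed
  have "site n C z j0 \<in> slab n 1 T" using Qj0 site_in_slab[OF n] unfolding Q_def by blast
  moreover have "first_meeting n T y z (site n C z j0) B C"
    unfolding first_meeting_def using Pi0 Qj0 i' j' unfolding P_def Q_def by blast
  ultimately show ?thesis by blast
qed

text \<open>First arrivals matter: neither ray has read the bit at \<open>v\<close>, so it can still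
  be chosen freely.\<close>

definition both_arrive :: "nat \<Rightarrow> int \<Rightarrow> int \<Rightarrow> int \<Rightarrow> vertex \<Rightarrow> vertex set \<Rightarrow> bool" where
  "both_arrive n T y z v B \<longleftrightarrow> (\<exists>i j. inside n T B y i \<and> inside n T B z j \<and>
     site n B y i = v \<and> site n B z j = v \<and> (\<forall>i'<i. site n B y i' \<noteq> v) \<and> (\<forall>j'<j. site n B z j' \<noteq> v))"

text \<open>This set depends on the first environment alone, so that it can be read off again after
  the exchange.\<close>

definition sites_before :: "nat \<Rightarrow> int \<Rightarrow> vertex \<Rightarrow> vertex set \<Rightarrow> vertex set" where
  "sites_before n y v B = site n B y ` {..<(LEAST i. site n B y i = v)}"

text \<open>Before the meeting the first ray reads only sites of \<open>D\<close> and the second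
  only sites off \<open>D\<close>, so both follow their old paths in \<open>B'\<close>. As the first
  ray and its arrival time at \<open>v\<close> are unchanged, \<open>D\<close> is recovered from
  \<open>B'\<close>.\<close>

lemma first_meeting_exchange:
  assumes "first_meeting n T y z v B C"
  defines "D \<equiv> sites_before n y v B"
  defines "B' \<equiv> (B \<inter> D) \<union> (C - D)"
  shows "sites_before n y v B' = D" "both_arrive n T y z v B'"
proof -
  obtain i j where i: "inside n T B y i" "site n B y i = v" and j: "inside n T C z j" "site n C z j = v"
    and i': "\<And>i' j'. i' < i \<Longrightarrow> j' \<le> j \<Longrightarrow> site n B y i' \<noteq> site n C z j'"
    and j': "\<And>j'. j' < j \<Longrightarrow> site n C z j' \<noteq> v"
    using assms(1) unfolding first_meeting_def by blast
  have iv: "site n B y i' \<noteq> v" if "i' < i" for i' using i'[OF that, of j] j by simp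
  have least: "(LEAST k. site n B y k = v) = i"
    by (rule Least_equality[where P = "\<lambda>k. site n B y k = v", OF i(2)]) (use iv not_le in blast)
  have D: "D = site n B y ` {..<i}" unfolding D_def sites_before_def least ..
  have rB: "ray (env n B) ((1, y), East) k = ray (env n B') ((1, y), East) k" if "k \<le> i" for k
  proof (rule ray_cong)
    fix m assume "m < k"
    then have "proj n (fst (ray (env n B) ((1, y), East) m)) \<in> D"
      unfolding D site_def[symmetric] using that by auto
    then show "env n B (fst (ray (env n B) ((1, y), East) m)) = env n B' (fst (ray (env n B) ((1, y), East) m))"
      unfolding env_proj B'_def by auto
  qed
  have rC: "ray (env n C) ((1, z), East) k = ray (env n B') ((1, z), East) k" if "k \<le> j" for k
  proof (rule ray_cong)
    fix m assume "m < k"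
    then have "proj n (fst (ray (env n C) ((1, z), East) m)) \<notin> D"
      unfolding D site_def[symmetric] using that i'[of _ m] by force
    then show "env n C (fst (ray (env n C) ((1, z), East) m)) = env n B' (fst (ray (env n C) ((1, z), East) m))"
      unfolding env_proj B'_def by auto
  qed
  have sB: "site n B' y k = site n B y k" if "k \<le> i" for k using rB[OF that] by (simp add: site_def)
  have sC: "site n B' z k = site n C z k" if "k \<le> j" for k using rC[OF that] by (simp add: site_def)
  have least': "(LEAST k. site n B' y k = v) = i"
    by (rule Least_equality[where P = "\<lambda>k. site n B' y k = v"])
      (use i(2) iv sB not_le in \<open>metis order_refl\<close>, metis iv sB not_le less_imp_le)
  show "sites_before n y v B' = D"
    unfolding sites_before_def least' D using sB by auto
  have "inside n T B' y i" "inside n T B' z j" using i(1) j(1) rB rC unfolding inside_def by auto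
  then show "both_arrive n T y z v B'"
    unfolding both_arrive_def using i j iv j' sB sC by (intro exI[of _ i] exI[where x = j]) auto
qed

definition returns :: "nat \<Rightarrow> int \<Rightarrow> int \<Rightarrow> int \<Rightarrow> vertex set \<Rightarrow> bool" where
  "returns n T y z B \<longleftrightarrow> (\<exists>k. turn_back (env n B) 1 T y (z + k * (2 * int n)))"

text \<open>The even and the odd row give opposite orientations, so the current bit at
  \<open>v\<close> or the flipped one joins the rays; the flip does not affect the paths up to their
  first arrivals.\<close>

lemma returns_if_both_arrive:
  assumes n: "n > 0" and "even y" "odd z" and "both_arrive n T y z v B"
  shows "returns n T y z B \<or> returns n T y z (if v \<in> B then B - {v} else insert v B)"
proof -
  obtain i j where i: "inside n T B y i" "site n B y i = v" "\<And>i'. i' < i \<Longrightarrow> site n B y i' \<noteq> v"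
    and j: "inside n T B z j" "site n B z j = v" "\<And>j'. j' < j \<Longrightarrow> site n B z j' \<noteq> v"
    using assms(4) unfolding both_arrive_def by blast
  let ?N = "2 * int n"
  obtain u h where s: "ray (env n B) ((1, y), East) i = (u, h)" by (metis prod.exhaust)
  obtain u' h' where s': "ray (env n B) ((1, z), East) j = (u', h')" by (metis prod.exhaust)
  have pu: "proj n u = v" "proj n u' = v" using i j s s' by (simp_all add: site_def)
  then have "fst u = fst u'" "snd u mod ?N = snd u' mod ?N" by (auto simp: proj_def)
  \<comment> \<open>A meeting on the cylinder is a meeting in the plane after lifting the second ray
    by k periods.\<close>
  define k where "k = snd u div ?N - snd u' div ?N"
  have "snd u = snd u' + k * ?N"
    using \<open>snd u mod ?N = snd u' mod ?N\<close> unfolding k_def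
    by (simp add: left_diff_distrib minus_mod_eq_div_mult[symmetric])
  then have u: "u = (fst u', snd u' + k * ?N)" using \<open>fst u = fst u'\<close> by (simp add: prod_eq_iff)
  define z' where "z' = z + k * ?N"
  have tr: "ray (env n B) ((1, z'), East) m = translate (0, k * ?N) (ray (env n B) ((1, z), East) m)" for m
    unfolding z'_def by (rule ray_env_translate[OF n])
  have s'': "ray (env n B) ((1, z'), East) j = (u, h')"
    unfolding tr s' u by (simp add: translate_def)
  have o: "oriented (u, h)" "\<not> oriented (u, h')"
    using oriented_ray[of "env n B" "((1, y), East)" i] oriented_ray[of "env n B" "((1, z'), East)" j]
    unfolding s s'' by (simp_all add: oriented_def z'_def assms)
  have colz: "col (ray (env n B) ((1, z'), East) m) \<in> {1..T}" if "m \<le> j" for m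
    using j(1) that unfolding tr inside_def by simp
  have sz: "proj n (fst (ray (env n B) ((1, z'), East) m)) = site n B z m" for m
    unfolding tr site_def by (simp add: proj_def translate_def)
  consider "step (env n B) (u, h) = reversed (u, h')"
    | "step (fun_upd (env n B) u (\<not> env n B u)) (u, h) = reversed (u, h')"
    using joined_by_some_state[OF o] by blast
  then show ?thesis
  proof cases
    case 1
    have "turn_back (env n B) 1 T y z'"
      by (rule turn_back_if_joined[where i = i and j = j])
        (use i(1) colz 1 s s'' in \<open>auto simp: inside_def\<close>)
    then show ?thesis unfolding returns_def z'_def by blast
  next
    case 2
    let ?B' = "if v \<in> B then B - {v} else insert v B"
    have same: "env n B w = env n ?B' w" if "proj n w \<noteq> v" for w
      using that unfolding env_proj by auto
    have flip: "env n ?B' u = (\<not> env n B u)" using pu unfolding env_proj by auto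
    have ry: "ray (env n B) ((1, y), East) m = ray (env n ?B') ((1, y), East) m" if "m \<le> i" for m
      by (rule ray_cong, rule same) (use i(3) that in \<open>auto simp: site_def\<close>)
    have rz: "ray (env n B) ((1, z'), East) m = ray (env n ?B') ((1, z'), East) m" if "m \<le> j" for m
      by (rule ray_cong, rule same) (use j(3) that sz in auto)
    \<comment> \<open>The flip on the cylinder changes all lifts of \<open>v\<close>, whereas the
      joining step depends only on the bit at \<open>u\<close>.\<close>
    have st: "step (env n ?B') (u, h) = reversed (u, h')"
      unfolding 2[symmetric] by (rule step_cong) (simp only: fst_conv flip fun_upd_same)
    have "turn_back (env n ?B') 1 T y z'"
    proof (rule turn_back_if_joined[where i = i and j = j])
      show "\<forall>i'\<le>i. col (ray (env n ?B') ((1, y), East) i') \<in> {1..T}"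
        using i(1) ry unfolding inside_def by metis
      show "\<forall>j'\<le>j. col (ray (env n ?B') ((1, z'), East) j') \<in> {1..T}"
        using colz rz by metis
      show "step (env n ?B') (ray (env n ?B') ((1, y), East) i) = reversed (ray (env n ?B') ((1, z'), East) j)"
        unfolding ry[OF order_refl, symmetric] rz[OF order_refl, symmetric] s s'' by (rule st)
    qed
    then show ?thesis unfolding returns_def z'_def by blast
  qed
qed

lemma expect_swap:
  "expect p V (\<lambda>B. expect p W (\<lambda>C. F B C)) = expect p W (\<lambda>C. expect p V (\<lambda>B. F B C))"
  unfolding expect_def sum_distrib_left by (subst sum.swap) (simp only: mult.left_commute)

lemma returns_shift: "returns n T y (z + k * (2 * int n)) B \<longleftrightarrow> returns n T y z B"
proof -
  have "z + k * (2 * int n) + l * (2 * int n) = z + (k + l) * (2 * int n)" for l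
    by (simp add: algebra_simps)
  then have "returns n T y (z + k * (2 * int n)) B \<longleftrightarrow> (\<exists>l. turn_back (env n B) 1 T y (z + (k + l) * (2 * int n)))"
    unfolding returns_def by (simp only:)
  also have "\<dots> \<longleftrightarrow> returns n T y z B"
    unfolding returns_def by (metis add.commute diff_add_cancel)
  finally show ?thesis .
qed

text \<open>The second ray crosses with probability m, and independently the first avoids the
  resulting window with probability of order m^2. The meeting is charged to one of the 2 n T sites;
  exchange and flip bring it into one environment at the cost of the factor depending on p.\<close>

lemma prb_returns_ge:
  fixes p :: real
  assumes n: "n \<ge> 2" and p: "0 < p" "p < 1" and y: "even y" and z: "odd z"
    and T: "T = 2 * int \<tau>" and \<tau>: "\<tau> > 1"
    and K: "2 * (real n)\<^sup>2 \<le> (p * (1 - p))\<^sup>2 * mass p n T * (real \<tau> - 1) / 2"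
  shows "p * (1 - p) * mass p n T ^ 3 / 256
    \<le> 2 * real n * real_of_int T * ((1 + (p / (1 - p) + (1 - p) / p)) * prb p (slab n 1 T) (returns n T y z))"
proof -
  let ?N = "2 * int n" and ?V = "slab n 1 T" and ?m = "mass p n T"
  let ?R = "p / (1 - p) + (1 - p) / p"
  \<comment> \<open>The lift of \<open>z\<close> strictly between \<open>y\<close> and its next
    translate; the parities of \<open>y\<close> and \<open>z\<close> exclude equality.\<close>
  define z1 where "z1 = y + (z - y) mod ?N"
  have z1: "z1 = z + (- ((z - y) div ?N)) * ?N"
    unfolding z1_def using minus_div_mult_eq_mod[of "z - y" ?N] by (simp add: algebra_simps)
  have ret: "returns n T y z1 = returns n T y z" unfolding z1 using returns_shift by blast
  have "odd ((z - y) mod ?N)" using y z dvd_mod_iff[of 2 ?N "z - y"] by simp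
  then have odd: "odd z1" and "(z - y) mod ?N \<noteq> 0" unfolding z1_def using y by (simp, metis even_zero)
  then have lt: "y < z1" "z1 < y + ?N"
    unfolding z1_def using n pos_mod_bound[of ?N "z - y"] pos_mod_sign[of ?N "z - y"] by linarith+
  have T1: "1 \<le> T" using T \<tau> by simp
  have m: "0 \<le> ?m" using mass_bounds p by simp
  define A where "A B C \<longleftrightarrow> (\<exists>e e'. cross (env n B) 1 T y e \<and> cross (env n C) 1 T z1 e' \<and>
    \<not> (e < e' \<and> e' < e + ?N))" for B C
  have "p * (1 - p) * ?m ^ 3 / 256 = p * (1 - p) * ?m\<^sup>2 / 256 * prb p ?V (crosses n 1 T z1)"
    using prb_crosses_odd[of n T z1 p] n T1 odd by (simp add: power2_eq_square power3_eq_cube)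
  also have "\<dots> = expect p ?V (\<lambda>C. p * (1 - p) * ?m\<^sup>2 / 256 * of_bool (crosses n 1 T z1 C))"
    by (simp only: expect_cmult)
  also have "\<dots> \<le> expect p ?V (\<lambda>C. prb p ?V (\<lambda>B. A B C))"
  proof (rule expect_mono)
    fix C
    show "p * (1 - p) * ?m\<^sup>2 / 256 * of_bool (crosses n 1 T z1 C) \<le> prb p ?V (\<lambda>B. A B C)"
    proof (cases "crosses n 1 T z1 C")
      case True
      then obtain e' where e': "cross (env n C) 1 T z1 e'" unfolding crosses_def by blast
      \<comment> \<open>With the window ending at e', avoiding it means exactly that e' is not
        strictly between e and e + 2n.\<close>
      have "p * (1 - p) * ?m\<^sup>2 / 256 \<le> prb p ?V (exits_avoiding n T y (e' - ?N))"
        by (rule prb_exits_avoiding[OF n p y T \<tau> K])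
      also have "\<dots> \<le> prb p ?V (\<lambda>B. A B C)"
      proof (rule prb_mono)
        fix B assume "exits_avoiding n T y (e' - ?N) B"
        then obtain e where "cross (env n B) 1 T y e" "\<not> (e < e' \<and> e' < e + ?N)"
          unfolding exits_avoiding_def by auto
        then show "A B C" unfolding A_def using e' by blast
      qed (use p in auto)
      finally show ?thesis using True by simp
    qed (use p in \<open>auto intro!: expect_nonneg\<close>)
  qed (use p in auto)
  also have "\<dots> = expect p ?V (\<lambda>B. prb p ?V (A B))"
    by (rule expect_swap)
  also have "\<dots> \<le> expect p ?V (\<lambda>B. \<Sum>v\<in>?V. prb p ?V (first_meeting n T y z1 v B))"
  proof (rule expect_mono)
    fix B
    have "prb p ?V (A B) \<le> prb p ?V (\<lambda>C. \<exists>v\<in>?V. first_meeting n T y z1 v B C)"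
    proof (rule prb_mono)
      fix C assume "A B C"
      then obtain e e' where e: "cross (env n B) 1 T y e" "cross (env n C) 1 T z1 e'" "\<not> (e < e' \<and> e' < e + ?N)"
        unfolding A_def by blast
      have "\<exists>i j. inside n T B y i \<and> inside n T C z1 j \<and> site n B y i = site n C z1 j"
        by (rule sites_meet[OF _ T1 _ lt(1) e lt(2)]) (use n y odd in auto)
      then show "\<exists>v\<in>?V. first_meeting n T y z1 v B C"
        using first_meeting_exists[of n T B y _ C z1] n by auto
    qed (use p in auto)
    also have "\<dots> \<le> (\<Sum>v\<in>?V. prb p ?V (first_meeting n T y z1 v B))"
      by (rule prb_ex_le) (use p in auto)
    finally show "prb p ?V (A B) \<le> (\<Sum>v\<in>?V. prb p ?V (first_meeting n T y z1 v B))" .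
  qed (use p in auto)
  also have "\<dots> = (\<Sum>v\<in>?V. expect p ?V (\<lambda>B. prb p ?V (first_meeting n T y z1 v B)))"
    by (rule expect_sum)
  also have "\<dots> \<le> (\<Sum>v\<in>?V. (1 + ?R) * prb p ?V (returns n T y z1))"
  proof (rule sum_mono)
    fix v assume v: "v \<in> ?V"
    have "expect p ?V (\<lambda>B. prb p ?V (first_meeting n T y z1 v B)) \<le> prb p ?V (both_arrive n T y z1 v)"
      by (rule expect_exchange_le[where D = "sites_before n y v"])
        (use p first_meeting_exchange in auto)
    also have "\<dots> \<le> prb p ?V (\<lambda>B. returns n T y z1 B \<or> returns n T y z1 (if v \<in> B then B - {v} else insert v B))"
      by (rule prb_mono) (use p n y odd returns_if_both_arrive[of n y z1 T v] in auto)
    also have "\<dots> \<le> prb p ?V (returns n T y z1) + prb p ?V (\<lambda>B. returns n T y z1 (if v \<in> B then B - {v} else insert v B))"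
      by (rule prb_disj_le) (use p in auto)
    also have "\<dots> \<le> prb p ?V (returns n T y z1) + ?R * prb p ?V (returns n T y z1)"
      using prb_flip_le[OF p finite_slab v, of "returns n T y z1"] by simp
    finally show "expect p ?V (\<lambda>B. prb p ?V (first_meeting n T y z1 v B)) \<le> (1 + ?R) * prb p ?V (returns n T y z1)"
      by (simp only: distrib_right mult_1)
  qed
  also have "\<dots> = real (card ?V) * ((1 + ?R) * prb p ?V (returns n T y z1))"
    by (simp only: sum_constant)
  also have "real (card ?V) = 2 * real n * real_of_int T"
    using T1 by (simp add: slab_def)
  finally show ?thesis unfolding ret .
qed

subsection \<open>Loss of crossings\<close>

definition some_cross :: "nat \<Rightarrow> int \<Rightarrow> int \<Rightarrow> vertex set \<Rightarrow> bool" where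
  "some_cross n a b B \<longleftrightarrow> (\<exists>y. crosses n a b y B)"

text \<open>By the balance of parities one crossing forces crossings of both kinds, the pair that a
  fresh slab can join.\<close>

lemma some_cross_parity:
  assumes n: "n > 0" and ab: "a \<le> b" and "some_cross n a b B"
  shows "\<exists>y\<in>{0..<2 * int n}. even y \<and> crosses n a b y B" "\<exists>y\<in>{0..<2 * int n}. odd y \<and> crosses n a b y B"
proof -
  let ?N = "2 * int n"
  note per = periodic_env[OF n, of B]
  obtain y r where yr: "cross (env n B) a b y r" using assms(3) unfolding some_cross_def crosses_def by blast
  have y: "y mod ?N + (y div ?N) * ?N = y" by (rule mod_div_mult_eq)
  have "cross (env n B) a b (y mod ?N + (y div ?N) * ?N) (r - (y div ?N) * ?N + (y div ?N) * ?N)"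
    unfolding y using yr by simp
  then have c: "cross (env n B) a b (y mod ?N) (r - (y div ?N) * ?N)"
    unfolding cross_periodic[OF per] .
  let ?E = "{y \<in> {0..<?N}. even y \<and> (\<exists>r. cross (env n B) a b y r)}"
  let ?O = "{y \<in> {0..<?N}. odd y \<and> (\<exists>r. cross (env n B) a b y r)}"
  have "y mod ?N \<in> ?E \<union> ?O" using c n by auto
  then have ne: "?E \<noteq> {} \<or> ?O \<noteq> {}" by blast
  have f: "finite ?E" "finite ?O" by (rule finite_subset[of _ "{0..<?N}"]; auto)+
  have "card ?E = card ?O" by (rule card_cross_even_eq_odd[OF per ab])
  then have "?E \<noteq> {}" "?O \<noteq> {}" using ne f by (metis card_0_eq)+
  then show "\<exists>y\<in>{0..<?N}. even y \<and> crosses n a b y B" "\<exists>y\<in>{0..<?N}. odd y \<and> crosses n a b y B"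
    unfolding crosses_def by blast+
qed

lemma turn_back_env_shift:
  assumes "n > 0" "B \<subseteq> slab n c d" "even i"
  shows "turn_back (env n (shift_site n i 0 ` B)) (a + i) (b + i) y r \<longleftrightarrow> turn_back (env n B) a b y r"
proof -
  have "(\<lambda>(x, y). env n (shift_site n i 0 ` B) (x + i, y)) = env n B"
    using env_shift[OF assms(1,2), of i 0] by auto
  then show ?thesis
    using turn_back_translate[of i 0 "env n (shift_site n i 0 ` B)" a b y r] assms(3) by simp
qed

text \<open>Each crossing of the longer slab extends one of the shorter slab, so the mean loss is at
  least the probability of losing one. Given some crossing, there is an even and an odd one, and the
  new columns, independent of the old, reflect the end of the former into that of the latter.
  Evenness of \<open>L\<close> makes the new columns a translate of the reference slab.\<close>

lemma mass_drop:
  assumes n: "n > 0" and p: "0 < p" "p < 1" and L: "1 \<le> L" "even L" and T: "1 \<le> T"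
    and q: "\<And>Y Z. even Y \<Longrightarrow> odd Z \<Longrightarrow> q \<le> prb p (slab n 1 T) (returns n T Y Z)"
  shows "n * mass p n (L + T) \<le> n * mass p n L - q * prb p (slab n 1 L) (some_cross n 1 L)"
proof -
  let ?N = "2 * int n" and ?V = "slab n 1 (L + T)" and ?V1 = "slab n 1 L" and ?V2 = "slab n (L + 1) (L + T)"
  let ?E = "{y \<in> {0..<2 * int n}. even y}"
  have fE: "finite ?E" by (rule finite_subset[of _ "{0..<2 * int n}"]) auto
  define lost where "lost B \<longleftrightarrow> (\<exists>y\<in>?E. crosses n 1 L y B \<and> \<not> crosses n 1 (L + T) y B)" for B
  have prefix: "crosses n 1 L y B" if "crosses n 1 (L + T) y B" for y B
    using that L T by (auto simp: crosses_def elim: cross_prefix)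
  have "n * mass p n L = (\<Sum>y\<in>?E. prb p ?V (crosses n 1 L y))"
  proof -
    have "prb p ?V (crosses n 1 L y) = mass p n L" if "y \<in> ?E" for y
      using prb_crosses_superset[of n 1 L ?V] prb_crosses_even[of n 1 y p L] that n T
      by (simp add: slab_def subset_eq)
    then show ?thesis using card_even_range[of n] by simp
  qed
  moreover have "n * mass p n (L + T) = (\<Sum>y\<in>?E. prb p ?V (crosses n 1 (L + T) y))"
    using prb_crosses_even[of n 1 _ p "L + T"] n card_even_range[of n] by simp
  moreover have "(\<Sum>y\<in>?E. prb p ?V (crosses n 1 L y)) - (\<Sum>y\<in>?E. prb p ?V (crosses n 1 (L + T) y))
      = expect p ?V (\<lambda>B. \<Sum>y\<in>?E. of_bool (crosses n 1 L y B) - of_bool (crosses n 1 (L + T) y B))"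
    unfolding expect_sum sum_subtractf[symmetric] expect_diff ..
  moreover have "prb p ?V lost \<le> expect p ?V (\<lambda>B. \<Sum>y\<in>?E. of_bool (crosses n 1 L y B) - of_bool (crosses n 1 (L + T) y B))"
  proof (rule expect_mono)
    fix B
    have nn: "0 \<le> (of_bool (crosses n 1 L y B) - of_bool (crosses n 1 (L + T) y B) :: real)" for y
      using prefix[of y B] by simp
    show "of_bool (lost B) \<le> (\<Sum>y\<in>?E. of_bool (crosses n 1 L y B) - of_bool (crosses n 1 (L + T) y B) :: real)"
    proof (cases "lost B")
      case True
      then obtain y where y: "y \<in> ?E" "crosses n 1 L y B" "\<not> crosses n 1 (L + T) y B" unfolding lost_def by blast
      have "of_bool (crosses n 1 L y B) - of_bool (crosses n 1 (L + T) y B)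
          \<le> (\<Sum>y\<in>?E. of_bool (crosses n 1 L y B) - of_bool (crosses n 1 (L + T) y B) :: real)"
        by (rule member_le_sum) (use y fE nn in auto)
      then show ?thesis using y True by simp
    qed (use nn in \<open>auto intro: sum_nonneg\<close>)
  qed (use p in auto)
  moreover have "q * prb p ?V1 (some_cross n 1 L) \<le> prb p ?V lost"
  proof -
    have "q * prb p ?V1 (some_cross n 1 L) = expect p ?V1 (\<lambda>B1. q * of_bool (some_cross n 1 L B1))"
      by (simp only: expect_cmult)
    also have "\<dots> \<le> expect p ?V1 (\<lambda>B1. prb p ?V2 (\<lambda>B2. lost (B1 \<union> B2)))"
    proof (rule expect_mono)
      fix B1 assume B1: "B1 \<subseteq> ?V1"
      show "q * of_bool (some_cross n 1 L B1) \<le> prb p ?V2 (\<lambda>B2. lost (B1 \<union> B2))"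
      proof (cases "some_cross n 1 L B1")
        case True
        obtain y Y where y: "y \<in> ?E" "cross (env n B1) 1 L y Y"
          using some_cross_parity(1)[OF n L(1) True] unfolding crosses_def by auto
        obtain z Z where z: "odd z" "cross (env n B1) 1 L z Z"
          using some_cross_parity(2)[OF n L(1) True] unfolding crosses_def by auto
        have par: "even Y" "odd Z" using cross_even[OF y(2)] cross_even[OF z(2)] y z by auto
        have "q \<le> prb p (slab n 1 T) (returns n T Y Z)" by (rule q[OF par])
        also have "\<dots> = prb p (slab n 1 T) (\<lambda>B. \<exists>k. turn_back (env n (shift_site n L 0 ` B)) (1 + L) (T + L) Y (Z + k * ?N))"
          unfolding returns_def
          by (intro expect_cong) (simp only: turn_back_env_shift[OF n _ L(2)])
        also have "\<dots> = prb p ?V2 (\<lambda>B2. \<exists>k. turn_back (env n B2) (1 + L) (T + L) Y (Z + k * ?N))"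
          using expect_shift[OF n, of p 1 L T _ 0] by (simp add: add.commute)
        also have "\<dots> \<le> prb p ?V2 (\<lambda>B2. lost (B1 \<union> B2))"
        proof (rule prb_mono)
          fix B2 assume B2: "B2 \<subseteq> ?V2" and "\<exists>k. turn_back (env n B2) (1 + L) (T + L) Y (Z + k * ?N)"
          then obtain k where k: "turn_back (env n B2) (L + 1) (L + T) Y (Z + k * ?N)"
            by (auto simp: add.commute)
          let ?\<omega> = "env n (B1 \<union> B2)"
          have e1: "env n B1 (x, w) = ?\<omega> (x, w)" if "x \<in> {1..L}" for x w
            using env_outside[OF B2, of x w] that by (simp add: env_Un)
          have e2: "env n B2 (x, w) = ?\<omega> (x, w)" if "x \<in> {L + 1..L + T}" for x w
            using env_outside[OF B1, of x w] that by (simp add: env_Un)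
          have c1: "cross ?\<omega> 1 L y Y" by (rule cross_cong[OF y(2)]) (rule e1)
          \<comment> \<open>The reflection ends at the exit row \<open>Z\<close> only up to k
            periods, so the odd crossing is lifted by the same amount.\<close>
          have "cross (env n B1) 1 L (z + k * ?N) (Z + k * ?N)"
            using z(2) cross_periodic[OF periodic_env[OF n, of B1]] by blast
          then have c2: "cross ?\<omega> 1 L (z + k * ?N) (Z + k * ?N)" by (rule cross_cong) (rule e1)
          have c3: "turn_back ?\<omega> (L + 1) (L + T) Y (Z + k * ?N)" by (rule turn_back_cong[OF k]) (rule e2)
          have "turn_back ?\<omega> 1 (L + T) y (z + k * ?N)"
            by (rule turn_back_compose[OF c1 c2 c3]) (use L T in auto)
          then have "\<not> crosses n 1 (L + T) y (B1 \<union> B2)"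
            unfolding crosses_def using not_cross_if_turn_back by blast
          then show "lost (B1 \<union> B2)" unfolding lost_def using y(1) c1 crosses_def by blast
        qed (use p in auto)
        finally show ?thesis using True by simp
      qed (use p in \<open>auto intro!: expect_nonneg\<close>)
    qed (use p in auto)
    also have "\<dots> = prb p (?V1 \<union> ?V2) lost"
      by (rule expect_union[symmetric]) (auto simp: slab_def)
    also have "?V1 \<union> ?V2 = ?V"
      using L T by (intro slab_Un) auto
    finally show ?thesis .
  qed
  ultimately show ?thesis by linarith
qed

text \<open>Since crossings come with both parities, the union bound runs over the n even rows
  only.\<close>

lemma prb_some_cross_le:
  assumes n: "n > 0" and p: "0 \<le> p" "p \<le> 1" and L: "1 \<le> L"
  shows "prb p (slab n 1 L) (some_cross n 1 L) \<le> n * mass p n L"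
proof -
  let ?E = "{y \<in> {0..<2 * int n}. even y}"
  have "prb p (slab n 1 L) (some_cross n 1 L) \<le> prb p (slab n 1 L) (\<lambda>B. \<exists>y\<in>?E. crosses n 1 L y B)"
  proof (rule prb_mono[OF p])
    fix B assume "some_cross n 1 L B"
    from some_cross_parity(1)[OF n L this] show "\<exists>y\<in>?E. crosses n 1 L y B" by auto
  qed
  also have "\<dots> \<le> (\<Sum>y\<in>?E. prb p (slab n 1 L) (crosses n 1 L y))"
    by (rule prb_ex_le[OF p]) (rule finite_subset[of _ "{0..<2 * int n}"], auto)
  also have "\<dots> = n * mass p n L"
    using prb_crosses_even[of n 1 _ p L] n card_even_range[of n] by simp
  finally show ?thesis .
qed

lemma some_cross_cong:
  assumes "\<And>x z. x \<in> {a..b} \<Longrightarrow> env n B (x, z) = env n C (x, z)"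
  shows "some_cross n a b B \<longleftrightarrow> some_cross n a b C"
  unfolding some_cross_def using crosses_cong[of a b n B C, OF assms] by simp

lemmas prb_some_cross_superset = prb_superset[OF _ _ _ some_cross_cong]

lemma prb_some_cross_antimono:
  assumes "n > 0" "0 \<le> p" "p \<le> 1" "1 \<le> L" "L \<le> L'"
  shows "prb p (slab n 1 L') (some_cross n 1 L') \<le> prb p (slab n 1 L) (some_cross n 1 L)"
proof -
  have "prb p (slab n 1 L') (some_cross n 1 L') \<le> prb p (slab n 1 L') (some_cross n 1 L)"
  proof (rule prb_mono[OF assms(2,3)])
    fix B assume "some_cross n 1 L' B"
    then obtain y r where "cross (env n B) 1 L' y r" unfolding some_cross_def crosses_def by blast
    then obtain q where "cross (env n B) 1 L y q" using assms(4,5) by (rule cross_prefix)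
    then show "some_cross n 1 L B" unfolding some_cross_def crosses_def by blast
  qed
  also have "\<dots> = prb p (slab n 1 L) (some_cross n 1 L)"
    by (rule prb_some_cross_superset) (use assms in \<open>auto simp: slab_def\<close>)
  finally show ?thesis .
qed

lemma prb_some_cross_shift:
  assumes "n > 0" "even i"
  shows "prb p (slab n (a + i) (b + i)) (some_cross n (a + i) (b + i)) = prb p (slab n a b) (some_cross n a b)"
proof (subst expect_shift[OF assms(1), of p a i b _ 0], rule expect_cong)
  fix B assume "B \<subseteq> slab n a b"
  then have "crosses n (a + i) (b + i) y (shift_site n i 0 ` B) \<longleftrightarrow> crosses n a b y B" for y
    using crosses_shift[of n B a b i 0 a b y] assms by simp
  then show "of_bool (some_cross n (a + i) (b + i) (shift_site n i 0 ` B)) = of_bool (some_cross n a b B)"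
    unfolding some_cross_def by simp
qed

text \<open>If crossings of \<open>[1, s T]\<close> had probability above 1/2 for all \<open>s \<le> S\<close>, with \<open>T\<close> of order
  \<open>n\<^sup>3\<close> and \<open>S\<close> of order \<open>n\<^sup>7\<close>, then the expected number of crossings would drop below 0.\<close>

lemma prb_some_cross_le_half:
  fixes p :: real
  assumes p: "0 < p" "p < 1"
  shows "\<exists>c::nat. c > 0 \<and> even c \<and> (\<forall>n\<ge>2.
    prb p (slab n 1 (int (c * n ^ 10))) (some_cross n 1 (int (c * n ^ 10))) \<le> 1 / 2)"
proof -
  define a where "a = p * (1 - p)"
  define R where "R = 1 + (p / (1 - p) + (1 - p) / p)"
  have a0: "a > 0" using p by (simp add: a_def)
  have R0: "R > 0" using p by (simp add: R_def add_pos_pos)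
  \<comment> \<open>\<open>t0\<close> makes a^2 (\<tau> - 1) at least 8 n^3, which is the dispersion
    requirement once m is at least 1 / (2n). \<open>s0\<close> contradicts the inequality reached at
    the end.\<close>
  obtain t0 :: nat where t0: "8 / a\<^sup>2 + 1 \<le> t0" using real_arch_simple by blast
  obtain s0 :: nat where s0: "8192 * t0 * R / a + 1 < s0" using reals_Archimedean2 by blast
  have t1: "1 \<le> t0" using t0 a0 by (smt (verit) divide_nonneg_pos of_nat_1 of_nat_le_iff zero_less_power)
  have "0 \<le> 8192 * t0 * R / a" using a0 R0 by simp
  then have s1: "1 < real s0" using s0 by linarith
  have "prb p (slab n 1 (int ((2 * t0 * s0) * n ^ 10))) (some_cross n 1 (int ((2 * t0 * s0) * n ^ 10))) \<le> 1 / 2"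
    if n: "n \<ge> 2" for n
  proof (rule ccontr)
    define \<tau> where "\<tau> = t0 * n ^ 3"
    define T where "T = 2 * int \<tau>"
    define S where "S = s0 * n ^ 7"
    define h where "h s = prb p (slab n 1 (int s * T)) (some_cross n 1 (int s * T))" for s
    define m where "m = mass p n T"
    have n1: "1 \<le> real n" "0 < n" using n by auto
    have \<tau>1: "\<tau> > 1"
    proof -
      have "(2::nat) ^ 3 \<le> n ^ 3" using n by (rule power_mono) simp
      then have "8 \<le> n ^ 3" by simp
      moreover have "1 * n ^ 3 \<le> t0 * n ^ 3" using t1 by (rule mult_le_mono1)
      ultimately show ?thesis unfolding \<tau>_def by linarith
    qed
    have T1: "1 \<le> T" "even T" using \<tau>1 by (simp_all add: T_def)
    have S1: "1 \<le> S" using s1 n unfolding S_def by simp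
    have ST: "int ((2 * t0 * s0) * n ^ 10) = int S * T"
      by (simp add: S_def T_def \<tau>_def power_add[symmetric])
    assume "\<not> ?thesis"
    then have "1 / 2 < h S" unfolding ST h_def by simp
    moreover have "h S \<le> h s" if "1 \<le> s" "s \<le> S" for s
    proof -
      have "1 * 1 \<le> int s * T" using that T1 by (intro mult_mono) auto
      moreover have "int s * T \<le> int S * T" using that T1 by (intro mult_right_mono) auto
      ultimately show ?thesis unfolding h_def by (intro prb_some_cross_antimono) (use n1 p in auto)
    qed
    ultimately have h: "1 / 2 < h s" if "1 \<le> s" "s \<le> S" for s using that by fastforce
    have "1 / 2 < n * m"
      using h[of 1] S1 prb_some_cross_le[of n p T] n1 p T1 unfolding h_def m_def by simp
    then have m: "1 / (2 * n) \<le> m" using n1 by (simp add: field_simps)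
    have m0: "m > 0" by (rule less_le_trans[OF _ m]) (use n1 in simp)
    have K: "2 * (real n)\<^sup>2 \<le> (p * (1 - p))\<^sup>2 * mass p n T * (real \<tau> - 1) / 2"
    proof -
      have n3: "1 \<le> real n ^ 3" using n1 by simp
      have "8 / a\<^sup>2 * real n ^ 3 \<le> (t0 - 1) * real n ^ 3"
        using t0 t1 by (intro mult_right_mono) (auto simp: of_nat_diff)
      also have "\<dots> \<le> real \<tau> - 1"
        using n3 t1 unfolding \<tau>_def by (simp add: of_nat_diff algebra_simps)
      finally have le: "8 * real n ^ 3 \<le> a\<^sup>2 * (real \<tau> - 1)"
        using a0 by (simp add: field_simps)
      have "1 / (2 * n) * (8 * real n ^ 3) \<le> m * (a\<^sup>2 * (real \<tau> - 1))"
        by (rule mult_mono[OF m le]) (use m0 in simp_all)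
      moreover have "1 / (2 * n) * (8 * real n ^ 3) = 4 * (real n)\<^sup>2"
        using n1 by (simp add: power2_eq_square power3_eq_cube)
      ultimately show ?thesis unfolding a_def[symmetric] m_def[symmetric] by (simp add: mult_ac)
    qed
    \<comment> \<open>The bound on returns solved for the probability: 512 is 256 times the 2 from
      the number of sites.\<close>
    define q where "q = a * m ^ 3 / (512 * n * T * R)"
    have q: "q \<le> prb p (slab n 1 T) (returns n T Y Z)" if "even Y" "odd Z" for Y Z
    proof -
      have "a * m ^ 3 / 256 \<le> 2 * real n * real_of_int T * (R * prb p (slab n 1 T) (returns n T Y Z))"
        unfolding a_def m_def R_def by (rule prb_returns_ge[OF n p that T_def \<tau>1 K])
      then show ?thesis using n1 T1 R0 unfolding q_def by (simp add: field_simps)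
    qed
    have q0: "q > 0" unfolding q_def using a0 m0 n1 T1 R0 by simp
    have drop: "n * mass p n (int (Suc s) * T) \<le> n * mass p n (int s * T) - q / 2" if "1 \<le> s" "s \<le> S" for s
    proof -
      have s: "1 * 1 \<le> int s * T" using that T1 by (intro mult_mono) auto
      have "n * mass p n (int s * T + T) \<le> n * mass p n (int s * T) - q * h s"
        unfolding h_def by (rule mass_drop[OF n1(2) p _ _ T1(1) q]) (use s T1 in auto)
      moreover have "q * (1 / 2) \<le> q * h s" using h[OF that] q0 by (intro mult_left_mono) auto
      moreover have "int (Suc s) * T = int s * T + T" by (simp add: algebra_simps)
      ultimately show ?thesis by simp
    qed
    have "n * mass p n (int (Suc s) * T) \<le> n * m - s * (q / 2)" if "s \<le> S" for s
      using that
    proof (induction s)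
      case (Suc s)
      have "real (Suc s) * (q / 2) = s * (q / 2) + q / 2" by (simp add: field_simps)
      moreover have "n * mass p n (int (Suc s) * T) \<le> n * m - s * (q / 2)" using Suc by simp
      moreover have "n * mass p n (int (Suc (Suc s)) * T) \<le> n * mass p n (int (Suc s) * T) - q / 2"
        using drop[of "Suc s"] Suc by simp
      ultimately show ?case by linarith
    qed (simp add: m_def)
    then have "n * mass p n (int (Suc S) * T) \<le> n * m - S * (q / 2)" by blast
    moreover have "0 \<le> n * mass p n (int (Suc S) * T)"
      using mass_bounds(1)[of p n "int (Suc S) * T"] p by (intro mult_nonneg_nonneg) auto
    ultimately have "S * (q / 2) \<le> n * m" by linarith
    then have "real S * (a * m ^ 3) \<le> n * m * (1024 * n * T * R)"
      unfolding q_def using n1 T1 R0 by (simp add: field_simps)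
    \<comment> \<open>One factor m of the loss cancels against the initial count n m; the other two
      are bounded below by 1 / (2n) each.\<close>
    then have "m * (real S * (a * m\<^sup>2)) \<le> m * (n * (1024 * n * T * R))"
      by (simp add: power2_eq_square power3_eq_cube mult_ac)
    then have le: "real S * (a * m\<^sup>2) \<le> n * (1024 * n * T * R)"
      using m0 by (simp only: mult_le_cancel_left_pos)
    have "(1 / (2 * n))\<^sup>2 \<le> m\<^sup>2" using m by (intro power_mono) auto
    then have "real S * (a * (1 / (2 * n))\<^sup>2) \<le> real S * (a * m\<^sup>2)"
      using a0 by (intro mult_left_mono) auto
    also note le
    finally have "real S * a \<le> 4096 * n ^ 4 * T * R"
      using n1 by (simp add: field_simps power2_eq_square power4_eq_xxxx)
    also have "\<dots> = 8192 * t0 * R * real n ^ 7"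
      by (simp add: T_def \<tau>_def power_add[of "real n" 4 3, simplified])
    finally have "real n ^ 7 * (s0 * a) \<le> real n ^ 7 * (8192 * t0 * R)"
      by (simp add: S_def mult_ac)
    then have "s0 * a \<le> 8192 * t0 * R" using n1 by (simp only: mult_le_cancel_left_pos zero_less_power)
    then show False using s0 a0 by (simp add: field_simps)
  qed
  moreover have "0 < 2 * t0 * s0" using t1 s1 by simp
  ultimately show ?thesis by (intro exI[of _ "2 * t0 * s0"]) auto
qed

subsection \<open>Localization\<close>

text \<open>The blocks use disjoint sets of columns, so their crossing events are independent, and
  each is a translate by an even number of columns of the event on the reference slab.\<close>

lemma prb_all_blocks_le:
  assumes n: "n > 0" and p: "0 \<le> p" "p \<le> 1" and L: "0 < L" "even L" and "finite I"
    and half: "prb p (slab n 1 L) (some_cross n 1 L) \<le> 1 / 2"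
  shows "prb p (\<Union>i\<in>I. slab n (1 + i * L) (L + i * L)) (\<lambda>B. \<forall>i\<in>I. some_cross n (1 + i * L) (L + i * L) B)
    \<le> (1 / 2) ^ card I"
  using \<open>finite I\<close>
proof (induction I rule: finite_induct)
  case (insert i I)
  let ?s = "\<lambda>i. slab n (1 + i * L) (L + i * L)" and ?c = "\<lambda>i. some_cross n (1 + i * L) (L + i * L)"
  let ?W = "\<Union>i\<in>I. ?s i"
  have cols: "x \<notin> {1 + j * L..L + j * L}" if "x \<in> {1 + i * L..L + i * L}" "i \<noteq> j" for x i j
  proof (cases "i < j")
    case True
    then have "(i + 1) * L \<le> j * L" using L by (intro mult_right_mono) auto
    then have "L + i * L \<le> j * L" by (simp add: algebra_simps)
    then show ?thesis using that by auto
  next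
    case False
    then have "(j + 1) * L \<le> i * L" using L that by (intro mult_right_mono) auto
    then have "L + j * L \<le> i * L" by (simp add: algebra_simps)
    then show ?thesis using that by auto
  qed
  have disj: "?s i \<inter> ?W = {}"
  proof -
    have "?s i \<inter> ?s j = {}" if "j \<in> I" for j
    proof -
      have "i \<noteq> j" using that insert.hyps by blast
      from cols[OF _ this] show ?thesis unfolding slab_def by blast
    qed
    then show ?thesis by blast
  qed
  have fW: "finite ?W" using insert.hyps by simp
  have nn: "0 \<le> prb p ?W (\<lambda>B. \<forall>j\<in>I. ?c j B)" using p by (intro expect_nonneg) auto
  have "prb p (?s i \<union> ?W) (\<lambda>B. \<forall>j\<in>insert i I. ?c j B)
      = expect p (?s i) (\<lambda>B1. expect p ?W (\<lambda>B2. of_bool (\<forall>j\<in>insert i I. ?c j (B1 \<union> B2))))"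
    by (rule expect_union[OF finite_slab fW disj])
  also have "\<dots> = expect p (?s i) (\<lambda>B1. expect p ?W (\<lambda>B2. of_bool (?c i B1) * of_bool (\<forall>j\<in>I. ?c j B2)))"
  proof (intro expect_cong)
    fix B1 B2 assume B1: "B1 \<subseteq> ?s i" and B2: "B2 \<subseteq> ?W"
    have 1: "?c i (B1 \<union> B2) \<longleftrightarrow> ?c i B1"
    proof (rule some_cross_cong)
      fix x z assume x: "x \<in> {1 + i * L..L + i * L}"
      have "\<not> env n B2 (x, z)"
      proof
        assume "env n B2 (x, z)"
        then obtain j where "j \<in> I" "x \<in> {1 + j * L..L + j * L}" using B2 by (auto simp: env_def slab_def)
        then show False using cols[OF x, of j] insert.hyps by auto
      qed
      then show "env n (B1 \<union> B2) (x, z) = env n B1 (x, z)" by (simp add: env_Un)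
    qed
    have 2: "?c j (B1 \<union> B2) \<longleftrightarrow> ?c j B2" if j: "j \<in> I" for j
    proof (rule some_cross_cong)
      fix x z assume x: "x \<in> {1 + j * L..L + j * L}"
      have "\<not> env n B1 (x, z)"
        using cols[OF x, of i] j insert.hyps env_outside[OF B1, of x z] by auto
      then show "env n (B1 \<union> B2) (x, z) = env n B2 (x, z)" by (simp add: env_Un)
    qed
    show "of_bool (\<forall>j\<in>insert i I. ?c j (B1 \<union> B2)) = (of_bool (?c i B1) * of_bool (\<forall>j\<in>I. ?c j B2) :: real)"
      using 1 2 by auto
  qed
  also have "\<dots> = prb p (?s i) (?c i) * prb p ?W (\<lambda>B. \<forall>j\<in>I. ?c j B)"
    unfolding expect_cmult by (subst mult.commute, subst (2) mult.commute) (rule expect_cmult)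
  also have "prb p (?s i) (?c i) = prb p (slab n 1 L) (some_cross n 1 L)"
    by (rule prb_some_cross_shift[OF n]) (use L in auto)
  also have "\<dots> * prb p ?W (\<lambda>B. \<forall>j\<in>I. ?c j B) \<le> 1 / 2 * (1 / 2) ^ card I"
    by (rule mult_mono[OF half insert.IH]) (use nn in auto)
  finally show ?case using insert.hyps by simp
qed simp

lemma prb_all_blocks_superset_le:
  assumes n: "n > 0" and p: "0 \<le> p" "p \<le> 1" and L: "0 < L" "even L" and "finite I"
    and half: "prb p (slab n 1 L) (some_cross n 1 L) \<le> 1 / 2"
    and V: "finite V" "(\<Union>i\<in>I. slab n (1 + i * L) (L + i * L)) \<subseteq> V" (is "?W \<subseteq> V")
  shows "prb p V (\<lambda>B. \<forall>i\<in>I. some_cross n (1 + i * L) (L + i * L) B) \<le> (1 / 2) ^ card I"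
proof -
  have "prb p V (\<lambda>B. \<forall>i\<in>I. some_cross n (1 + i * L) (L + i * L) B)
      = expect p V (\<lambda>B. of_bool (\<forall>i\<in>I. some_cross n (1 + i * L) (L + i * L) (B \<inter> ?W)))"
  proof (intro expect_cong arg_cong[where f = of_bool] ball_cong refl some_cross_cong)
    fix B i x z assume "i \<in> I" "x \<in> {1 + i * L..L + i * L}"
    then have "(x, z mod (2 * int n)) \<in> ?W" using n by (auto simp: slab_def)
    then show "env n B (x, z) = env n (B \<inter> ?W) (x, z)" by (simp add: env_def)
  qed
  also have "\<dots> = prb p ?W (\<lambda>B. \<forall>i\<in>I. some_cross n (1 + i * L) (L + i * L) B)"
    by (rule expect_restrict[where F = "\<lambda>B. of_bool (\<forall>i\<in>I. some_cross n (1 + i * L) (L + i * L) B)", OF V])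
  also have "\<dots> \<le> (1 / 2) ^ card I" by (rule prb_all_blocks_le) fact+
  finally show ?thesis .
qed

section \<open>From finite sums to the product measure\<close>

lemma pmf_manhattan_site:
  assumes "0 < p" "p < 1"
  shows "pmf (manhattan_site p v) (site_of (\<lambda>w. w \<in> B) v) = (if v \<in> B then p else 1 - p)"
proof -
  obtain x y where v: "v = (x, y)" by (cases v)
  let ?f = "\<lambda>mirror. if mirror then (if even (x - y) then NW_Mirror else NE_Mirror) else No_Mirror"
  have inj: "inj ?f" by (auto simp: inj_def split: if_splits)
  have "site_of (\<lambda>w. w \<in> B) v = ?f (v \<in> B)" by (simp add: site_of_def v)
  then have "pmf (manhattan_site p v) (site_of (\<lambda>w. w \<in> B) v) = pmf (map_pmf ?f (bernoulli_pmf p)) (?f (v \<in> B))"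
    by (simp only: manhattan_site_def v prod.case)
  also have "\<dots> = pmf (bernoulli_pmf p) (v \<in> B)" by (rule pmf_map_inj'[OF inj])
  finally show ?thesis using assms by (cases "v \<in> B") simp_all
qed

text \<open>Each good configuration fixes finitely many coordinates, and the product measure of this
  set of environments is the weight of the configuration. These sets are disjoint and contained in
  \<open>A\<close>.\<close>

lemma measure_manhattan_ge:
  fixes p :: real
  assumes p: "0 < p" "p < 1" and V: "finite V" "V \<subseteq> cylinder n"
    and A: "A \<in> sets (manhattan_law p n)"
    and sub: "\<And>\<omega> B. \<omega> \<in> cylinder n \<rightarrow>\<^sub>E UNIV \<Longrightarrow> B \<subseteq> V \<Longrightarrow> good B \<Longrightarrow>
      (\<forall>v\<in>V. \<omega> v = site_of (\<lambda>w. w \<in> B) v) \<Longrightarrow> \<omega> \<in> A"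
  shows "prb p V good \<le> measure (manhattan_law p n) A"
proof -
  let ?M = "manhattan_law p n"
  interpret prob_space ?M by (rule prob_space_manhattan_law)
  interpret P: product_prob_space "\<lambda>v. measure_pmf (manhattan_site p v)" "cylinder n"
    by unfold_locales
  define S where "S B = {\<omega> \<in> space ?M. \<forall>v\<in>V. \<omega> v = site_of (\<lambda>w. w \<in> B) v}" for B
  have S: "S B = P.emb (cylinder n) V (Pi\<^sub>E V (\<lambda>v. {site_of (\<lambda>w. w \<in> B) v}))" for B
    unfolding S_def space_manhattan_law prod_emb_def by (auto simp: PiE_iff restrict_def extensional_def)
  have Sset: "S B \<in> sets ?M" for B
    unfolding S manhattan_law_def by (rule sets_PiM_I) (use V in auto)
  have meas: "measure ?M (S B) = (\<Prod>v\<in>V. if v \<in> B then p else 1 - p)" for B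
  proof -
    have "measure ?M (S B) = (\<Prod>v\<in>V. measure (measure_pmf (manhattan_site p v)) {site_of (\<lambda>w. w \<in> B) v})"
      unfolding S manhattan_law_def by (rule P.measure_PiM_emb) (use V in auto)
    also have "\<dots> = (\<Prod>v\<in>V. if v \<in> B then p else 1 - p)"
      by (intro prod.cong refl) (simp add: measure_pmf_single pmf_manhattan_site[OF p])
    finally show ?thesis .
  qed
  let ?G = "{B. B \<subseteq> V \<and> good B}"
  have fG: "finite ?G" using V by simp
  have "prb p V good = (\<Sum>B\<in>?G. measure ?M (S B))"
    unfolding expect_def meas by (rule sum.mono_neutral_cong_right) (use V in auto)
  also have "\<dots> = measure ?M (\<Union>B\<in>?G. S B)"
  proof (rule finite_measure_finite_Union[symmetric, OF fG])
    show "disjoint_family_on S ?G"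
    proof (unfold disjoint_family_on_def, intro ballI impI)
      fix B C assume B: "B \<in> ?G" "C \<in> ?G" "B \<noteq> C"
      then obtain v where v: "v \<in> V" "(v \<in> B) \<noteq> (v \<in> C)" by blast
      then have "site_of (\<lambda>w. w \<in> B) v \<noteq> site_of (\<lambda>w. w \<in> C) v" by (auto simp: site_of_def)
      then show "S B \<inter> S C = {}" unfolding S_def using v by fastforce
    qed
  qed (use Sset in auto)
  also have "\<dots> \<le> measure ?M A"
    by (rule finite_measure_mono[OF _ A]) (use sub in \<open>auto simp: S_def space_manhattan_law\<close>)
  finally show ?thesis .
qed

text \<open>A ray reaching column b + 1 crosses \<open>a..b\<close> between its last time left of a
  and its first arrival at b + 1. An escape to the left gives, read backwards, a crossing of the
  left slab.\<close>

lemma ray_confined: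
  assumes s: "b' < col s" "col s < a" and ab: "a \<le> b" "a' \<le> b'"
    and right: "\<And>y r. \<not> cross \<omega> a b y r" and left: "\<And>y r. \<not> cross \<omega> a' b' y r"
  shows "a' \<le> col (ray \<omega> s k) \<and> col (ray \<omega> s k) \<le> b"
proof (rule conjI; rule ccontr)
  assume "\<not> col (ray \<omega> s k) \<le> b"
  then obtain l r where l: "\<forall>i<l. col (ray \<omega> s i) \<le> b" "ray \<omega> s l = ((b + 1, r), East)"
    using first_arrival_East[of s b \<omega> k] s ab by (metis less_imp_le not_le order_trans)
  define m where "m = (GREATEST i. i \<le> l \<and> col (ray \<omega> s i) < a)"
  have m: "m \<le> l \<and> col (ray \<omega> s m) < a"
    unfolding m_def by (rule GreatestI_nat[where k = 0 and b = l]) (use s in auto)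
  have gt: "a \<le> col (ray \<omega> s i)" if "m < i" "i \<le> l" for i
    using Greatest_le_nat[of "\<lambda>i. i \<le> l \<and> col (ray \<omega> s i) < a" i l] that unfolding m_def by fastforce
  have "m \<noteq> l" using m l ab by auto
  then have ml: "m < l" using m by simp
  define t where "t = ray \<omega> s (Suc m)"
  have "a \<le> col t" using gt[of "Suc m"] ml unfolding t_def by simp
  then have "col (step \<omega> (ray \<omega> s m)) > col (ray \<omega> s m)" using m unfolding t_def by (simp add: ray_Suc)
  then have "t = ((col (ray \<omega> s m) + 1, row (ray \<omega> s m)), East)"
    unfolding t_def ray_Suc by (rule step_East)
  then obtain y where t: "t = ((a, y), East)" using m \<open>a \<le> col t\<close> by auto
  have "ray \<omega> t i = ray \<omega> s (Suc m + i)" for i unfolding t_def ray_add ..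
  then have "cross \<omega> a b y r"
    unfolding cross_def t[symmetric] using l gt ml by (intro exI[of _ "l - Suc m"]) auto
  then show False using right by blast
next
  assume "\<not> a' \<le> col (ray \<omega> s k)"
  then obtain l r where l: "\<forall>i<l. col (ray \<omega> s i) \<ge> a'" "ray \<omega> s l = ((a' - 1, r), West)"
    using first_arrival_West[of a' s \<omega> k] s ab by (metis less_imp_le not_le order_trans)
  define m where "m = (GREATEST i. i \<le> l \<and> b' < col (ray \<omega> s i))"
  have m: "m \<le> l \<and> b' < col (ray \<omega> s m)"
    unfolding m_def by (rule GreatestI_nat[where k = 0 and b = l]) (use s in auto)
  have gt: "col (ray \<omega> s i) \<le> b'" if "m < i" "i \<le> l" for i
    using Greatest_le_nat[of "\<lambda>i. i \<le> l \<and> b' < col (ray \<omega> s i)" i l] that unfolding m_def by fastforce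
  have "m \<noteq> l" using m l ab by auto
  then have ml: "m < l" using m by simp
  define t where "t = ray \<omega> s (Suc m)"
  have "col t \<le> b'" using gt[of "Suc m"] ml unfolding t_def by simp
  then have "col (step \<omega> (ray \<omega> s m)) < col (ray \<omega> s m)" using m unfolding t_def by (simp add: ray_Suc)
  then have "t = ((col (ray \<omega> s m) - 1, row (ray \<omega> s m)), West)"
    unfolding t_def ray_Suc by (rule step_West)
  then obtain y where t: "t = ((b', y), West)" using m \<open>col t \<le> b'\<close> by auto
  have tr: "ray \<omega> t i = ray \<omega> s (Suc m + i)" for i unfolding t_def ray_add ..
  have "cross \<omega> a' b' r y"
    by (rule cross_if_run_West[of "l - Suc m"]) (use l gt ml tr in \<open>auto simp: t[symmetric]\<close>)
  then show False using left by blast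
qed

lemma neighbour_proj:
  assumes "n > 0"
  shows "neighbour n (proj n w) h = proj n (move w h)"
  by (cases w; cases h) (simp_all add: proj_def mod_simps)

text \<open>A directed edge is recorded at its initial vertex and a ray state at the vertex it
  reaches, hence the shift of time by one. Confinement to \<open>S\<close> keeps the ray where the
  two environments are known to agree.\<close>

lemma trajectory_confined:
  assumes n: "n > 0" and y: "y \<in> {0..<2 * int n}"
    and w: "\<And>k. fst (ray \<omega>' (move (0, y) h, h) k) \<in> S"
    and \<omega>': "\<And>w. w \<in> S \<Longrightarrow> site_of \<omega>' w = \<omega> (proj n w)"
  shows "fst (trajectory n \<omega> ((0, y), h) (Suc k)) = proj n (fst (ray \<omega>' (move (0, y) h, h) k))"
proof -
  let ?s = "ray \<omega>' (move (0, y) h, h)" and ?e = "trajectory n \<omega> ((0, y), h)"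
  have nxt: "fst (next_edge n \<omega> e) = neighbour n (fst e) (snd e)" for e
    by (simp add: next_edge_def case_prod_beta Let_def)
  have suc: "?e (Suc k) = next_edge n \<omega> (?e k)" for k by (simp add: trajectory_def)
  have "neighbour n (fst (?e k)) (snd (?e k)) = proj n (fst (?s k)) \<and> snd (?e k) = snd (?s k)"
  proof (induction k)
    case 0
    have "proj n (0, y) = (0, y)" using y by (simp add: proj_def)
    then show ?case using neighbour_proj[OF n, of "(0, y)" h] by (simp add: trajectory_def)
  next
    case (Suc k)
    have "snd (?e (Suc k)) = paired (\<omega> (proj n (fst (?s k)))) (opposite (snd (?s k)))"
      unfolding suc Suc[THEN conjunct1, symmetric] Suc[THEN conjunct2, symmetric]
      by (simp add: next_edge_def case_prod_beta Let_def)
    also have "\<dots> = paired (site_of \<omega>' (fst (?s k))) (opposite (snd (?s k)))"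
      using \<omega>'[OF w] by simp
    finally have h: "snd (?e (Suc k)) = snd (?s (Suc k))"
      by (simp add: ray_Suc step_def Let_def)
    have "fst (?e (Suc k)) = proj n (fst (?s k))" unfolding suc nxt by (rule Suc[THEN conjunct1])
    moreover have "fst (?s (Suc k)) = move (fst (?s k)) (snd (?s (Suc k)))"
      by (simp add: ray_Suc step_def Let_def)
    ultimately show ?case using h neighbour_proj[OF n] by simp
  qed
  then show ?thesis unfolding suc nxt by (rule conjunct1)
qed

lemma localized_if_no_crossing:
  assumes n: "n > 0" and \<omega>: "\<omega> \<in> cylinder n \<rightarrow>\<^sub>E UNIV" and B: "B \<subseteq> slab n c d"
    and \<omega>B: "\<forall>v\<in>slab n c d. \<omega> v = site_of (\<lambda>w. w \<in> B) v"
    and right: "\<not> some_cross n a b B" "1 < a" "a \<le> b" "b \<le> d"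
    and left: "\<not> some_cross n a' b' B" "b' < -1" "a' \<le> b'" "c \<le> a'"
    and M: "- M \<le> real_of_int c" "real_of_int d \<le> M"
  shows "\<omega> \<in> localization_event n M"
proof -
  let ?N = "2 * int n"
  have site: "site_of (env n B) w = \<omega> (proj n w)" if w: "w \<in> {a'..b} \<times> UNIV" for w
  proof -
    obtain x z where wx: "w = (x, z)" by (cases w)
    have V: "proj n w \<in> slab n c d" using w right left n by (auto simp: proj_def slab_def wx)
    \<comment> \<open>The circumference is even, so reduction of the row does not change the type of
      the mirror.\<close>
    have "even (x - z mod ?N) \<longleftrightarrow> even (x - z)"
      using dvd_mod_iff[of 2 ?N z] by simp
    then have "site_of (env n B) w = site_of (\<lambda>w. w \<in> B) (proj n w)"
      by (simp add: site_of_def env_def proj_def wx)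
    then show ?thesis using \<omega>B V by simp
  qed
  have "fst (trajectory n \<omega> (u, h) k) \<in> strip n M" if "u \<in> {0} \<times> {0..<?N}" for u h k
  proof (cases k)
    case 0
    then show ?thesis using that M left right
      by (auto simp: trajectory_def strip_def cylinder_def)
  next
    case (Suc j)
    obtain y where u: "u = (0, y)" and y: "y \<in> {0..<?N}" using \<open>u \<in> _\<close> by auto
    let ?s = "(move (0, y) h, h)"
    \<comment> \<open>The first edge may lead from column 0 to column 1 or -1, which is why the
      slabs start beyond these columns.\<close>
    have cs: "b' < col ?s" "col ?s < a" using left right by (cases h; simp)+
    have conf: "a' \<le> col (ray (env n B) ?s k) \<and> col (ray (env n B) ?s k) \<le> b" for k
      by (rule ray_confined[OF cs right(3) left(3)])
        (use right(1) left(1) in \<open>auto simp: some_cross_def crosses_def\<close>)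
    have S: "fst (ray (env n B) ?s k) \<in> {a'..b} \<times> UNIV" for k
      using conf[of k] by (simp add: mem_Times_iff)
    have "fst (trajectory n \<omega> (u, h) (Suc j)) = proj n (fst (ray (env n B) ?s j))"
      unfolding u by (rule trajectory_confined[OF n y S site])
    moreover have "proj n (fst (ray (env n B) ?s j)) \<in> strip n M"
      using conf[of j] left(4) right(4) M n by (auto simp: proj_def strip_def cylinder_def)
    ultimately show ?thesis using Suc by simp
  qed
  then show ?thesis using \<omega> unfolding localization_event_def remains_in_def by blast
qed

theorem corollary1p5:
  fixes p :: real
  assumes "0 < p" and "p < 1"
  shows "\<exists>C::real. C > 0 \<and> (\<exists>n_star::nat. n_star \<ge> 1 \<and>
    (\<forall>n::nat. n \<ge> n_star \<longrightarrow> (\<forall>M::real. M \<ge> C * real n ^ 10 \<longrightarrow>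
      measure (manhattan_law p n) (localization_event n M)
        \<ge> 1 - C * exp (- (M / (C * real n ^ 10))))))"
proof -
  obtain c :: nat where c: "c > 0" "even c" and half: "\<And>n. n \<ge> 2 \<Longrightarrow>
    prb p (slab n 1 (int (c * n ^ 10))) (some_cross n 1 (int (c * n ^ 10))) \<le> 1 / 2"
    using prb_some_cross_le_half[OF assms] by blast
  have c2: "2 \<le> c" using c by presburger
  \<comment> \<open>With L = c n^10, the assumption on M becomes M at least 4 L, and the rate in the
    exponential becomes 1 / (4 L).\<close>
  define C where "C = 4 * real c"
  have C8: "8 \<le> C" using c2 by (simp add: C_def)
  have "1 - C * exp (- (M / (C * real n ^ 10))) \<le> measure (manhattan_law p n) (localization_event n M)"
    if n: "n \<ge> 2" and M: "C * real n ^ 10 \<le> M" for n M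
  proof -
    have n0: "n > 0" using n by simp
    define L where "L = int (c * n ^ 10)"
    have L: "2 \<le> L" "even L"
    proof -
      have "2 * 1 \<le> c * n ^ 10" using c2 n by (intro mult_le_mono) auto
      then show "2 \<le> L" unfolding L_def by linarith
      show "even L" using c by (simp add: L_def)
    qed
    have LC: "C * real n ^ 10 = 4 * real_of_int L" by (simp add: C_def L_def)
    have M4: "4 * real_of_int L \<le> M" using M LC by simp
    define m where "m = nat \<lfloor>M / L\<rfloor>"
    have m: "real m \<le> M / L" "M / L < real m + 1"
    proof -
      have "0 \<le> M / L" using M4 L by (intro divide_nonneg_nonneg) auto
      then have "real m = of_int \<lfloor>M / L\<rfloor>" unfolding m_def by simp
      then show "real m \<le> M / L" "M / L < real m + 1" by linarith+
    qed
    have m4: "4 \<le> m"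
    proof -
      have "4 \<le> M / L" using M4 L by (simp add: field_simps)
      then show ?thesis using m by linarith
    qed
    define K where "K = m - 1"
    have Km: "int K + 1 = int m" using m4 by (simp add: K_def)
    have mL: "real_of_int (int m * L) \<le> M" using m(1) L by (simp add: field_simps)
    define V where "V = slab n (- int m * L) (int m * L)"
    let ?c = "\<lambda>i. some_cross n (1 + i * L) (L + i * L)"
    \<comment> \<open>Blocks 0 and -1 are skipped because they do not lie beyond columns 1 and -1.
      Both index ranges have K elements, and their columns lie between -m L and m L.\<close>
    let ?R = "{1..int K}" and ?Lf = "{- int m..-2}"
    have "prb p V (\<lambda>B. (\<forall>i\<in>?R. ?c i B) \<or> (\<forall>i\<in>?Lf. ?c i B))
        \<le> prb p V (\<lambda>B. \<forall>i\<in>?R. ?c i B) + prb p V (\<lambda>B. \<forall>i\<in>?Lf. ?c i B)"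
      by (rule prb_disj_le) (use assms in auto)
    also have "\<dots> \<le> (1 / 2) ^ K + (1 / 2) ^ K"
    proof (rule add_mono)
      have sub: "slab n (1 + i * L) (L + i * L) \<subseteq> V" if "- int m \<le> i" "i \<le> int K" for i
      proof -
        have "- int m * L \<le> i * L" "(i + 1) * L \<le> int m * L"
          using that L Km by (intro mult_right_mono; simp)+
        then show ?thesis unfolding V_def slab_def by (auto simp: algebra_simps)
      qed
      have blocks: "prb p V (\<lambda>B. \<forall>i\<in>I. ?c i B) \<le> (1 / 2) ^ card I"
        if I: "finite I" "I \<subseteq> {- int m..int K}" for I
      proof (rule prb_all_blocks_superset_le[OF n0 _ _ _ L(2) I(1)])
        show "prb p (slab n 1 L) (some_cross n 1 L) \<le> 1 / 2" unfolding L_def by (rule half[OF n])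
        show "(\<Union>i\<in>I. slab n (1 + i * L) (L + i * L)) \<subseteq> V"
          by (intro UN_least sub) (use I(2) in auto)
      qed (use assms L in \<open>auto simp: V_def\<close>)
      show "prb p V (\<lambda>B. \<forall>i\<in>?R. ?c i B) \<le> (1 / 2) ^ K" using blocks[of ?R] m4 by auto
      show "prb p V (\<lambda>B. \<forall>i\<in>?Lf. ?c i B) \<le> (1 / 2) ^ K" using blocks[of ?Lf] by (simp add: Km[symmetric])
    qed
    also have "\<dots> = 2 * (1 / 2) ^ K" by simp
    also have "\<dots> \<le> C * exp (- (M / (C * real n ^ 10)))"
    proof -
      \<comment> \<open>As K is at least M / L - 2 and ln 2 at least 1 / 4, one side fails with
        probability at most 4 exp(-M / (4 L)); two sides give 8, which C dominates.\<close>
      have "(1 / 2 :: real) ^ K = exp (real K * ln (1 / 2))" by (simp add: exp_of_nat_mult)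
      also have "\<dots> = exp (- (real K * ln 2))" by (simp add: ln_div)
      also have "\<dots> \<le> exp (2 * ln 2 - M / (4 * L))"
      proof -
        have "M / L - 2 \<le> real K" using m Km by linarith
        then have 1: "(M / L - 2) * ln 2 \<le> real K * ln 2" by (intro mult_right_mono) auto
        have "1 / 4 \<le> ln (2::real)" using ln2_ge_two_thirds by simp
        then have "M / L * (1 / 4) \<le> M / L * ln 2"
          using m by (intro mult_left_mono) (auto intro: order_trans[OF of_nat_0_le_iff])
        then have "M / (4 * L) \<le> M / L * ln 2" by simp
        then show ?thesis using 1 by (simp add: left_diff_distrib)
      qed
      also have "\<dots> = 4 * exp (- (M / (4 * L)))"
        by (simp add: exp_diff exp_minus exp_double field_simps)
      finally have "2 * (1 / 2) ^ K \<le> 8 * exp (- (M / (4 * L)))" by simp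
      also have "\<dots> \<le> C * exp (- (M / (4 * L)))" using C8 by (intro mult_right_mono) auto
      finally show ?thesis unfolding LC by simp
    qed
    finally have fail: "prb p V (\<lambda>B. (\<forall>i\<in>?R. ?c i B) \<or> (\<forall>i\<in>?Lf. ?c i B)) \<le> C * exp (- (M / (C * real n ^ 10)))" .
    define good where "good B \<longleftrightarrow> \<not> ((\<forall>i\<in>?R. ?c i B) \<or> (\<forall>i\<in>?Lf. ?c i B))" for B
    have "prb p V good = 1 - prb p V (\<lambda>B. (\<forall>i\<in>?R. ?c i B) \<or> (\<forall>i\<in>?Lf. ?c i B))"
      unfolding good_def by (rule prb_not) (simp add: V_def)
    then have "1 - C * exp (- (M / (C * real n ^ 10))) \<le> prb p V good" using fail by linarith
    also have "\<dots> \<le> measure (manhattan_law p n) (localization_event n M)"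
    proof (rule measure_manhattan_ge[OF assms _ _ sets_localization_event])
      show "finite V" "V \<subseteq> cylinder n" by (auto simp: V_def slab_def cylinder_def)
      fix \<omega> B assume \<omega>: "\<omega> \<in> cylinder n \<rightarrow>\<^sub>E UNIV" and B: "B \<subseteq> V" "good B"
        and \<omega>B: "\<forall>v\<in>V. \<omega> v = site_of (\<lambda>w. w \<in> B) v"
      obtain i j where i: "1 \<le> i" "i \<le> int K" "\<not> ?c i B" and j: "- int m \<le> j" "j \<le> -2" "\<not> ?c j B"
        using B(2) unfolding good_def by auto
      have "1 * L \<le> i * L" "(i + 1) * L \<le> int m * L" "- int m * L \<le> j * L" "(j + 1) * L \<le> (- 1) * L"
        using i j L Km by (intro mult_right_mono; simp)+
      then have ineq: "1 < 1 + i * L" "L + i * L \<le> int m * L" "- int m * L \<le> 1 + j * L" "L + j * L < - 1"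
        using L by (simp_all add: algebra_simps)
      show "\<omega> \<in> localization_event n M"
        by (rule localized_if_no_crossing[OF n0 \<omega> B(1)[unfolded V_def] \<omega>B[unfolded V_def]
              i(3) ineq(1) _ ineq(2) j(3) ineq(4) _ ineq(3)])
          (use L mL in auto)
    qed
    finally show ?thesis .
  qed
  then show ?thesis using C8 by (intro exI[of _ C] conjI exI[of _ 2]) auto
qed

end
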